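(* Let $\Omega\subset\mathbb{R}^2$ be a convex polytope and let $\omega\in A_2(\Omega)$. Let $(\mathbf{V}(\mathscr{T}),\mathcal{P}(\mathscr{T}))$, $\mathscr{T}\in\mathbb{T}$, be either the mini element or the lowest order Taylor--Hood pair. Assume that: (i) the discrete Brinkman operators $\mathcal{B}_{\mathscr{T}}$ are invertible with $\|\mathcal{B}_{\mathscr{T}}^{-1}\|$ bounded uniformly over all $\mathscr{T}\in\mathbb{T}$; (ii) (stability of the Brinkman projection) there is a constant $C_{\mathscr{B}}>0$, independent of $\mathscr{T}$, such that for every $(\mathbf{w},\mathsf{r})\in\mathbf{H}_0^1(\omega,\Omega)\times L^2(\omega,\Omega)/\mathbb{R}$ with $\mathrm{div}\,\mathbf{w}=0$, its Brinkman projection satisfies $\|\nabla\mathscr{B}_{\mathscr{T}}\mathbf{w}\|_{\mathbf{L}^2(\omega,\Omega)}+\|\mathscr{B}_{\mathscr{T}}\mathsf{r}\|_{L^2(\omega,\Omega)}\le C_{\mathscr{B}}\left(\|\nabla\mathbf{w}\|_{\mathbf{L}^2(\omega,\Omega)}+\|\mathsf{r}\|_{L^2(\omega,\Omega)}\right)$. Let $\mathbf{f}\in\mathbf{H}^{-1}(\omega,\Omega)$ be sufficiently small so that $$C_e\|\mathcal{B}^{-1}\|^2\|\mathbf{f}\|_{\mathbf{H}^{-1}(\omega,\Omega)}<\tfrac16,\qquad C_e\|\mathcal{B}_{\mathscr{T}}^{-1}\|^2\|\mathbf{f}\|_{\mathbf{H}^{-1}(\omega,\Omega)}<\tfrac16,$$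 $$\frac{3C}{2}\|\mathbf{f}\|_{\mathbf{H}^{-1}(\omega,\Omega)}\left[\|\mathcal{B}^{-1}\|+\|\mathcal{B}_{\mathscr{T}}^{-1}\|\right]<\frac12,\qquad C:=C_{\mathscr{B}}\,C_{4\to2}^2(1+C_{2\to2}).$$ Let $(\mathbf{u},\mathsf{p})$ be the solution of the continuous problem and $(\mathbf{u}_{\mathscr{T}},\mathsf{p}_{\mathscr{T}})$ the solution of the discrete problem (both given in the context). Then $$\|\nabla(\mathbf{u}-\mathbf{u}_{\mathscr{T}})\|_{\mathbf{L}^2(\omega,\Omega)}+\|\mathsf{p}-\mathsf{p}_{\mathscr{T}}\|_{L^2(\omega,\Omega)}\le C'\left(\inf_{\mathbf{w}_{\mathscr{T}}\in\mathbf{V}(\mathscr{T})}\|\nabla(\mathbf{u}-\mathbf{w}_{\mathscr{T}})\|_{\mathbf{L}^2(\omega,\Omega)}+\inf_{\mathsf{q}_{\mathscr{T}}\in\mathcal{P}(\mathscr{T})}\|\mathsf{p}-\mathsf{q}_{\mathscr{T}}\|_{L^2(\omega,\Omega)}\right),$$ where the constant $C'>0$ may depend on $\mathbf{f}$ and $\mathbf{u}$, but is independent of the mesh size $h_{\mathscr{T}}$.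
   Context: A weight is a nonnegative locally integrable function on $\mathbb{R}^2$. $\omega\in A_2$ means $\sup_B\left(\frac{1}{|B|}\int_B\omega\right)\left(\frac{1}{|B|}\int_B\omega^{-1}\right)<\infty$ over all balls $B$. For a Lipschitz domain $D$, $A_2(D)$ consists of those $\varpi\in A_2$ for which there are an open set $\mathcal{G}\subset D$ and $\epsilon,\varpi_l>0$ with $\{\mathbf{x}\in D:\mathrm{dist}(\mathbf{x},\partial D)<\epsilon\}\subset\mathcal{G}$, $\varpi\in C(\overline{\mathcal{G}})$, and $\varpi_l\le\varpi$ on $\overline{\mathcal{G}}$. $L^p(\omega,\Omega)$ is the Lebesgue space with respect to $\omega\,d\mathbf{x}$; $H^1(\omega,\Omega)$ is the space of $v\in L^2(\omega,\Omega)$ with weak gradient in $\mathbf{L}^2(\omega,\Omega)$; $H_0^1(\omega,\Omega)$ is the closure of $C_0^\infty(\Omega)$ in it, normed by $\|\nabla v\|_{\mathbf{L}^2(\omega,\Omega)}$. Boldface denotes vector-valued objects. $L^2(\omega,\Omega)/\mathbb{R}$ is identified with the zero-integral functions in $L^2(\omega,\Omega)$. $\mathbf{H}^{-1}(\omega,\Omega):=\mathbf{H}_0^1(\omega^{-1},\Omega)'$ with dual norm and pairing $\langle\cdot,\cdot\rangle$. $\mathcal{X}:=\mathbf{H}_0^1(\omega,\Omega)\times L^2(\omega,\Omega)/\mathbb{R}$, $\mathcal{Y}:=\mathbf{H}_0^1(\omega^{-1},\Omega)\times L^2(\omega^{-1},\Omega)/\mathbb{R}$, with norms $\|\nabla\mathbf{v}\|_{\mathbf{L}^2(\omega^{\pm1},\Omega)}+\|\mathsf{q}\|_{L^2(\omega^{\pm1},\Omega)}$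 ($+$ for $\mathcal{X}$, $-$ for $\mathcal{Y}$). Forms: $a(\mathbf{w},\mathbf{v})=\int_\Omega(\nabla\mathbf{w}:\nabla\mathbf{v}+\mathbf{w}\cdot\mathbf{v})$; $b_\pm(\mathbf{v},\mathsf{q})=-\int_\Omega\mathsf{q}\,\mathrm{div}\,\mathbf{v}$ on $\mathbf{H}_0^1(\omega^{\pm1},\Omega)\times L^2(\omega^{\mp1},\Omega)/\mathbb{R}$; $c(\mathbf{u},\mathbf{w};\mathbf{v})=-\int_\Omega\mathbf{u}\otimes\mathbf{w}:\nabla\mathbf{v}$; $d(\mathbf{u},\mathbf{w};\mathbf{v})=\int_\Omega|\mathbf{u}|\,\mathbf{w}\cdot\mathbf{v}$. $C_{4\to2}$ and $C_{2\to2}$ are the best constants in $\mathbf{H}_0^1(\omega,\Omega)\hookrightarrow\mathbf{L}^4(\omega,\Omega)$ and $\mathbf{H}_0^1(\omega^{-1},\Omega)\hookrightarrow\mathbf{L}^2(\omega^{-1},\Omega)$ (gradient norms on the left-hand spaces); $C_e:=C_{4\to2}^2(1+C_{2\to2})$. $\mathcal{B}:\mathcal{X}\to\mathcal{Y}'$, $\langle\mathcal{B}(\mathbf{u},\mathsf{p}),(\mathbf{v},\mathsf{q})\rangle=a(\mathbf{u},\mathbf{v})+b_-(\mathbf{v},\mathsf{p})+b_+(\mathbf{u},\mathsf{q})$, which is boundedly invertible; $\|\mathcal{B}^{-1}\|$ is the $\mathcal{Y}'\to\mathcal{X}$ operator norm. Continuous problem: find $(\mathbf{u},\mathsf{p})\in\mathcal{X}$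 with $a(\mathbf{u},\mathbf{v})+b_-(\mathbf{v},\mathsf{p})+c(\mathbf{u},\mathbf{u};\mathbf{v})+d(\mathbf{u},\mathbf{u};\mathbf{v})=\langle\mathbf{f},\mathbf{v}\rangle$ and $b_+(\mathbf{u},\mathsf{q})=0$ for all $(\mathbf{v},\mathsf{q})\in\mathcal{Y}$. Discrete problem: find $(\mathbf{u}_{\mathscr{T}},\mathsf{p}_{\mathscr{T}})\in\mathbf{V}(\mathscr{T})\times\mathcal{P}(\mathscr{T})$ satisfying the same equations for all test functions in $\mathbf{V}(\mathscr{T})\times\mathcal{P}(\mathscr{T})$. Under the first two smallness conditions these problems are uniquely solvable, with $\|\nabla\mathbf{u}\|_{\mathbf{L}^2(\omega,\Omega)}\le\frac32\|\mathcal{B}^{-1}\|\|\mathbf{f}\|_{\mathbf{H}^{-1}(\omega,\Omega)}$ and $\|\nabla\mathbf{u}_{\mathscr{T}}\|_{\mathbf{L}^2(\omega,\Omega)}\le\frac32\|\mathcal{B}_{\mathscr{T}}^{-1}\|\|\mathbf{f}\|_{\mathbf{H}^{-1}(\omega,\Omega)}$. $\mathbb{T}$ is a collection of shape regular conforming triangulations $\mathscr{T}$ of $\overline\Omega$ into closed triangles, all refinements of an initial mesh; $h_{\mathscr{T}}=\max_{K\in\mathscr{T}}\mathrm{diam}(K)$. In both pairs, $\mathcal{P}(\mathscr{T})=\{\mathsf{q}\in L_0^2(\Omega)\cap C(\overline\Omega):\mathsf{q}|_K\in\mathbb{P}_1(K)\ \forall K\in\mathscr{T}\}$ ($L_0^2$: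 zero integral). Mini element: $\mathbf{V}(\mathscr{T})=\{\mathbf{v}\in\mathbf{C}(\overline\Omega):\mathbf{v}|_K\in[\mathbb{P}_1(K)\oplus\mathbb{B}(K)]^2\ \forall K\}\cap\mathbf{H}_0^1(\Omega)$, with $\mathbb{B}(K)$ spanned by a local bubble function (standard choice: the product of the three barycentric coordinates). Taylor--Hood: $\mathbf{V}(\mathscr{T})=\{\mathbf{v}\in\mathbf{C}(\overline\Omega):\mathbf{v}|_K\in[\mathbb{P}_2(K)]^2\ \forall K\}\cap\mathbf{H}_0^1(\Omega)$. $\mathcal{B}_{\mathscr{T}}$ maps $\mathbf{V}(\mathscr{T})\times\mathcal{P}(\mathscr{T})$ into its dual by the same formula as $\mathcal{B}$; $\|\mathcal{B}_{\mathscr{T}}^{-1}\|$ is the operator norm of its inverse, trial functions carrying the $\mathcal{X}$-norm and functionals the dual norm with respect to the $\mathcal{Y}$-norm. The Brinkman projection of $(\mathbf{w},\mathsf{r})\in\mathcal{X}$, $\mathrm{div}\,\mathbf{w}=0$, is the pair $(\mathscr{B}_{\mathscr{T}}\mathbf{w},\mathscr{B}_{\mathscr{T}}\mathsf{r})\in\mathbf{V}(\mathscr{T})\times\mathcal{P}(\mathscr{T})$ such that $a(\mathscr{B}_{\mathscr{T}}\mathbf{w},\mathbf{v}_{\mathscr{T}})+b_-(\mathbf{v}_{\mathscr{T}},\mathscr{B}_{\mathscr{T}}\mathsf{r})=a(\mathbf{w},\mathbf{v}_{\mathscr{T}})+b_-(\mathbf{v}_{\mathscr{T}},\mathsf{r})$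 and $b_+(\mathscr{B}_{\mathscr{T}}\mathbf{w},\mathsf{q}_{\mathscr{T}})=0$ for all $\mathbf{v}_{\mathscr{T}}\in\mathbf{V}(\mathscr{T})$, $\mathsf{q}_{\mathscr{T}}\in\mathcal{P}(\mathscr{T})$. *)

theory Defs
  imports "HOL-Analysis.Analysis"
begin

type_synonym scalar = "real^2 \<Rightarrow> real"
type_synonym vfield = "real^2 \<Rightarrow> real^2"
type_synonym mesh = "(real^2) set set"

section \<open>Domain and weights\<close>

text \<open>The polytope itself is the closure; \<open>\<Omega>\<close> is its (nonempty) interior.\<close>

definition convex_polytope_domain :: "(real^2) set \<Rightarrow> bool" where
  "convex_polytope_domain \<Omega> \<longleftrightarrow> open \<Omega> \<and> convex \<Omega> \<and> \<Omega> \<noteq> {} \<and> polytope (closure \<Omega>)"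

definition locally_integrable_on ::
    "(real^2) set \<Rightarrow> (real^2 \<Rightarrow> 'b::{banach,second_countable_topology}) \<Rightarrow> bool" where
  "locally_integrable_on \<Omega> g \<longleftrightarrow> (\<forall>K. compact K \<and> K \<subseteq> \<Omega> \<longrightarrow> integrable (lebesgue_on K) g)"

definition weight :: "scalar \<Rightarrow> bool" where
  "weight \<omega> \<longleftrightarrow> (\<forall>x. 0 \<le> \<omega> x) \<and> locally_integrable_on UNIV \<omega>"

definition average :: "(real^2) set \<Rightarrow> scalar \<Rightarrow> ennreal" where
  "average B g = (\<integral>\<^sup>+x. ennreal (g x) \<partial>lebesgue_on B) / emeasure lebesgue B"

definition inv_weight :: "scalar \<Rightarrow> scalar" where
  "inv_weight \<omega> = (\<lambda>x. inverse (\<omega> x))"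

text \<open>Positivity almost everywhere is stated separately: the real \<open>inverse 0 = 0\<close> would otherwise
  hide the points where \<open>\<omega>\<^sup>-\<^sup>1 = \<infinity>\<close>.\<close>

definition A2 :: "scalar \<Rightarrow> bool" where
  "A2 \<omega> \<longleftrightarrow> weight \<omega> \<and> (AE x in lebesgue. 0 < \<omega> x) \<and>
     (SUP (x, r) \<in> UNIV \<times> {0<..}. average (ball x r) \<omega> * average (ball x r) (inv_weight \<omega>)) < \<infinity>"

definition A2_on :: "(real^2) set \<Rightarrow> scalar \<Rightarrow> bool" where
  "A2_on D \<omega> \<longleftrightarrow> A2 \<omega> \<and>
     (\<exists>G \<epsilon> \<omega>l. open G \<and> G \<subseteq> D \<and> 0 < \<epsilon> \<and> 0 < \<omega>l \<and>
        {x \<in> D. infdist x (frontier D) < \<epsilon>} \<subseteq> G \<and>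
        continuous_on (closure G) \<omega> \<and> (\<forall>x \<in> closure G. \<omega>l \<le> \<omega> x))"

section \<open>Weighted Lebesgue and Sobolev spaces\<close>

text \<open>Elements of function spaces are represented by functions on the whole plane of which only the
  values in \<open>\<Omega>\<close> (up to null sets) matter.\<close>

definition Lp ::
    "nat \<Rightarrow> scalar \<Rightarrow> (real^2) set \<Rightarrow> (real^2 \<Rightarrow> 'b::real_normed_vector) set" where
  "Lp p \<omega> \<Omega> = {g \<in> borel_measurable (lebesgue_on \<Omega>).
     integrable (lebesgue_on \<Omega>) (\<lambda>x. norm (g x) ^ p * \<omega> x)}"

definition Lp_norm ::
    "nat \<Rightarrow> scalar \<Rightarrow> (real^2) set \<Rightarrow> (real^2 \<Rightarrow> 'b::real_normed_vector) \<Rightarrow> real" where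
  "Lp_norm p \<omega> \<Omega> g = root p (LINT x|lebesgue_on \<Omega>. norm (g x) ^ p * \<omega> x)"

definition L2_zero_mean :: "scalar \<Rightarrow> (real^2) set \<Rightarrow> scalar set" where
  "L2_zero_mean \<omega> \<Omega> = {q \<in> Lp 2 \<omega> \<Omega>. (LINT x|lebesgue_on \<Omega>. q x) = 0}"

definition partial_deriv :: "2 \<Rightarrow> scalar \<Rightarrow> scalar" where
  "partial_deriv i g = (\<lambda>x. frechet_derivative g (at x) (axis i 1))"

primrec C_k :: "nat \<Rightarrow> scalar \<Rightarrow> bool" where
  "C_k 0 g \<longleftrightarrow> continuous_on UNIV g"
| "C_k (Suc k) g \<longleftrightarrow> (\<forall>x. g differentiable (at x)) \<and> (\<forall>i. C_k k (partial_deriv i g))"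

definition C0_infinity :: "(real^2) set \<Rightarrow> scalar set" where
  "C0_infinity \<Omega> = {\<phi>. (\<forall>k. C_k k \<phi>) \<and> compact (closure {x. \<phi> x \<noteq> 0}) \<and>
     closure {x. \<phi> x \<noteq> 0} \<subseteq> \<Omega>}"

definition has_weak_gradient :: "(real^2) set \<Rightarrow> scalar \<Rightarrow> vfield \<Rightarrow> bool" where
  "has_weak_gradient \<Omega> v g \<longleftrightarrow> locally_integrable_on \<Omega> v \<and> locally_integrable_on \<Omega> g \<and>
     (\<forall>\<phi> \<in> C0_infinity \<Omega>. \<forall>i.
        (LINT x|lebesgue_on \<Omega>. v x * partial_deriv i \<phi> x) =
        - (LINT x|lebesgue_on \<Omega>. g x $ i * \<phi> x))"

text \<open>The weak gradient is unique up to a null set, so the choice is immaterial.\<close>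

definition weak_grad :: "(real^2) set \<Rightarrow> scalar \<Rightarrow> vfield" where
  "weak_grad \<Omega> v = (SOME g. has_weak_gradient \<Omega> v g)"

definition H1 :: "scalar \<Rightarrow> (real^2) set \<Rightarrow> scalar set" where
  "H1 \<omega> \<Omega> = {v \<in> Lp 2 \<omega> \<Omega>. \<exists>g \<in> Lp 2 \<omega> \<Omega>. has_weak_gradient \<Omega> v g}"

definition H1_norm :: "scalar \<Rightarrow> (real^2) set \<Rightarrow> scalar \<Rightarrow> real" where
  "H1_norm \<omega> \<Omega> v = sqrt ((Lp_norm 2 \<omega> \<Omega> v)\<^sup>2 + (Lp_norm 2 \<omega> \<Omega> (weak_grad \<Omega> v))\<^sup>2)"

definition H10 :: "scalar \<Rightarrow> (real^2) set \<Rightarrow> scalar set" where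
  "H10 \<omega> \<Omega> = {v \<in> H1 \<omega> \<Omega>.
     \<forall>\<epsilon>>0. \<exists>\<phi> \<in> C0_infinity \<Omega>. H1_norm \<omega> \<Omega> (\<lambda>x. v x - \<phi> x) < \<epsilon>}"

definition H10_vec :: "scalar \<Rightarrow> (real^2) set \<Rightarrow> vfield set" where
  "H10_vec \<omega> \<Omega> = {v. \<forall>i. (\<lambda>x. v x $ i) \<in> H10 \<omega> \<Omega>}"

text \<open>Row \<open>i\<close> is the gradient of the \<open>i\<close>-th component.  The inner product and norm of
  \<^typ>\<open>real^2^2\<close> are the Frobenius ones.\<close>

definition grad :: "(real^2) set \<Rightarrow> vfield \<Rightarrow> real^2 \<Rightarrow> real^2^2" where
  "grad \<Omega> v x = (\<chi> i. weak_grad \<Omega> (\<lambda>y. v y $ i) x)"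

definition divergence :: "(real^2) set \<Rightarrow> vfield \<Rightarrow> scalar" where
  "divergence \<Omega> v x = trace (grad \<Omega> v x)"

definition grad_norm :: "scalar \<Rightarrow> (real^2) set \<Rightarrow> vfield \<Rightarrow> real" where
  "grad_norm \<omega> \<Omega> v = Lp_norm 2 \<omega> \<Omega> (grad \<Omega> v)"

text \<open>\<open>pair_space \<omega> \<Omega>\<close> and \<open>pair_norm \<omega> \<Omega>\<close> give the space \<open>X\<close> and its norm; with
  \<open>inv_weight \<omega>\<close> in place of \<open>\<omega>\<close> they give \<open>Y\<close>.\<close>

definition pair_space :: "scalar \<Rightarrow> (real^2) set \<Rightarrow> (vfield \<times> scalar) set" where
  "pair_space \<omega> \<Omega> = H10_vec \<omega> \<Omega> \<times> L2_zero_mean \<omega> \<Omega>"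

definition pair_norm :: "scalar \<Rightarrow> (real^2) set \<Rightarrow> vfield \<times> scalar \<Rightarrow> real" where
  "pair_norm \<omega> \<Omega> y = grad_norm \<omega> \<Omega> (fst y) + Lp_norm 2 \<omega> \<Omega> (snd y)"

text \<open>Best constant of \<open>H10_vec \<omega> \<Omega>\<close> in \<open>Lp p \<omega> \<Omega>\<close>; it is \<open>\<infinity>\<close> exactly if there is no such
  (bounded) embedding.\<close>

definition embedding_const :: "nat \<Rightarrow> scalar \<Rightarrow> (real^2) set \<Rightarrow> ennreal" where
  "embedding_const p \<omega> \<Omega> = Inf {ennreal C |C. 0 \<le> C \<and>
     (\<forall>v \<in> H10_vec \<omega> \<Omega>. v \<in> Lp p \<omega> \<Omega> \<and> Lp_norm p \<omega> \<Omega> v \<le> C * grad_norm \<omega> \<Omega> v)}"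

definition C_e :: "scalar \<Rightarrow> (real^2) set \<Rightarrow> ennreal" where
  "C_e \<omega> \<Omega> = (embedding_const 4 \<omega> \<Omega>)\<^sup>2 * (1 + embedding_const 2 (inv_weight \<omega>) \<Omega>)"

section \<open>Dual spaces and operators given by bilinear forms\<close>

definition lincomb ::
    "real \<Rightarrow> ('a \<Rightarrow> 'b::real_vector) \<Rightarrow> real \<Rightarrow> ('a \<Rightarrow> 'b) \<Rightarrow> 'a \<Rightarrow> 'b" where
  "lincomb a v b w = (\<lambda>x. a *\<^sub>R v x + b *\<^sub>R w x)"

definition lincomb_pair ::
    "real \<Rightarrow> vfield \<times> scalar \<Rightarrow> real \<Rightarrow> vfield \<times> scalar \<Rightarrow> vfield \<times> scalar" where
  "lincomb_pair a y b z =
     (lincomb a (fst y) b (fst z), lincomb a (snd y) b (snd z))"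

text \<open>Bounded linear functionals on the subspace \<open>S\<close> with norm \<open>N\<close>, where \<open>lc\<close> is the linear
  combination of two elements; the values outside \<open>S\<close> are irrelevant.\<close>

definition dual_space ::
    "(real \<Rightarrow> 'e \<Rightarrow> real \<Rightarrow> 'e \<Rightarrow> 'e) \<Rightarrow> 'e set \<Rightarrow> ('e \<Rightarrow> real) \<Rightarrow> ('e \<Rightarrow> real) set" where
  "dual_space lc S N = {F.
     (\<forall>a b. \<forall>y \<in> S. \<forall>z \<in> S. F (lc a y b z) = a * F y + b * F z) \<and>
     (\<exists>M. \<forall>y \<in> S. \<bar>F y\<bar> \<le> M * N y)}"

definition dual_norm :: "'e set \<Rightarrow> ('e \<Rightarrow> real) \<Rightarrow> ('e \<Rightarrow> real) \<Rightarrow> real" where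
  "dual_norm S N F = (SUP y \<in> {y \<in> S. N y \<le> 1}. \<bar>F y\<bar>)"

definition H_minus1 :: "scalar \<Rightarrow> (real^2) set \<Rightarrow> (vfield \<Rightarrow> real) set" where
  "H_minus1 \<omega> \<Omega> =
     dual_space lincomb (H10_vec (inv_weight \<omega>) \<Omega>) (grad_norm (inv_weight \<omega>) \<Omega>)"

definition H_minus1_norm :: "scalar \<Rightarrow> (real^2) set \<Rightarrow> (vfield \<Rightarrow> real) \<Rightarrow> real" where
  "H_minus1_norm \<omega> \<Omega> F =
     dual_norm (H10_vec (inv_weight \<omega>) \<Omega>) (grad_norm (inv_weight \<omega>) \<Omega>) F"

text \<open>A form \<open>B\<close> is regarded as the operator \<open>y \<mapsto> B y\<close> from \<open>S\<close> (norm \<open>NS\<close>) to the dual of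
  \<open>T\<close> (norm \<open>NT\<close>).  As elements are functions rather than classes of functions, injectivity
  says that the kernel consists of elements of norm zero, and the operator inverse is a choice of
  representative.\<close>

definition op_invertible ::
    "(vfield \<times> scalar) set \<Rightarrow> (vfield \<times> scalar \<Rightarrow> real) \<Rightarrow>
     (vfield \<times> scalar) set \<Rightarrow> (vfield \<times> scalar \<Rightarrow> real) \<Rightarrow>
     (vfield \<times> scalar \<Rightarrow> vfield \<times> scalar \<Rightarrow> real) \<Rightarrow> bool" where
  "op_invertible S NS T NT B \<longleftrightarrow>
     (\<forall>F \<in> dual_space lincomb_pair T NT. \<exists>y \<in> S. \<forall>z \<in> T. B y z = F z) \<and>
     (\<forall>y \<in> S. (\<forall>z \<in> T. B y z = 0) \<longrightarrow> NS y = 0)"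

definition op_inverse ::
    "(vfield \<times> scalar) set \<Rightarrow> (vfield \<times> scalar) set \<Rightarrow>
     (vfield \<times> scalar \<Rightarrow> vfield \<times> scalar \<Rightarrow> real) \<Rightarrow>
     (vfield \<times> scalar \<Rightarrow> real) \<Rightarrow> vfield \<times> scalar" where
  "op_inverse S T B F = (SOME y. y \<in> S \<and> (\<forall>z \<in> T. B y z = F z))"

definition op_inverse_norm ::
    "(vfield \<times> scalar) set \<Rightarrow> (vfield \<times> scalar \<Rightarrow> real) \<Rightarrow>
     (vfield \<times> scalar) set \<Rightarrow> (vfield \<times> scalar \<Rightarrow> real) \<Rightarrow>
     (vfield \<times> scalar \<Rightarrow> vfield \<times> scalar \<Rightarrow> real) \<Rightarrow> ennreal" where
  "op_inverse_norm S NS T NT B =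
     (SUP F \<in> {F \<in> dual_space lincomb_pair T NT. dual_norm T NT F \<le> 1}.
        ennreal (NS (op_inverse S T B F)))"

section \<open>Forms and the continuous problem\<close>

definition a_form :: "(real^2) set \<Rightarrow> vfield \<Rightarrow> vfield \<Rightarrow> real" where
  "a_form \<Omega> w v = (LINT x|lebesgue_on \<Omega>. grad \<Omega> w x \<bullet> grad \<Omega> v x + w x \<bullet> v x)"

text \<open>\<open>b\<^sub>+\<close> and \<open>b\<^sub>-\<close> are given by the same formula on different spaces.\<close>

definition b_form :: "(real^2) set \<Rightarrow> vfield \<Rightarrow> scalar \<Rightarrow> real" where
  "b_form \<Omega> v q = - (LINT x|lebesgue_on \<Omega>. q x * divergence \<Omega> v x)"

definition tensor :: "real^2 \<Rightarrow> real^2 \<Rightarrow> real^2^2" where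
  "tensor y z = (\<chi> i j. y $ i * z $ j)"

definition c_form :: "(real^2) set \<Rightarrow> vfield \<Rightarrow> vfield \<Rightarrow> vfield \<Rightarrow> real" where
  "c_form \<Omega> u w v = - (LINT x|lebesgue_on \<Omega>. tensor (u x) (w x) \<bullet> grad \<Omega> v x)"

definition d_form :: "(real^2) set \<Rightarrow> vfield \<Rightarrow> vfield \<Rightarrow> vfield \<Rightarrow> real" where
  "d_form \<Omega> u w v = (LINT x|lebesgue_on \<Omega>. norm (u x) * (w x \<bullet> v x))"

definition brinkman_form ::
    "(real^2) set \<Rightarrow> vfield \<times> scalar \<Rightarrow> vfield \<times> scalar \<Rightarrow> real" where
  "brinkman_form \<Omega> = (\<lambda>(u, p) (v, q). a_form \<Omega> u v + b_form \<Omega> v p + b_form \<Omega> u q)"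

definition brinkman_inv_norm :: "scalar \<Rightarrow> (real^2) set \<Rightarrow> ennreal" where
  "brinkman_inv_norm \<omega> \<Omega> =
     op_inverse_norm (pair_space \<omega> \<Omega>) (pair_norm \<omega> \<Omega>)
       (pair_space (inv_weight \<omega>) \<Omega>) (pair_norm (inv_weight \<omega>) \<Omega>) (brinkman_form \<Omega>)"

definition continuous_solution ::
    "scalar \<Rightarrow> (real^2) set \<Rightarrow> (vfield \<Rightarrow> real) \<Rightarrow> vfield \<Rightarrow> scalar \<Rightarrow> bool" where
  "continuous_solution \<omega> \<Omega> f u p \<longleftrightarrow> (u, p) \<in> pair_space \<omega> \<Omega> \<and>
     (\<forall>(v, q) \<in> pair_space (inv_weight \<omega>) \<Omega>.
        a_form \<Omega> u v + b_form \<Omega> v p + c_form \<Omega> u u v + d_form \<Omega> u u v = f v \<and>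
        b_form \<Omega> u q = 0)"

section \<open>Meshes and finite element spaces\<close>

definition conforming_mesh :: "(real^2) set \<Rightarrow> mesh \<Rightarrow> bool" where
  "conforming_mesh \<Omega> \<T> \<longleftrightarrow> triangulation \<T> \<and> (\<forall>K \<in> \<T>. 2 simplex K) \<and> \<Union>\<T> = closure \<Omega>"

definition inner_diameter :: "(real^2) set \<Rightarrow> real" where
  "inner_diameter K = Sup {2 * r |r. 0 \<le> r \<and> (\<exists>x. cball x r \<subseteq> K)}"

definition mesh_family :: "(real^2) set \<Rightarrow> mesh set \<Rightarrow> bool" where
  "mesh_family \<Omega> TT \<longleftrightarrow>
     (\<forall>\<T> \<in> TT. conforming_mesh \<Omega> \<T>) \<and>
     (\<exists>\<sigma>>0. \<forall>\<T> \<in> TT. \<forall>K \<in> \<T>. diameter K \<le> \<sigma> * inner_diameter K) \<and>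
     (\<exists>\<T>0. conforming_mesh \<Omega> \<T>0 \<and> (\<forall>\<T> \<in> TT. \<forall>K \<in> \<T>. \<exists>K0 \<in> \<T>0. K \<subseteq> K0))"

definition polynomials :: "nat \<Rightarrow> scalar set" where
  "polynomials k =
     {g. \<exists>c. \<forall>x. g x = (\<Sum>(i, j) \<in> {(i, j). i + j \<le> k}. c i j * (x $ 1) ^ i * (x $ 2) ^ j)}"

definition barycentric :: "(real^2) set \<Rightarrow> real^2 \<Rightarrow> scalar" where
  "barycentric K z = (THE l. l \<in> polynomials 1 \<and>
     (\<forall>y. y extreme_point_of K \<longrightarrow> l y = (if y = z then 1 else 0)))"

definition bubble :: "(real^2) set \<Rightarrow> scalar" where
  "bubble K x = (\<Prod>z \<in> {z. z extreme_point_of K}. barycentric K z x)"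

definition pressure_space :: "(real^2) set \<Rightarrow> mesh \<Rightarrow> scalar set" where
  "pressure_space \<Omega> \<T> = {q \<in> L2_zero_mean (\<lambda>_. 1) \<Omega>. continuous_on (closure \<Omega>) q \<and>
     (\<forall>K \<in> \<T>. \<exists>g \<in> polynomials 1. \<forall>x \<in> K. q x = g x)}"

definition mini_velocity :: "(real^2) set \<Rightarrow> mesh \<Rightarrow> vfield set" where
  "mini_velocity \<Omega> \<T> = {v \<in> H10_vec (\<lambda>_. 1) \<Omega>. continuous_on (closure \<Omega>) v \<and>
     (\<forall>K \<in> \<T>. \<forall>i. \<exists>g \<in> polynomials 1. \<exists>\<beta>. \<forall>x \<in> K. v x $ i = g x + \<beta> * bubble K x)}"

definition taylor_hood_velocity :: "(real^2) set \<Rightarrow> mesh \<Rightarrow> vfield set" where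
  "taylor_hood_velocity \<Omega> \<T> = {v \<in> H10_vec (\<lambda>_. 1) \<Omega>. continuous_on (closure \<Omega>) v \<and>
     (\<forall>K \<in> \<T>. \<forall>i. \<exists>g \<in> polynomials 2. \<forall>x \<in> K. v x $ i = g x)}"

section \<open>Discrete problem and Brinkman projection\<close>

text \<open>Below, \<open>V\<close> and \<open>P\<close> are the velocity and pressure spaces of one mesh.\<close>

definition discrete_invertible ::
    "scalar \<Rightarrow> (real^2) set \<Rightarrow> vfield set \<Rightarrow> scalar set \<Rightarrow> bool" where
  "discrete_invertible \<omega> \<Omega> V P \<longleftrightarrow>
     op_invertible (V \<times> P) (pair_norm \<omega> \<Omega>) (V \<times> P) (pair_norm (inv_weight \<omega>) \<Omega>)
       (brinkman_form \<Omega>)"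

definition discrete_inv_norm ::
    "scalar \<Rightarrow> (real^2) set \<Rightarrow> vfield set \<Rightarrow> scalar set \<Rightarrow> ennreal" where
  "discrete_inv_norm \<omega> \<Omega> V P =
     op_inverse_norm (V \<times> P) (pair_norm \<omega> \<Omega>) (V \<times> P) (pair_norm (inv_weight \<omega>) \<Omega>)
       (brinkman_form \<Omega>)"

definition discrete_solution ::
    "(real^2) set \<Rightarrow> vfield set \<Rightarrow> scalar set \<Rightarrow> (vfield \<Rightarrow> real) \<Rightarrow> vfield \<Rightarrow> scalar \<Rightarrow> bool" where
  "discrete_solution \<Omega> V P f u p \<longleftrightarrow> u \<in> V \<and> p \<in> P \<and>
     (\<forall>v \<in> V. \<forall>q \<in> P.
        a_form \<Omega> u v + b_form \<Omega> v p + c_form \<Omega> u u v + d_form \<Omega> u u v = f v \<and>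
        b_form \<Omega> u q = 0)"

definition brinkman_projection ::
    "(real^2) set \<Rightarrow> vfield set \<Rightarrow> scalar set \<Rightarrow> vfield \<Rightarrow> scalar \<Rightarrow> vfield \<Rightarrow> scalar \<Rightarrow> bool" where
  "brinkman_projection \<Omega> V P w r Bw Br \<longleftrightarrow> Bw \<in> V \<and> Br \<in> P \<and>
     (\<forall>v \<in> V. \<forall>q \<in> P.
        a_form \<Omega> Bw v + b_form \<Omega> v Br = a_form \<Omega> w v + b_form \<Omega> v r \<and>
        b_form \<Omega> Bw q = 0)"

definition brinkman_projection_stable ::
    "scalar \<Rightarrow> (real^2) set \<Rightarrow> vfield set \<Rightarrow> scalar set \<Rightarrow> real \<Rightarrow> bool" where
  "brinkman_projection_stable \<omega> \<Omega> V P C \<longleftrightarrow>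
     (\<forall>(w, r) \<in> pair_space \<omega> \<Omega>. (AE x in lebesgue_on \<Omega>. divergence \<Omega> w x = 0) \<longrightarrow>
        (\<forall>Bw Br. brinkman_projection \<Omega> V P w r Bw Br \<longrightarrow>
           grad_norm \<omega> \<Omega> Bw + Lp_norm 2 \<omega> \<Omega> Br \<le>
             C * (grad_norm \<omega> \<Omega> w + Lp_norm 2 \<omega> \<Omega> r)))"

end

theory Submission
  imports Defs
begin

text \<open>
  The discrete solution \<open>(uT, pT)\<close> is compared with an arbitrary pair \<open>(w, q)\<close> of the same finite element
  spaces.  Subtract the discrete equations from the continuous ones: tested with a discrete pair, the
  Brinkman form of \<open>y = (uT - w, pT - q)\<close> equals the Brinkman form of the approximation error
  \<open>(u - w, p - q)\<close> plus the difference of the two convective terms at \<open>u\<close> and at \<open>uT\<close>.  The first part is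
  bounded by the norm of the approximation error.  The second part is locally Lipschitz, with bound
  \<open>C_e (\<parallel>\<nabla>u\<parallel> + \<parallel>\<nabla>uT\<parallel>) \<parallel>\<nabla>(u - uT)\<parallel>\<close> (lemma \<open>nonlinear_difference_bound\<close>).  If \<open>D\<close> is the norm of the inverse
  of the discrete Brinkman operator, the norm of \<open>y\<close> is at most \<open>D\<close> times the sum of the two bounds
  (\<open>discrete_inverse_bound\<close>).  With the norm \<open>B\<close> of the inverse of the continuous operator, the a priori
  bounds for \<open>u\<close> and \<open>uT\<close> give
  \<open>D C_e (\<parallel>\<nabla>u\<parallel> + \<parallel>\<nabla>uT\<parallel>) \<le> 3/2 C_e \<parallel>f\<parallel> (B D + D\<^sup>2) \<le> 1/2\<close>
  because \<open>C_e B\<^sup>2 \<parallel>f\<parallel>\<close> and \<open>C_e D\<^sup>2 \<parallel>f\<parallel>\<close> are below \<open>1/6\<close> (\<open>smallness\<close>).  So the nonlinear part can be absorbed,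
  the triangle inequality gives quasi-best approximation (\<open>error_estimate\<close>), and the constant is uniform
  because \<open>D\<close> is bounded over all meshes.

  Two points need more work.  First, discrete functions must be admissible in the spaces for both weights:
  a finite element function vanishes on the boundary in the unweighted sense, and it must be
  approximated by test functions in the weighted norm (\<open>velocity_H10_vec\<close>).  Near the boundary the weights
  are bounded, so unweighted approximation suffices there; in the interior mollification is used, which
  converges almost everywhere and boundedly, for the gradient is bounded and continuous off the edges
  (\<open>mollification_dense\<close>, \<open>H10_change_weight\<close>).  Since weak gradients are fixed by an arbitrary choice, all of
  this rests on their uniqueness, that is, on \<open>fundamental_lemma_calculus_of_variations\<close>.

  Second, the embedding constants are extended reals, so a product such as \<open>C_e B\<^sup>2 \<parallel>f\<parallel>\<close> may be small
  although a factor is infinite.  In that case the a priori bounds force the gradients of both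
  velocities to vanish, hence the velocities themselves (\<open>H10_gradient_0_imp_0\<close>, from a Poincare inequality
  in \<open>L\<^sup>1\<close>), and only the pressures are left (\<open>error_estimate_0\<close>).
\<close>


section \<open>Smooth functions\<close>

abbreviation smooth :: "scalar \<Rightarrow> bool" where
  "smooth g \<equiv> \<forall>k. C_k k g"

lemma has_derivative_partial_deriv:
  assumes "(g has_derivative g') (at x)"
  shows "partial_deriv i g x = g' (axis i 1)"
  unfolding partial_deriv_def using frechet_derivative_at[OF assms] by simp

lemma derivative_eq_sum_partial_deriv:
  assumes "g differentiable (at x)"
  shows "(g has_derivative (\<lambda>h. \<Sum>i\<in>UNIV. h $ i * partial_deriv i g x)) (at x)"
proof -
  let ?D = "frechet_derivative g (at x)"
  have D: "(g has_derivative ?D) (at x)"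
    using assms frechet_derivative_works by blast
  then interpret linear ?D by (rule has_derivative_linear)
  have "?D h = (\<Sum>i\<in>UNIV. h $ i * partial_deriv i g x)" for h
  proof -
    have "?D h = ?D (\<Sum>i\<in>UNIV. h $ i *\<^sub>R axis i 1)"
      using basis_expansion[of h] by (simp add: scalar_mult_eq_scaleR)
    then show ?thesis by (simp add: sum scaleR partial_deriv_def)
  qed
  then have "?D = (\<lambda>h. \<Sum>i\<in>UNIV. h $ i * partial_deriv i g x)" by (rule ext)
  then show ?thesis using D by simp
qed

lemma C_k_differentiable: "C_k (Suc k) g \<Longrightarrow> g differentiable (at x)"
  by simp

lemma C_k_imp_continuous: "C_k k g \<Longrightarrow> continuous_on UNIV g"
proof (cases k)
  case (Suc m)
  assume "C_k k g"
  then show ?thesis using Suc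
    by (simp add: continuous_on_eq_continuous_within differentiable_imp_continuous_within)
qed simp

lemma C_k_Suc_imp: "C_k (Suc k) g \<Longrightarrow> C_k k g"
proof (induction k arbitrary: g)
  case 0
  then show ?case using C_k_imp_continuous[of "Suc 0" g] by simp
qed simp

lemma smooth_partial_deriv: "smooth g \<Longrightarrow> smooth (partial_deriv i g)"
  by (metis C_k.simps(2))

lemma smooth_differentiable: "smooth g \<Longrightarrow> g differentiable (at x)"
  using C_k_differentiable by blast

lemma smooth_continuous: "smooth g \<Longrightarrow> continuous_on S g"
  using C_k_imp_continuous continuous_on_subset by blast

lemma C_k_const: "C_k k (\<lambda>x. c)"
proof (induction k arbitrary: c)
  case (Suc k)
  have "partial_deriv i (\<lambda>x. c) = (\<lambda>x. 0)" for i
    by (rule ext) (use has_derivative_partial_deriv[OF has_derivative_const] in blast)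
  with Suc show ?case by simp
qed simp

lemma partial_deriv_coord: "partial_deriv i (\<lambda>x. x $ j) = (\<lambda>x. if i = j then 1 else 0)"
proof
  fix x :: "real^2"
  have "((\<lambda>x::real^2. x $ j) has_derivative (\<lambda>h. h $ j)) (at x)"
    by (rule bounded_linear_imp_has_derivative[OF bounded_linear_vec_nth])
  from has_derivative_partial_deriv[OF this]
  show "partial_deriv i (\<lambda>x. x $ j) x = (if i = j then 1 else 0)"
    by (simp add: axis_def)
qed

lemma C_k_coord: "C_k k (\<lambda>x. x $ j)"
proof (cases k)
  case 0
  then show ?thesis by (simp add: continuous_intros)
next
  case (Suc m)
  have "(\<lambda>x::real^2. x $ j) differentiable (at x)" for x
    by (simp add: bounded_linear_imp_differentiable bounded_linear_vec_nth)
  then show ?thesis using Suc by (simp add: partial_deriv_coord C_k_const)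
qed

lemma partial_deriv_add:
  assumes "f differentiable (at x)" "g differentiable (at x)"
  shows "partial_deriv i (\<lambda>y. f y + g y) x = partial_deriv i f x + partial_deriv i g x"
proof -
  have "((\<lambda>y. f y + g y) has_derivative
      (\<lambda>h. frechet_derivative f (at x) h + frechet_derivative g (at x) h)) (at x)"
    using assms by (intro has_derivative_add) (auto simp: frechet_derivative_works)
  from has_derivative_partial_deriv[OF this] show ?thesis by (simp add: partial_deriv_def)
qed

lemma partial_deriv_mult:
  assumes "f differentiable (at x)" "g differentiable (at x)"
  shows "partial_deriv i (\<lambda>y. f y * g y) x = f x * partial_deriv i g x + partial_deriv i f x * g x"
proof -
  have "((\<lambda>y. f y * g y) has_derivative
      (\<lambda>h. f x * frechet_derivative g (at x) h + frechet_derivative f (at x) h * g x)) (at x)"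
    using assms by (intro has_derivative_mult) (auto simp: frechet_derivative_works)
  from has_derivative_partial_deriv[OF this] show ?thesis by (simp add: partial_deriv_def)
qed

lemma partial_deriv_chain:
  assumes "f differentiable (at x)" "(h has_real_derivative d) (at (f x))"
  shows "(\<lambda>y. h (f y)) differentiable (at x)"
    and "partial_deriv i (\<lambda>y. h (f y)) x = d * partial_deriv i f x"
proof -
  have "(h \<circ> f has_derivative ((*) d) \<circ> frechet_derivative f (at x)) (at x)"
    using assms by (intro diff_chain_at) (auto simp: frechet_derivative_works has_field_derivative_def)
  then have D: "((\<lambda>y. h (f y)) has_derivative (\<lambda>z. d * frechet_derivative f (at x) z)) (at x)"
    by (simp add: o_def)
  then show "(\<lambda>y. h (f y)) differentiable (at x)" by (auto simp: differentiable_def)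
  from has_derivative_partial_deriv[OF D]
  show "partial_deriv i (\<lambda>y. h (f y)) x = d * partial_deriv i f x" by (simp add: partial_deriv_def)
qed

lemma C_k_add: "C_k k f \<Longrightarrow> C_k k g \<Longrightarrow> C_k k (\<lambda>x. f x + g x)"
proof (induction k arbitrary: f g)
  case 0
  then show ?case by (simp add: continuous_on_add)
next
  case (Suc k)
  then have "partial_deriv i (\<lambda>y. f y + g y) = (\<lambda>x. partial_deriv i f x + partial_deriv i g x)" for i
    by (intro ext partial_deriv_add) auto
  with Suc show ?case by simp
qed

lemma C_k_mult: "C_k k f \<Longrightarrow> C_k k g \<Longrightarrow> C_k k (\<lambda>x. f x * g x)"
proof (induction k arbitrary: f g)
  case 0
  then show ?case by (simp add: continuous_on_mult)
next
  case (Suc k)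
  then have "partial_deriv i (\<lambda>y. f y * g y) =
      (\<lambda>x. f x * partial_deriv i g x + partial_deriv i f x * g x)" for i
    by (intro ext partial_deriv_mult) auto
  moreover have "C_k k f" "C_k k g" using Suc.prems C_k_Suc_imp by blast+
  ultimately show ?case using Suc.prems by (auto intro!: C_k_add Suc.IH)
qed

lemma C_k_cmult: "C_k k f \<Longrightarrow> C_k k (\<lambda>x. c * f x)"
  by (intro C_k_mult C_k_const)

lemma C_k_diff: "C_k k f \<Longrightarrow> C_k k g \<Longrightarrow> C_k k (\<lambda>x. f x - g x)"
  using C_k_add[OF _ C_k_cmult[of k g "-1"], of f] by simp

lemma C_k_sum: "(\<And>a. a \<in> A \<Longrightarrow> C_k k (f a)) \<Longrightarrow> C_k k (\<lambda>x. \<Sum>a\<in>A. f a x)"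
  by (induction A rule: infinite_finite_induct) (auto intro: C_k_const C_k_add)

lemma C_k_prod: "(\<And>a. a \<in> A \<Longrightarrow> C_k k (f a)) \<Longrightarrow> C_k k (\<lambda>x. \<Prod>a\<in>A. f a x)"
  by (induction A rule: infinite_finite_induct) (auto intro: C_k_const C_k_mult)

lemma C_k_power: "C_k k f \<Longrightarrow> C_k k (\<lambda>x. f x ^ n)"
  by (induction n) (auto intro: C_k_const C_k_mult)

text \<open>A smooth function of one variable is given by the sequence of all its derivatives; this makes
  the chain rule an induction over that sequence.\<close>

lemma C_k_chain:
  assumes "\<And>n t. (H n has_real_derivative H (Suc n) t) (at t)"
  shows "C_k k f \<Longrightarrow> C_k k (\<lambda>x. H n (f x))"
proof (induction k arbitrary: n)
  case 0
  have "continuous_on UNIV (H n)"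
    by (intro continuous_at_imp_continuous_on ballI DERIV_isCont[OF assms])
  with 0 show ?case using continuous_on_compose2[of UNIV "H n" UNIV f] by simp
next
  case (Suc k)
  note chain = partial_deriv_chain[OF _ assms]
  have d: "\<And>x. f differentiable (at x)" using Suc.prems by simp
  then have "partial_deriv i (\<lambda>x. H n (f x)) = (\<lambda>x. H (Suc n) (f x) * partial_deriv i f x)" for i
    by (intro ext chain(2))
  moreover have "C_k k (\<lambda>x. H (Suc n) (f x) * partial_deriv i f x)" for i
    using Suc.IH[OF C_k_Suc_imp[OF Suc.prems]] Suc.prems by (intro C_k_mult) auto
  ultimately show ?case using chain(1)[OF d] by simp
qed

lemma C_k_inverse:
  assumes "\<And>x. f x \<noteq> 0"
  shows "C_k k f \<Longrightarrow> C_k k (\<lambda>x. inverse (f x))"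
proof (induction k)
  case 0
  then show ?case using assms by (auto intro: continuous_on_inverse)
next
  case (Suc k)
  have D: "(inverse has_real_derivative - (inverse (f x) * inverse (f x))) (at (f x))" for x
    using DERIV_inverse[OF assms[of x]] by (simp add: power2_eq_square numeral_2_eq_2)
  have d: "\<And>x. f differentiable (at x)" using Suc.prems by simp
  then have "partial_deriv i (\<lambda>x. inverse (f x)) =
      (\<lambda>x. (- 1) * (inverse (f x) * inverse (f x)) * partial_deriv i f x)" for i
    using partial_deriv_chain(2)[OF _ D] by (intro ext) simp
  moreover have "C_k k (\<lambda>x. (- 1) * (inverse (f x) * inverse (f x)) * partial_deriv i f x)" for i
    using Suc.IH[OF C_k_Suc_imp[OF Suc.prems]] Suc.prems by (intro C_k_mult C_k_const) auto
  ultimately show ?case using partial_deriv_chain(1)[OF d D] by (simp del: mult_minus_left)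
qed

section \<open>Cutoff functions\<close>

text \<open>The flat function \<open>exp (-1/t)\<close>, continued by zero to \<open>t \<le> 0\<close>, has derivatives of the form
  \<open>p (1/t) exp (-1/t)\<close> with a polynomial \<open>p\<close>.\<close>

definition flat :: "real poly \<Rightarrow> real \<Rightarrow> real" where
  "flat p t = (if 0 < t then poly p (1 / t) * exp (- (1 / t)) else 0)"

primrec flat_poly :: "nat \<Rightarrow> real poly" where
  "flat_poly 0 = 1"
| "flat_poly (Suc n) = [:0, 0, 1:] * (flat_poly n - pderiv (flat_poly n))"

lemma poly_exp_tendsto_0: "((\<lambda>s::real. poly p s * exp (- s)) \<longlongrightarrow> 0) at_top"
proof -
  have "((\<lambda>s::real. \<Sum>i\<le>degree p. coeff p i * (s ^ i / exp s)) \<longlongrightarrow> (\<Sum>i\<le>degree p. coeff p i * 0)) at_top"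
    by (intro tendsto_intros tendsto_power_div_exp_0)
  then show ?thesis
    by (simp add: poly_altdef exp_minus divide_inverse sum_distrib_right mult.assoc)
qed

lemma flat_has_derivative:
  "(flat p has_real_derivative flat ([:0, 0, 1:] * (p - pderiv p)) t) (at t)"
proof -
  consider "t < 0" | "0 < t" | "t = 0" by linarith
  then show ?thesis
  proof cases
    case 1
    then have ev: "\<forall>\<^sub>F s in nhds t. flat p s = 0"
      by (auto simp: eventually_nhds flat_def intro!: exI[of _ "{..<0}"])
    have "((\<lambda>_. 0) has_real_derivative 0) (at t)" by simp
    then have "(flat p has_real_derivative 0) (at t)"
      using DERIV_cong_ev[OF refl ev refl] by simp
    then show ?thesis using 1 by (simp add: flat_def)
  next
    case 2
    then have ev: "\<forall>\<^sub>F s in nhds t. flat p s = poly p (1 / s) * exp (- (1 / s))"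
      by (auto simp: eventually_nhds flat_def intro!: exI[of _ "{0<..}"])
    have inv: "((\<lambda>s. 1 / s) has_real_derivative - (1 / t * (1 / t))) (at t)"
      using 2 by (auto intro!: derivative_eq_intros simp: divide_inverse)
    have "((\<lambda>s. poly p (1 / s) * exp (- (1 / s))) has_real_derivative
        (poly (pderiv p) (1 / t) * (- (1 / t * (1 / t)))) * exp (- (1 / t)) +
        (exp (- (1 / t)) * (- (- (1 / t * (1 / t))))) * poly p (1 / t)) (at t)"
      by (intro DERIV_mult DERIV_chain2[OF poly_DERIV inv] DERIV_chain2[OF DERIV_exp]
          DERIV_minus inv)
    moreover have "(poly (pderiv p) (1 / t) * (- (1 / t * (1 / t)))) * exp (- (1 / t)) +
        (exp (- (1 / t)) * (- (- (1 / t * (1 / t))))) * poly p (1 / t) =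
        flat ([:0, 0, 1:] * (p - pderiv p)) t"
      using 2 by (simp add: flat_def algebra_simps)
    ultimately have "((\<lambda>s. poly p (1 / s) * exp (- (1 / s))) has_real_derivative
        flat ([:0, 0, 1:] * (p - pderiv p)) t) (at t)" by simp
    then show ?thesis using DERIV_cong_ev[OF refl ev refl] by simp
  next
    case 3
    have "((\<lambda>s. poly (pCons 0 p) (1 / s) * exp (- (1 / s))) \<longlongrightarrow> 0) (at_right 0)"
      using poly_exp_tendsto_0[of "pCons 0 p"]
      by (rule filterlim_compose) (simp add: filterlim_inverse_at_top_right flip: inverse_eq_divide)
    moreover have "\<forall>\<^sub>F s in at_right (0::real). poly (pCons 0 p) (1 / s) * exp (- (1 / s)) = flat p s / s"
      by (auto simp: eventually_at_right_less flat_def eventually_at intro!: exI[of _ 1])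
    ultimately have r: "((\<lambda>s. flat p s / s) \<longlongrightarrow> 0) (at_right 0)"
      by (rule Lim_transform_eventually)
    have "\<forall>\<^sub>F s in at_left (0::real). 0 = flat p s / s"
      by (auto simp: flat_def eventually_at intro!: exI[of _ 1])
    then have l: "((\<lambda>s. flat p s / s) \<longlongrightarrow> 0) (at_left 0)"
      by (rule Lim_transform_eventually[OF tendsto_const])
    from l r have "((\<lambda>s. flat p s / s) \<longlongrightarrow> 0) (at 0)" using filterlim_split_at by blast
    then show ?thesis using 3 by (simp add: has_field_derivative_iff flat_def)
  qed
qed

abbreviation flat_exp :: "real \<Rightarrow> real" where
  "flat_exp \<equiv> flat 1"

lemma C_k_flat_exp: "C_k k f \<Longrightarrow> C_k k (\<lambda>x. flat_exp (f x))"
  using C_k_chain[where H = "\<lambda>n. flat (flat_poly n)" and n = 0] flat_has_derivative by simp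

lemma flat_exp_nonneg: "0 \<le> flat_exp t"
  and flat_exp_pos_iff: "0 < flat_exp t \<longleftrightarrow> 0 < t"
  and flat_exp_eq_0: "t \<le> 0 \<Longrightarrow> flat_exp t = 0"
  by (auto simp: flat_def)

definition bump :: "real^2 \<Rightarrow> real \<Rightarrow> scalar" where
  "bump c r x = flat_exp (r\<^sup>2 - (\<Sum>i\<in>UNIV. (x $ i - c $ i)\<^sup>2))"

lemma smooth_bump: "smooth (bump c r)"
  unfolding bump_def
  by (intro allI C_k_flat_exp C_k_diff C_k_const C_k_sum C_k_power C_k_coord)

lemma bump_nonneg: "0 \<le> bump c r x"
  by (simp add: bump_def flat_exp_nonneg)

lemma norm_vec_squared: "(norm (x :: 'b::real_normed_vector ^ 2))\<^sup>2 = (\<Sum>i\<in>UNIV. (norm (x $ i))\<^sup>2)"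
  by (simp add: norm_vec_def L2_set_def sum_nonneg)

lemma bump_pos_iff: "0 < r \<Longrightarrow> 0 < bump c r x \<longleftrightarrow> x \<in> ball c r"
proof -
  assume r: "0 < r"
  have "0 < bump c r x \<longleftrightarrow> (norm (x - c))\<^sup>2 < r\<^sup>2"
    by (simp add: bump_def flat_exp_pos_iff norm_vec_squared)
  also have "\<dots> \<longleftrightarrow> norm (x - c) < r"
    using r power_less_imp_less_base power_strict_mono by (metis less_eq_real_def norm_ge_zero zero_less_numeral)
  finally show ?thesis by (simp add: dist_norm norm_minus_commute)
qed



lemma C0_infinityI:
  assumes "\<And>x. x \<notin> S \<Longrightarrow> \<phi> x = 0" "compact S" "S \<subseteq> U" "smooth \<phi>"
  shows "\<phi> \<in> C0_infinity U"
proof -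
  have sub: "closure {x. \<phi> x \<noteq> 0} \<subseteq> S"
    using assms by (intro closure_minimal) (auto intro: compact_imp_closed)
  then have "compact (closure {x. \<phi> x \<noteq> 0})"
    using assms(2) compact_Int_closed[of S "closure {x. \<phi> x \<noteq> 0}"] by (simp add: Int_absorb1)
  then show ?thesis using assms sub unfolding C0_infinity_def by auto
qed

lemma C0_infinity_smooth: "\<phi> \<in> C0_infinity U \<Longrightarrow> smooth \<phi>"
  and C0_infinity_compact: "\<phi> \<in> C0_infinity U \<Longrightarrow> compact (closure {x. \<phi> x \<noteq> 0})"
  and C0_infinity_subset: "\<phi> \<in> C0_infinity U \<Longrightarrow> closure {x. \<phi> x \<noteq> 0} \<subseteq> U"
  unfolding C0_infinity_def by auto

lemma eq_0_off_support: "x \<notin> closure {x. \<phi> x \<noteq> 0} \<Longrightarrow> \<phi> x = (0::real)"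
  using closure_subset[of "{x. \<phi> x \<noteq> 0}"] by auto

lemma C0_infinity_eq_0: "\<phi> \<in> C0_infinity U \<Longrightarrow> x \<notin> U \<Longrightarrow> \<phi> x = 0"
  using eq_0_off_support[of x \<phi>] C0_infinity_subset[of \<phi> U] by (meson subsetD)

lemma C0_infinity_mono: "\<phi> \<in> C0_infinity U \<Longrightarrow> U \<subseteq> U' \<Longrightarrow> \<phi> \<in> C0_infinity U'"
  unfolding C0_infinity_def by auto

lemma C0_infinity_mult:
  assumes "\<phi> \<in> C0_infinity U" "smooth \<psi>"
  shows "(\<lambda>x. \<phi> x * \<psi> x) \<in> C0_infinity U"
proof (rule C0_infinityI[OF _ C0_infinity_compact[OF assms(1)] C0_infinity_subset[OF assms(1)]])
  show "smooth (\<lambda>x. \<phi> x * \<psi> x)"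
    using C_k_mult C0_infinity_smooth[OF assms(1)] assms(2) by blast
qed (drule eq_0_off_support, simp)

lemma C0_infinity_zero: "(\<lambda>x. 0) \<in> C0_infinity U"
  by (rule C0_infinityI[where S = "{}"]) (auto simp: C_k_const)

lemma C0_infinity_add:
  assumes "\<phi> \<in> C0_infinity U" "\<psi> \<in> C0_infinity U"
  shows "(\<lambda>x. \<phi> x + \<psi> x) \<in> C0_infinity U"
proof (rule C0_infinityI)
  let ?S = "closure {x. \<phi> x \<noteq> 0} \<union> closure {x. \<psi> x \<noteq> 0}"
  show "compact ?S" using assms by (simp only: compact_Un C0_infinity_compact)
  show "?S \<subseteq> U" using assms C0_infinity_subset by blast
  show "smooth (\<lambda>x. \<phi> x + \<psi> x)" using C_k_add assms C0_infinity_smooth by blast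
next
  fix x assume "x \<notin> closure {x. \<phi> x \<noteq> 0} \<union> closure {x. \<psi> x \<noteq> 0}"
  then have "\<phi> x = 0" "\<psi> x = 0"
    using eq_0_off_support[of x \<phi>] eq_0_off_support[of x \<psi>] by blast+
  then show "\<phi> x + \<psi> x = 0" by simp
qed

lemma C0_infinity_cmult: "\<phi> \<in> C0_infinity U \<Longrightarrow> (\<lambda>x. c * \<phi> x) \<in> C0_infinity U"
  using C0_infinity_mult[of \<phi> U "\<lambda>x. c"] by (simp add: C_k_const mult.commute)

lemma partial_deriv_eq_0:
  assumes "\<forall>\<^sub>F y in nhds x. f y = c"
  shows "partial_deriv i f x = 0"
proof -
  have "(f has_derivative (\<lambda>_. 0)) (at x)"
    using assms eventually_nhds_x_imp_x[OF assms]
    by (intro has_derivative_transform_eventually[OF has_derivative_const[of c]])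
      (auto simp: eventually_at_filter elim: eventually_mono)
  then show ?thesis using has_derivative_partial_deriv by fastforce
qed

lemma C0_infinity_partial_deriv:
  assumes "\<phi> \<in> C0_infinity U"
  shows "partial_deriv i \<phi> \<in> C0_infinity U"
proof (rule C0_infinityI)
  let ?S = "closure {x. \<phi> x \<noteq> 0}"
  show "partial_deriv i \<phi> x = 0" if "x \<notin> ?S" for x
  proof (rule partial_deriv_eq_0)
    have "\<forall>\<^sub>F y in nhds x. y \<in> - ?S" using that by (intro eventually_nhds_in_open) auto
    then show "\<forall>\<^sub>F y in nhds x. \<phi> y = 0"
      by (rule eventually_mono) (rule eq_0_off_support, blast)
  qed
  show "compact ?S" "?S \<subseteq> U" using assms C0_infinity_compact C0_infinity_subset by auto
  show "smooth (partial_deriv i \<phi>)" using smooth_partial_deriv C0_infinity_smooth[OF assms] by blast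
qed

text \<open>A finite sum of bumps is bounded below by some \<open>c > 0\<close> on the compact set; the quotient below
  turns it into a function that is 1 wherever the sum is at least \<open>c\<close>.\<close>

lemma cutoff_exists:
  assumes "compact K" "open U" "K \<subseteq> U"
  obtains \<zeta> where "\<zeta> \<in> C0_infinity U" "\<And>x. 0 \<le> \<zeta> x" "\<And>x. \<zeta> x \<le> 1" "\<And>x. x \<in> K \<Longrightarrow> \<zeta> x = 1"
proof (cases "K = {}")
  case True
  then show thesis using that[of "\<lambda>x. 0"] C0_infinity_zero by auto
next
  case False
  obtain e where e: "0 < e" "(\<Union>x\<in>K. cball x e) \<subseteq> U"
    using compact_subset_open_imp_cball_epsilon_subset[OF assms] by blast
  have "K \<subseteq> (\<Union>x\<in>K. ball x e)" using e by auto
  then obtain A where A: "A \<subseteq> K" "finite A" "K \<subseteq> (\<Union>x\<in>A. ball x e)"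
    using compactE_image[OF assms(1), of K "\<lambda>x. ball x e"] by blast
  define \<Phi> where "\<Phi> x = (\<Sum>a\<in>A. bump a e x)" for x
  have sm: "smooth \<Phi>" unfolding \<Phi>_def using smooth_bump by (auto intro: C_k_sum)
  have pos: "0 < \<Phi> x" if xK: "x \<in> K" for x
  proof -
    obtain a where a: "a \<in> A" "x \<in> ball a e" using A xK by blast
    show ?thesis unfolding \<Phi>_def
      using A a e by (intro sum_pos2[of A a]) (auto simp: bump_pos_iff bump_nonneg simp del: mem_ball)
  qed
  obtain x0 where x0: "x0 \<in> K" "\<And>x. x \<in> K \<Longrightarrow> \<Phi> x0 \<le> \<Phi> x"
    using continuous_attains_inf[OF assms(1) False smooth_continuous[OF sm]] by blast
  define c where "c = \<Phi> x0"
  have c: "0 < c" "\<And>x. x \<in> K \<Longrightarrow> c \<le> \<Phi> x" using pos x0 by (auto simp: c_def)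
  define d where "d x = flat_exp (\<Phi> x) + flat_exp (c - \<Phi> x)" for x
  have d: "0 < d x" for x
    unfolding d_def using c flat_exp_pos_iff[of "\<Phi> x"] flat_exp_pos_iff[of "c - \<Phi> x"]
      flat_exp_nonneg[of "\<Phi> x"] flat_exp_nonneg[of "c - \<Phi> x"] by linarith
  define \<zeta> where "\<zeta> x = flat_exp (\<Phi> x) * inverse (d x)" for x
  show thesis
  proof (rule that[of \<zeta>])
    show "\<zeta> \<in> C0_infinity U"
    proof (rule C0_infinityI[where S = "\<Union>a\<in>A. cball a e"])
      show "compact (\<Union>a\<in>A. cball a e)" using A by (auto intro: compact_UN)
      show "(\<Union>a\<in>A. cball a e) \<subseteq> U" using A e by blast
      show "smooth \<zeta>" unfolding \<zeta>_def d_def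
        using d sm unfolding d_def
        by (intro allI C_k_mult C_k_inverse C_k_add C_k_flat_exp C_k_diff C_k_const)
          (auto simp: less_imp_neq[symmetric])
      fix x assume "x \<notin> (\<Union>a\<in>A. cball a e)"
      then have "bump a e x = 0" if "a \<in> A" for a
        using that bump_pos_iff[OF e(1), of a x] bump_nonneg[of a e x] by force
      then have "\<Phi> x = 0" by (simp add: \<Phi>_def)
      then show "\<zeta> x = 0" by (simp add: \<zeta>_def flat_exp_eq_0)
    qed
    show "0 \<le> \<zeta> x" for x unfolding \<zeta>_def using d[of x] by (simp add: flat_exp_nonneg)
    show "\<zeta> x \<le> 1" for x unfolding \<zeta>_def using d[of x]
      by (simp add: d_def flat_exp_nonneg divide_le_eq flip: divide_inverse)
    show "\<zeta> x = 1" if "x \<in> K" for x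
      unfolding \<zeta>_def using d[of x] c(2)[OF that] by (simp add: d_def flat_exp_eq_0)
  qed
qed


section \<open>Integration by parts\<close>




lemma line_has_derivative:
  assumes "\<And>x. \<phi> differentiable (at x)"
  shows "((\<lambda>t. \<phi> (x + t *\<^sub>R axis i 1)) has_real_derivative
    partial_deriv i \<phi> (x + t *\<^sub>R axis i 1)) (at t)"
proof -
  let ?D = "frechet_derivative \<phi> (at (x + t *\<^sub>R axis i 1))"
  have D: "(\<phi> has_derivative ?D) (at (x + t *\<^sub>R axis i 1))"
    using assms frechet_derivative_works by blast
  then interpret linear ?D by (rule has_derivative_linear)
  have "((\<lambda>t. x + t *\<^sub>R axis i 1) has_derivative (\<lambda>s. s *\<^sub>R axis i 1)) (at t)"
    by (auto intro!: derivative_eq_intros)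
  from has_derivative_compose[OF this D] show ?thesis
    by (simp add: has_field_derivative_def partial_deriv_def scaleR mult.commute[of _ "?D _"])
qed

lemma C0_infinity_bounded:
  assumes "\<phi> \<in> C0_infinity U"
  obtains B where "0 \<le> B" "\<And>x. \<bar>\<phi> x\<bar> \<le> B"
proof -
  let ?S = "closure {x. \<phi> x \<noteq> 0}"
  have "compact (\<phi> ` ?S)"
    using C0_infinity_compact[OF assms] smooth_continuous[OF C0_infinity_smooth[OF assms]]
    by (rule compact_continuous_image[rotated])
  then obtain B where B: "\<And>y. y \<in> \<phi> ` ?S \<Longrightarrow> norm y \<le> B"
    using compact_imp_bounded bounded_iff by metis
  have "\<bar>\<phi> x\<bar> \<le> max B 0" for x
  proof (cases "x \<in> ?S")
    case True
    then show ?thesis using B[of "\<phi> x"] by auto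
  next
    case False
    then show ?thesis using eq_0_off_support[of x \<phi>] by simp
  qed
  then show thesis using that[of "max B 0"] by simp
qed

lemma continuous_compact_support_integrable:
  fixes f :: scalar
  assumes "continuous_on UNIV f" "compact S" "\<And>x. x \<notin> S \<Longrightarrow> f x = 0"
  shows "integrable lborel f"
proof -
  have "(\<lambda>x. indicat_real S x *\<^sub>R f x) = f"
  proof
    fix x show "indicat_real S x *\<^sub>R f x = f x" using assms(3)[of x] by (cases "x \<in> S") auto
  qed
  then show ?thesis
    using borel_integrable_compact[OF assms(2) continuous_on_subset[OF assms(1)]] by simp
qed

lemma C0_infinity_integrable:
  assumes "\<phi> \<in> C0_infinity U"
  shows "integrable lborel \<phi>"
  by (rule continuous_compact_support_integrable[OF _ C0_infinity_compact[OF assms]])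
    (use smooth_continuous[OF C0_infinity_smooth[OF assms]] in \<open>auto intro: eq_0_off_support\<close>)

lemma smooth_measurable: "smooth \<phi> \<Longrightarrow> \<phi> \<in> borel_measurable borel"
  using borel_measurable_continuous_onI smooth_continuous by blast

text \<open>The integral of a difference quotient vanishes by translation invariance, and the difference
  quotients converge boundedly to the derivative.\<close>

lemma integral_partial_deriv_eq_0:
  assumes "\<phi> \<in> C0_infinity U"
  shows "(LINT x|lborel. partial_deriv i \<phi> x) = 0"
proof -
  note sm = C0_infinity_smooth[OF assms]
  let ?S = "closure {x. \<phi> x \<noteq> 0}" and ?e = "axis i (1::real) :: real^2"
  obtain B where B: "0 \<le> B" "\<And>x. \<bar>partial_deriv i \<phi> x\<bar> \<le> B"
    using C0_infinity_bounded[OF C0_infinity_partial_deriv[OF assms]] by blast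
  obtain R where R: "\<And>x. x \<in> ?S \<Longrightarrow> norm x \<le> R"
    using C0_infinity_compact[OF assms] compact_imp_bounded bounded_iff by metis
  define g where "g n x = (\<phi> (inverse (real (Suc n)) *\<^sub>R ?e + x) - \<phi> x) / inverse (real (Suc n))" for n x
  note deriv = line_has_derivative[OF smooth_differentiable[OF sm]]
  have m [measurable]: "\<phi> \<in> borel_measurable borel" by (rule smooth_measurable[OF sm])
  have lim: "(\<lambda>n. LINT x|lborel. g n x) \<longlonglongrightarrow> (LINT x|lborel. partial_deriv i \<phi> x)"
  proof (rule integral_dominated_convergence)
    show "(\<lambda>x. partial_deriv i \<phi> x) \<in> borel_measurable lborel"
      using smooth_measurable[OF smooth_partial_deriv[OF sm]] by simp
    show "g n \<in> borel_measurable lborel" for n unfolding g_def by measurable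
    show "integrable lborel (\<lambda>x. indicat_real (cball 0 (R + 1)) x *\<^sub>R B)"
      by (intro integrable_scaleR_left) (simp add: integrable_indicator_iff emeasure_lborel_cball_finite[simplified])
    show "AE x in lborel. (\<lambda>n. g n x) \<longlonglongrightarrow> partial_deriv i \<phi> x"
    proof (rule AE_I2)
      fix x
      have "((\<lambda>h. (\<phi> (x + h *\<^sub>R ?e) - \<phi> x) / h) \<longlongrightarrow> partial_deriv i \<phi> x) (at 0)"
        using deriv[of x i 0] by (simp add: DERIV_def)
      then have "(\<lambda>n. (\<phi> (x + inverse (real (Suc n)) *\<^sub>R ?e) - \<phi> x) / inverse (real (Suc n)))
          \<longlonglongrightarrow> partial_deriv i \<phi> x"
        by (rule filterlim_compose)
          (use LIMSEQ_inverse_real_of_nat in \<open>auto simp: filterlim_at\<close>)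
      then show "(\<lambda>n. g n x) \<longlonglongrightarrow> partial_deriv i \<phi> x" by (simp add: g_def add.commute)
    qed
    show "AE x in lborel. norm (g n x) \<le> indicat_real (cball 0 (R + 1)) x *\<^sub>R B" for n
    proof (rule AE_I2)
      fix x
      let ?h = "inverse (real (Suc n))"
      have h: "0 < ?h" "?h \<le> 1" by (auto simp: divide_simps)
      show "norm (g n x) \<le> indicat_real (cball 0 (R + 1)) x *\<^sub>R B"
      proof (cases "x \<in> cball 0 (R + 1)")
        case True
        obtain z where "\<phi> (x + ?h *\<^sub>R ?e) - \<phi> (x + 0 *\<^sub>R ?e) =
            (?h - 0) * partial_deriv i \<phi> (x + z *\<^sub>R ?e)"
          using MVT2[OF h(1), of "\<lambda>t. \<phi> (x + t *\<^sub>R ?e)"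
              "\<lambda>t. partial_deriv i \<phi> (x + t *\<^sub>R ?e)"] deriv by blast
        then have "g n x = partial_deriv i \<phi> (x + z *\<^sub>R ?e)"
          using h by (simp add: g_def add.commute)
        then show ?thesis using True B by simp
      next
        case False
        have "norm x \<le> norm (?h *\<^sub>R ?e + x) + norm (?h *\<^sub>R ?e)"
          using norm_triangle_ineq4[of "?h *\<^sub>R ?e + x" "?h *\<^sub>R ?e"] by simp
        moreover have "norm (?h *\<^sub>R ?e) \<le> 1" using h by simp
        moreover have "R + 1 < norm x" using False by simp
        ultimately have "R < norm (?h *\<^sub>R ?e + x)" "R < norm x" by linarith+
        then have "x \<notin> ?S" "?h *\<^sub>R ?e + x \<notin> ?S" using R by force+
        then have "\<phi> x = 0" "\<phi> (?h *\<^sub>R ?e + x) = 0" by (blast intro: eq_0_off_support)+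
        then show ?thesis using False by (simp add: g_def)
      qed
    qed
  qed
  have "(LINT x|lborel. g n x) = 0" for n
  proof -
    let ?c = "inverse (real (Suc n)) *\<^sub>R ?e"
    have i: "integrable lborel \<phi>" by (rule C0_infinity_integrable[OF assms])
    have i2: "integrable lborel (\<lambda>x. \<phi> (?c + x))"
      using integrable_distr[of "(+) ?c" lborel borel \<phi>] i by (simp add: lborel_distr_plus)
    have "(LINT x|lborel. \<phi> (?c + x)) = (LINT x|distr lborel borel ((+) ?c). \<phi> x)"
      by (subst integral_distr) auto
    then have "(LINT x|lborel. \<phi> (?c + x)) = (LINT x|lborel. \<phi> x)"
      by (simp only: lborel_distr_plus)
    then show ?thesis unfolding g_def using i i2 by simp
  qed
  then have "(\<lambda>n. LINT x|lborel. g n x) \<longlonglongrightarrow> 0" by simp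
  with lim show ?thesis by (rule LIMSEQ_unique)
qed

section \<open>Weak gradients\<close>

lemma LINT_on_eq_LINT_lebesgue:
  fixes f :: scalar
  assumes "U \<in> sets lebesgue" "\<And>x. x \<notin> U \<Longrightarrow> f x = 0"
  shows "(LINT x|lebesgue_on U. f x) = (LINT x|lebesgue. f x)"
    and "integrable (lebesgue_on U) f \<longleftrightarrow> integrable lebesgue f"
proof -
  have "(\<lambda>x. if x \<in> U then f x else 0) = f" using assms by auto
  then show "(LINT x|lebesgue_on U. f x) = (LINT x|lebesgue. f x)"
      "integrable (lebesgue_on U) f \<longleftrightarrow> integrable lebesgue f"
    using Lebesgue_Measure.integral_restrict_UNIV[OF assms(1), of f]
      Lebesgue_Measure.integrable_restrict_UNIV[OF assms(1), of f] by simp_all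
qed

lemma LINT_on_eq_LINT_lborel:
  fixes f :: scalar
  assumes "U \<in> sets lebesgue" "\<And>x. x \<notin> U \<Longrightarrow> f x = 0" "f \<in> borel_measurable borel"
  shows "(LINT x|lebesgue_on U. f x) = (LINT x|lborel. f x)"
  using LINT_on_eq_LINT_lebesgue(1)[OF assms(1,2)] integral_completion[of f lborel] assms(3) by simp

lemma open_sets_lebesgue [simp, intro]: "open U \<Longrightarrow> U \<in> sets lebesgue"
  by (simp add: borel_open sets_completionI_sets)

lemma compact_sets_lebesgue: "compact K \<Longrightarrow> K \<in> sets lebesgue"
  by (simp add: borel_compact sets_completionI_sets)

lemma locally_integrable_times_test:
  fixes h :: scalar
  assumes "open U" "locally_integrable_on U h" "\<phi> \<in> C0_infinity U"
  shows "integrable (lebesgue_on U) (\<lambda>x. h x * \<phi> x)"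
proof -
  let ?S = "closure {x. \<phi> x \<noteq> 0}"
  have S: "compact ?S" "?S \<subseteq> U" using C0_infinity_compact C0_infinity_subset assms(3) by auto
  have h: "integrable (lebesgue_on ?S) h" using assms(2) S by (auto simp: locally_integrable_on_def)
  obtain B where B: "\<And>x. \<bar>\<phi> x\<bar> \<le> B" using C0_infinity_bounded[OF assms(3)] by blast
  have m: "\<phi> \<in> borel_measurable (lebesgue_on ?S)"
    using smooth_measurable[OF C0_infinity_smooth[OF assms(3)]]
    by (intro measurable_restrict_space1 measurable_completion) simp
  have "integrable (lebesgue_on ?S) (\<lambda>x. h x * \<phi> x)"
  proof (rule Bochner_Integration.integrable_bound)
    show "integrable (lebesgue_on ?S) (\<lambda>x. h x * B)" using h by simp
    show "AE x in lebesgue_on ?S. norm (h x * \<phi> x) \<le> norm (h x * B)"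
    proof (rule AE_I2)
      fix x show "norm (h x * \<phi> x) \<le> norm (h x * B)"
        using B[of x] by (auto simp: abs_mult intro!: mult_left_mono)
    qed
    show "(\<lambda>x. h x * \<phi> x) \<in> borel_measurable (lebesgue_on ?S)"
      using m h by (intro borel_measurable_times) auto
  qed
  then have "integrable lebesgue (\<lambda>x. h x * \<phi> x)"
    using LINT_on_eq_LINT_lebesgue(2)[OF compact_sets_lebesgue[OF S(1)], of "\<lambda>x. h x * \<phi> x"]
      eq_0_off_support by (metis mult_zero_right)
  moreover have "x \<notin> U \<Longrightarrow> h x * \<phi> x = 0" for x
    using eq_0_off_support[of x \<phi>] S by auto
  ultimately show ?thesis
    using LINT_on_eq_LINT_lebesgue(2)[of U "\<lambda>x. h x * \<phi> x"] assms(1) by auto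
qed

text \<open>For a test function \<open>\<phi>\<close> the product \<open>\<phi> s\<close> has compact support, so its derivative integrates
  to zero.\<close>

lemma smooth_has_weak_gradient:
  assumes "open U" "smooth s"
  shows "has_weak_gradient U s (\<lambda>x. \<chi> i. partial_deriv i s x)"
  unfolding has_weak_gradient_def
proof (intro conjI ballI allI)
  have li: "locally_integrable_on U h" if "continuous_on UNIV h" for h :: "real^2 \<Rightarrow> 'b::euclidean_space"
    unfolding locally_integrable_on_def
  proof (intro allI impI)
    fix K assume K: "compact K \<and> K \<subseteq> U"
    have "integrable lborel (\<lambda>x. indicat_real K x *\<^sub>R h x)"
      using borel_integrable_compact[of K h] K continuous_on_subset[OF that] by auto
    then show "integrable (lebesgue_on K) h"
      using K compact_sets_lebesgue by (subst integrable_restrict_space)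
        (auto simp: integrable_completion)
  qed
  show "locally_integrable_on U s" by (rule li[OF smooth_continuous[OF assms(2)]])
  show "locally_integrable_on U (\<lambda>x. \<chi> i. partial_deriv i s x)"
    by (intro li continuous_on_vec_lambda smooth_continuous smooth_partial_deriv[OF assms(2)])
  fix \<phi> i assume \<phi>: "\<phi> \<in> C0_infinity U"
  note sm = C0_infinity_smooth[OF \<phi>]
  have s\<phi>: "(\<lambda>x. \<phi> x * s x) \<in> C0_infinity U" by (rule C0_infinity_mult[OF \<phi> assms(2)])
  have z: "\<phi> x = 0 \<and> partial_deriv j \<phi> x = 0" if "x \<notin> U" for x j
    using C0_infinity_eq_0[OF \<phi> that] C0_infinity_eq_0[OF C0_infinity_partial_deriv[OF \<phi>] that] by simp
  have i1: "integrable lborel (\<lambda>x. partial_deriv i \<phi> x * s x)"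
    by (rule C0_infinity_integrable[OF C0_infinity_mult[OF C0_infinity_partial_deriv[OF \<phi>] assms(2)]])
  have i2: "integrable lborel (\<lambda>x. \<phi> x * partial_deriv i s x)"
    by (rule C0_infinity_integrable[OF C0_infinity_mult[OF \<phi> smooth_partial_deriv[OF assms(2)]]])
  have "0 = (LINT x|lborel. partial_deriv i (\<lambda>x. \<phi> x * s x) x)"
    using integral_partial_deriv_eq_0[OF s\<phi>] by simp
  also have "\<dots> = (LINT x|lborel. \<phi> x * partial_deriv i s x + partial_deriv i \<phi> x * s x)"
    by (intro Bochner_Integration.integral_cong refl partial_deriv_mult smooth_differentiable sm assms)
  also have "\<dots> = (LINT x|lborel. \<phi> x * partial_deriv i s x) + (LINT x|lborel. partial_deriv i \<phi> x * s x)"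
    using i1 i2 by simp
  finally have *: "(LINT x|lborel. partial_deriv i \<phi> x * s x) = - (LINT x|lborel. \<phi> x * partial_deriv i s x)"
    by simp
  have "(LINT x|lebesgue_on U. s x * partial_deriv i \<phi> x) = (LINT x|lborel. partial_deriv i \<phi> x * s x)"
    using LINT_on_eq_LINT_lborel[of U "\<lambda>x. partial_deriv i \<phi> x * s x"] assms(1) z i1
    by (auto simp: mult.commute)
  moreover have "(LINT x|lebesgue_on U. (\<chi> i. partial_deriv i s x) $ i * \<phi> x) =
      (LINT x|lborel. \<phi> x * partial_deriv i s x)"
    using LINT_on_eq_LINT_lborel[of U "\<lambda>x. \<phi> x * partial_deriv i s x"] assms(1) z i2
    by (auto simp: mult.commute)
  ultimately show "(LINT x|lebesgue_on U. s x * partial_deriv i \<phi> x) =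
      - (LINT x|lebesgue_on U. (\<chi> i. partial_deriv i s x) $ i * \<phi> x)"
    using * by simp
qed

lemma compact_neighbourhood_in_open:
  fixes S :: "(real^2) set"
  assumes "compact S" "open U" "S \<subseteq> U"
  obtains e L where "0 < e" "compact L" "L \<subseteq> U" "\<And>x y. x \<in> S \<Longrightarrow> dist x y \<le> e \<Longrightarrow> y \<in> L"
proof -
  obtain e where e: "0 < e" "(\<Union>x\<in>S. cball x e) \<subseteq> U"
    using compact_subset_open_imp_cball_epsilon_subset[OF assms] by blast
  define L where "L = {x + y |x y. x \<in> S \<and> y \<in> cball 0 e}"
  have L: "y \<in> L \<longleftrightarrow> (\<exists>x\<in>S. dist x y \<le> e)" for y
  proof
    assume "\<exists>x\<in>S. dist x y \<le> e"
    then obtain x where "x \<in> S" "dist x y \<le> e" by blast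
    then show "y \<in> L" unfolding L_def
      by (intro CollectI exI[of _ x] exI[of _ "y - x"]) (simp add: dist_norm norm_minus_commute)
  qed (force simp: L_def dist_norm)
  show thesis
  proof (rule that[OF e(1)])
    show "compact L" unfolding L_def by (intro compact_sums assms compact_cball)
    show "L \<subseteq> U" using e(2) L by (auto simp: subset_iff)
    show "\<And>x y. x \<in> S \<Longrightarrow> dist x y \<le> e \<Longrightarrow> y \<in> L" using L by blast
  qed
qed

text \<open>Cutoffs that decrease to the indicator function of a compact set turn the hypothesis into
  \<open>\<integral>\<^sub>K h = 0\<close>.\<close>

lemma integral_compact_eq_0:
  fixes h :: scalar
  assumes "open U" "locally_integrable_on U h"
    and "\<And>\<phi>. \<phi> \<in> C0_infinity U \<Longrightarrow> (LINT x|lebesgue_on U. h x * \<phi> x) = 0"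
    and "compact K" "K \<subseteq> U"
  shows "(LINT x|lebesgue_on K. h x) = 0"
proof -
  obtain e L where e: "0 < e" and Lc: "compact L" "L \<subseteq> U"
    and near: "\<And>x y. x \<in> K \<Longrightarrow> dist x y \<le> e \<Longrightarrow> y \<in> L"
    using compact_neighbourhood_in_open[OF assms(4,1,5)] by metis
  have L: "compact L" "L \<subseteq> U" "K \<subseteq> L" using Lc near[of x x for x] e by auto
  define W where "W n = (\<Union>x\<in>K. ball x (e / real (Suc n)))" for n
  have W: "open (W n)" "K \<subseteq> W n" "W n \<subseteq> L" for n
  proof -
    show "open (W n)" by (auto simp: W_def)
    show "K \<subseteq> W n" using e by (auto simp: W_def intro!: bexI divide_pos_pos)
    have le: "e / real (Suc n) \<le> e" using e by (simp add: divide_le_eq mult_left_mono)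
    show "W n \<subseteq> L"
    proof
      fix z assume "z \<in> W n"
      then obtain x where x: "x \<in> K" "dist x z < e / real (Suc n)" by (auto simp: W_def)
      then show "z \<in> L" using le near[of x z] by simp
    qed
  qed
  have "\<exists>\<zeta>. \<zeta> \<in> C0_infinity (W n) \<and> (\<forall>x. 0 \<le> \<zeta> x) \<and> (\<forall>x. \<zeta> x \<le> 1) \<and> (\<forall>x\<in>K. \<zeta> x = 1)" for n
    by (rule cutoff_exists[OF assms(4) W(1)[of n] W(2)[of n]]) blast
  then obtain \<zeta> where \<zeta>: "\<And>n. \<zeta> n \<in> C0_infinity (W n)" "\<And>n x. 0 \<le> \<zeta> n x" "\<And>n x. \<zeta> n x \<le> 1"
      "\<And>n x. x \<in> K \<Longrightarrow> \<zeta> n x = 1"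
    by metis
  have off: "\<zeta> n x = 0" if "x \<notin> W n" for n x
    by (rule C0_infinity_eq_0[OF \<zeta>(1) that])
  have hL: "integrable (lebesgue_on L) h" using assms(2) L by (auto simp: locally_integrable_on_def)
  have KL: "K \<in> sets lebesgue" "L \<in> sets lebesgue" using L assms(4) compact_sets_lebesgue by auto
  have "(\<lambda>n. LINT x|lebesgue_on L. h x * \<zeta> n x) \<longlonglongrightarrow> (LINT x|lebesgue_on L. h x * indicator K x)"
  proof (rule integral_dominated_convergence)
    have K': "K \<inter> L \<in> sets (lebesgue_on L)" using KL by (auto simp: sets_restrict_space)
    have "indicat_real K \<in> borel_measurable (lebesgue_on L)"
      using KL L by (intro borel_measurable_indicator) (auto simp: sets_restrict_space)
    then show "(\<lambda>x. h x * indicator K x) \<in> borel_measurable (lebesgue_on L)"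
      using hL by (intro borel_measurable_times) auto
    have "\<zeta> n \<in> borel_measurable (lebesgue_on L)" for n
      using smooth_measurable[OF C0_infinity_smooth[OF \<zeta>(1)]]
      by (intro measurable_restrict_space1 measurable_completion) simp
    then show "(\<lambda>x. h x * \<zeta> n x) \<in> borel_measurable (lebesgue_on L)" for n
      using hL by (intro borel_measurable_times) auto
    show "integrable (lebesgue_on L) (\<lambda>x. \<bar>h x\<bar>)" using hL by simp
    show "AE x in lebesgue_on L. norm (h x * \<zeta> n x) \<le> \<bar>h x\<bar>" for n
      using \<zeta>(2,3) by (intro AE_I2) (simp add: abs_mult mult_left_le)
    show "AE x in lebesgue_on L. (\<lambda>n. h x * \<zeta> n x) \<longlonglongrightarrow> h x * indicator K x"
    proof (rule AE_I2)
      fix x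
      show "(\<lambda>n. h x * \<zeta> n x) \<longlonglongrightarrow> h x * indicator K x"
      proof (cases "x \<in> K")
        case True
        then show ?thesis using \<zeta>(4) by simp
      next
        case False
        then obtain d where d: "0 < d" "ball x d \<subseteq> - K"
          using compact_imp_closed[OF assms(4)] open_contains_ball[of "- K"] by (auto simp: open_Compl)
        obtain N where N: "e / d < real N" using reals_Archimedean2 by blast
        have "\<zeta> n x = 0" if "N \<le> n" for n
        proof (rule off, rule notI)
          assume "x \<in> W n"
          then obtain y where y: "y \<in> K" "dist y x < e / real (Suc n)" by (auto simp: W_def)
          have "e / d < real (Suc n)" using N that by simp
          then have "e / real (Suc n) < d" using d by (simp add: field_simps)
          then have "y \<in> ball x d" using y by (simp add: dist_commute)
          then show False using d y by blast
        qed
        then have "\<forall>\<^sub>F n in sequentially. h x * \<zeta> n x = 0"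
          by (auto simp: eventually_sequentially intro!: exI[of _ N])
        then show ?thesis using False by (simp add: tendsto_eventually)
      qed
    qed
  qed
  moreover have "(LINT x|lebesgue_on L. h x * \<zeta> n x) = 0" for n
  proof -
    have \<zeta>U: "\<zeta> n \<in> C0_infinity U" by (rule C0_infinity_mono[OF \<zeta>(1)]) (use W(3) L(2) in \<open>rule order_trans\<close>)
    have o: "x \<notin> L \<Longrightarrow> h x * \<zeta> n x = 0" "x \<notin> U \<Longrightarrow> h x * \<zeta> n x = 0" for x
      using off[of x n] W(3)[of n] L by auto
    have "(LINT x|lebesgue_on L. h x * \<zeta> n x) = (LINT x|lebesgue_on U. h x * \<zeta> n x)"
      using LINT_on_eq_LINT_lebesgue(1)[OF KL(2), of "\<lambda>x. h x * \<zeta> n x"]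
        LINT_on_eq_LINT_lebesgue(1)[of U "\<lambda>x. h x * \<zeta> n x"] o assms(1) by auto
    then show ?thesis using assms(3)[OF \<zeta>U] by simp
  qed
  ultimately have "(\<lambda>n. 0) \<longlonglongrightarrow> (LINT x|lebesgue_on L. h x * indicator K x)" by simp
  from LIMSEQ_unique[OF this tendsto_const]
  have "(LINT x|lebesgue_on L. h x * indicator K x) = 0" .
  moreover have "(LINT x|lebesgue_on L. h x * indicator K x) = (LINT x|lebesgue_on K. h x)"
  proof -
    have "(\<lambda>x. h x * indicator K x) = (\<lambda>x. if x \<in> K then h x else 0)" by auto
    then show ?thesis using integral_restrict[OF L(3) KL, of h] by simp
  qed
  ultimately show ?thesis by simp
qed

text \<open>An open set is a countable union of compact subsets.\<close>

lemma AE_compacts_imp_AE_open: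
  assumes "open U" "\<And>K. compact K \<Longrightarrow> K \<subseteq> U \<Longrightarrow> AE x in lebesgue_on K. P x"
  shows "AE x in lebesgue_on U. P x"
proof -
  obtain C where C: "\<And>n. compact (C n)" "\<And>n::nat. C n \<subseteq> U" "\<Union>(range C) = U"
    using open_Union_compact_subsets[OF assms(1)] by metis
  have "AE x in lebesgue. x \<in> C n \<longrightarrow> P x" for n
    using assms(2)[OF C(1,2)] compact_sets_lebesgue[OF C(1)] by (subst (asm) AE_restrict_space_iff) auto
  then have "AE x in lebesgue. \<forall>n. x \<in> C n \<longrightarrow> P x" by (subst AE_all_countable) blast
  then have "AE x in lebesgue. x \<in> U \<longrightarrow> P x" by (rule eventually_mono) (use C(3) in blast)
  then show ?thesis using assms(1) by (subst AE_restrict_space_iff) auto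
qed

lemma integrable_lebesgue_on_subset:
  fixes h :: "real^2 \<Rightarrow> 'b::{banach,second_countable_topology}"
  assumes "integrable (lebesgue_on S) h" "S \<in> sets lebesgue" "T \<in> sets lebesgue" "T \<subseteq> S"
  shows "integrable (lebesgue_on T) h"
proof -
  have "set_integrable lebesgue S h" using assms set_integrable_eq[of S lebesgue h] by simp
  then have "set_integrable lebesgue T h" using assms by (rule_tac set_integrable_subset)
  then show ?thesis using assms set_integrable_eq[of T lebesgue h] by simp
qed

text \<open>If \<open>h > 0\<close> on a set of positive measure then, by inner regularity, also on a compact set of
  positive measure, over which the integral of \<open>h\<close> cannot vanish.\<close>

lemma nonpos_AE_if_integral_compact_eq_0:
  fixes h :: scalar
  assumes K0: "compact K0" and h: "integrable (lebesgue_on K0) h"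
    and 0: "\<And>K. compact K \<Longrightarrow> K \<subseteq> K0 \<Longrightarrow> (LINT x|lebesgue_on K. h x) = 0"
  shows "AE x in lebesgue_on K0. h x \<le> 0"
proof -
  have K0s: "K0 \<in> sets lebesgue" by (rule compact_sets_lebesgue[OF K0])
  let ?S = "{x \<in> K0. 0 < h x}"
  have "{x \<in> space (lebesgue_on K0). 0 < h x} \<in> sets (lebesgue_on K0)"
    using h by measurable
  then have S: "?S \<in> sets lebesgue" using K0s by (auto simp: sets_restrict_space)
  have null: "K \<in> null_sets lebesgue" if K: "compact K" "K \<subseteq> ?S" for K
  proof -
    have Ks: "K \<in> sets lebesgue" by (rule compact_sets_lebesgue[OF K(1)])
    have hK: "integrable (lebesgue_on K) h"
      by (rule integrable_lebesgue_on_subset[OF h K0s Ks]) (use K(2) in blast)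
    have "AE x in lebesgue_on K. 0 \<le> h x" using K by (intro AE_I2) auto
    then have "AE x in lebesgue_on K. h x = 0"
      using integral_nonneg_eq_0_iff_AE[OF hK] 0[of K] K by auto
    then have "AE x in lebesgue. x \<in> K \<longrightarrow> h x = 0"
      using Ks by (subst (asm) AE_restrict_space_iff) auto
    then have "AE x in lebesgue. x \<notin> K" by (rule eventually_mono) (use K in force)
    then show ?thesis using Ks by (subst AE_iff_null_sets) auto
  qed
  have "emeasure lebesgue ?S = 0"
  proof (rule ccontr)
    assume "emeasure lebesgue ?S \<noteq> 0"
    then have "0 < emeasure lebesgue ?S" by (simp add: zero_less_iff_neq_zero)
    then obtain e' where e': "0 < e'" "e' < emeasure lebesgue ?S" using dense by blast
    then obtain e where e: "0 < e" "ennreal e < emeasure lebesgue ?S"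
      by (cases e') auto
    obtain T where T: "closed T" "T \<subseteq> ?S" "?S - T \<in> lmeasurable" "emeasure lebesgue (?S - T) < ennreal e"
      using sets_lebesgue_inner_closed[OF S e(1)] by blast
    have "compact T" using T(1,2) K0 compact_Int_closed[of K0 T] by (simp add: Int_absorb1 subset_iff)
    then have "T \<in> null_sets lebesgue" using null T by blast
    then have "emeasure lebesgue (?S - T) = emeasure lebesgue ?S"
      by (rule emeasure_Diff_null_set) (rule S)
    then show False using T e by simp
  qed
  then have "AE x in lebesgue. x \<notin> ?S" using S by (subst AE_iff_null_sets[symmetric]) auto
  then have "AE x in lebesgue. x \<in> K0 \<longrightarrow> h x \<le> 0" by (rule eventually_mono) auto
  then show ?thesis using K0s by (subst AE_restrict_space_iff) auto
qed

lemma locally_integrable_on_subset: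
  "locally_integrable_on U h \<Longrightarrow> U' \<subseteq> U \<Longrightarrow> locally_integrable_on U' h"
  by (auto simp: locally_integrable_on_def)

lemma fundamental_lemma_calculus_of_variations:
  fixes h :: scalar
  assumes "open U" "locally_integrable_on U h"
    and "\<And>\<phi>. \<phi> \<in> C0_infinity U \<Longrightarrow> (LINT x|lebesgue_on U. h x * \<phi> x) = 0"
  shows "AE x in lebesgue_on U. h x = 0"
proof (rule AE_compacts_imp_AE_open[OF assms(1)])
  fix K0 assume K0: "compact K0" "K0 \<subseteq> U"
  have h: "integrable (lebesgue_on K0) h" using assms(2) K0 by (auto simp: locally_integrable_on_def)
  have 0: "(LINT x|lebesgue_on K. h x) = 0" if "compact K" "K \<subseteq> K0" for K
    using integral_compact_eq_0[OF assms that(1)] that K0 by auto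
  have "AE x in lebesgue_on K0. h x \<le> 0"
    using nonpos_AE_if_integral_compact_eq_0[OF K0(1) h 0] .
  moreover have "AE x in lebesgue_on K0. - h x \<le> 0"
    using h 0 by (intro nonpos_AE_if_integral_compact_eq_0[OF K0(1)]) auto
  ultimately show "AE x in lebesgue_on K0. h x = 0" by eventually_elim simp
qed


lemma locally_integrable_component:
  fixes g :: vfield
  assumes "locally_integrable_on U g"
  shows "locally_integrable_on U (\<lambda>x. g x $ i)"
  using assms integrable_bounded_linear[OF bounded_linear_vec_nth]
  unfolding locally_integrable_on_def by blast

lemma locally_integrable_lincomb:
  assumes "locally_integrable_on U v" "locally_integrable_on U w"
  shows "locally_integrable_on U (\<lambda>x. a *\<^sub>R v x + b *\<^sub>R w x)"
  using assms unfolding locally_integrable_on_def by simp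

lemma locally_integrable_continuous_scaleR:
  fixes h :: "real^2 \<Rightarrow> 'b::{banach,second_countable_topology}"
  assumes "locally_integrable_on U h" "continuous_on UNIV s"
  shows "locally_integrable_on U (\<lambda>x. s x *\<^sub>R h x)"
  unfolding locally_integrable_on_def
proof (intro allI impI)
  fix K assume K: "compact K \<and> K \<subseteq> U"
  then have h: "integrable (lebesgue_on K) h" using assms(1) by (simp add: locally_integrable_on_def)
  have sm: "s \<in> borel_measurable (lebesgue_on K)"
    using borel_measurable_continuous_onI[OF assms(2)]
    by (intro measurable_restrict_space1 measurable_completion) simp
  have "compact (s ` K)" using K compact_continuous_image continuous_on_subset[OF assms(2)] by blast
  then obtain B where B: "\<And>y. y \<in> s ` K \<Longrightarrow> norm y \<le> B"
    using compact_imp_bounded bounded_iff by metis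
  show "integrable (lebesgue_on K) (\<lambda>x. s x *\<^sub>R h x)"
  proof (rule Bochner_Integration.integrable_bound)
    show "integrable (lebesgue_on K) (\<lambda>x. B *\<^sub>R h x)" using h by simp
    show "(\<lambda>x. s x *\<^sub>R h x) \<in> borel_measurable (lebesgue_on K)"
      using h sm by (intro borel_measurable_scaleR) auto
    show "AE x in lebesgue_on K. norm (s x *\<^sub>R h x) \<le> norm (B *\<^sub>R h x)"
    proof (rule AE_I2)
      fix x assume "x \<in> space (lebesgue_on K)"
      then have "\<bar>s x\<bar> \<le> \<bar>B\<bar>" using B[of "s x"] by auto
      then show "norm (s x *\<^sub>R h x) \<le> norm (B *\<^sub>R h x)" by (simp add: mult_right_mono)
    qed
  qed
qed

lemma locally_integrable_cong:
  assumes "\<And>x. x \<in> U \<Longrightarrow> v x = w x" "locally_integrable_on U v"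
  shows "locally_integrable_on U w"
  unfolding locally_integrable_on_def
proof (intro allI impI)
  fix K assume K: "compact K \<and> K \<subseteq> U"
  have "integrable (lebesgue_on K) v \<longleftrightarrow> integrable (lebesgue_on K) w"
    by (rule Bochner_Integration.integrable_cong) (use K assms(1) in auto)
  then show "integrable (lebesgue_on K) w" using assms(2) K by (simp add: locally_integrable_on_def)
qed

lemma has_weak_gradientD:
  assumes "has_weak_gradient U v g" "\<phi> \<in> C0_infinity U"
  shows "(LINT x|lebesgue_on U. v x * partial_deriv i \<phi> x) = - (LINT x|lebesgue_on U. g x $ i * \<phi> x)"
  using assms unfolding has_weak_gradient_def by blast

lemma has_weak_gradient_locally_integrable:
  assumes "has_weak_gradient U v g"
  shows "locally_integrable_on U v" "locally_integrable_on U g"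
  using assms unfolding has_weak_gradient_def by blast+

text \<open>Weak gradients are chosen by \<open>SOME\<close>; uniqueness makes this choice linear up to null sets.\<close>

lemma has_weak_gradient_unique:
  assumes "open U" "has_weak_gradient U v g" "has_weak_gradient U v g'"
  shows "AE x in lebesgue_on U. g x = g' x"
proof -
  note li = locally_integrable_component[OF has_weak_gradient_locally_integrable(2)[OF assms(2)]]
    locally_integrable_component[OF has_weak_gradient_locally_integrable(2)[OF assms(3)]]
  have "AE x in lebesgue_on U. g x $ i - g' x $ i = 0" for i
  proof (rule fundamental_lemma_calculus_of_variations[OF assms(1)])
    show "locally_integrable_on U (\<lambda>x. g x $ i - g' x $ i)"
      using locally_integrable_lincomb[OF li, of 1 i "- 1" i] by simp
    fix \<phi> assume \<phi>: "\<phi> \<in> C0_infinity U"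
    have "(LINT x|lebesgue_on U. (g x $ i - g' x $ i) * \<phi> x) =
        (LINT x|lebesgue_on U. g x $ i * \<phi> x) - (LINT x|lebesgue_on U. g' x $ i * \<phi> x)"
      using locally_integrable_times_test[OF assms(1) li(1) \<phi>]
        locally_integrable_times_test[OF assms(1) li(2) \<phi>]
      by (simp add: left_diff_distrib)
    then show "(LINT x|lebesgue_on U. (g x $ i - g' x $ i) * \<phi> x) = 0"
      using has_weak_gradientD[OF assms(2) \<phi>, of i] has_weak_gradientD[OF assms(3) \<phi>, of i] by simp
  qed
  then have "AE x in lebesgue_on U. \<forall>i. g x $ i - g' x $ i = 0"
    by (rule eventually_all_finite)
  then show ?thesis by (rule eventually_mono) (simp add: vec_eq_iff)
qed

lemma weak_grad_AE:
  assumes "open U" "has_weak_gradient U v g"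
  shows "AE x in lebesgue_on U. weak_grad U v x = g x"
    and has_weak_gradient_weak_grad: "has_weak_gradient U v (weak_grad U v)"
proof -
  show h: "has_weak_gradient U v (weak_grad U v)"
    unfolding weak_grad_def using someI[of "has_weak_gradient U v", OF assms(2)] .
  show "AE x in lebesgue_on U. weak_grad U v x = g x"
    by (rule has_weak_gradient_unique[OF assms(1) h assms(2)])
qed

lemma has_weak_gradient_lincomb:
  assumes "open U" "has_weak_gradient U v g" "has_weak_gradient U w h"
  shows "has_weak_gradient U (\<lambda>x. a * v x + b * w x) (\<lambda>x. a *\<^sub>R g x + b *\<^sub>R h x)"
  unfolding has_weak_gradient_def
proof (intro conjI ballI allI)
  note li = has_weak_gradient_locally_integrable[OF assms(2)] has_weak_gradient_locally_integrable[OF assms(3)]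
  show "locally_integrable_on U (\<lambda>x. a * v x + b * w x)"
    using locally_integrable_lincomb[OF li(1,3), of a b] by simp
  show "locally_integrable_on U (\<lambda>x. a *\<^sub>R g x + b *\<^sub>R h x)"
    by (rule locally_integrable_lincomb[OF li(2,4)])
  fix \<phi> i assume \<phi>: "\<phi> \<in> C0_infinity U"
  note t = locally_integrable_times_test[OF assms(1)]
  note i = t[OF li(1) C0_infinity_partial_deriv[OF \<phi>]] t[OF li(3) C0_infinity_partial_deriv[OF \<phi>]]
    t[OF locally_integrable_component[OF li(2)] \<phi>] t[OF locally_integrable_component[OF li(4)] \<phi>]
  have "(LINT x|lebesgue_on U. (a * v x + b * w x) * partial_deriv i \<phi> x) =
      (LINT x|lebesgue_on U. a * (v x * partial_deriv i \<phi> x) + b * (w x * partial_deriv i \<phi> x))"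
    by (simp add: algebra_simps)
  also have "\<dots> = a * (LINT x|lebesgue_on U. v x * partial_deriv i \<phi> x)
      + b * (LINT x|lebesgue_on U. w x * partial_deriv i \<phi> x)"
    using i by simp
  also have "\<dots> = - (a * (LINT x|lebesgue_on U. g x $ i * \<phi> x) + b * (LINT x|lebesgue_on U. h x $ i * \<phi> x))"
    using has_weak_gradientD[OF assms(2) \<phi>, of i] has_weak_gradientD[OF assms(3) \<phi>, of i] by simp
  also have "\<dots> = - (LINT x|lebesgue_on U. a * (g x $ i * \<phi> x) + b * (h x $ i * \<phi> x))"
    using i by simp
  also have "\<dots> = - (LINT x|lebesgue_on U. (a *\<^sub>R g x + b *\<^sub>R h x) $ i * \<phi> x)"
    by (simp add: algebra_simps)
  finally show "(LINT x|lebesgue_on U. (a * v x + b * w x) * partial_deriv i \<phi> x) =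
      - (LINT x|lebesgue_on U. (a *\<^sub>R g x + b *\<^sub>R h x) $ i * \<phi> x)" .
qed



text \<open>Only the product of \<open>\<zeta>\<close> and \<open>\<psi>\<close> has to be a test function on \<open>U\<close>.  For a cutoff \<open>\<zeta>\<close> this allows
  every smooth \<open>\<psi>\<close>, in particular the translates of a mollifier.\<close>

lemma integral_mult_smooth_partial_deriv:
  assumes "open U" "has_weak_gradient U v g" "smooth \<zeta>" "smooth \<psi>"
    and "(\<lambda>x. \<zeta> x * \<psi> x) \<in> C0_infinity U"
    and "integrable (lebesgue_on U) (\<lambda>x. v x * (\<psi> x * partial_deriv i \<zeta> x))"
    and "integrable (lebesgue_on U) (\<lambda>x. g x $ i * (\<zeta> x * \<psi> x))"
  shows "(LINT x|lebesgue_on U. (\<zeta> x * v x) * partial_deriv i \<psi> x) =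
    - (LINT x|lebesgue_on U. (\<zeta> x * g x $ i + v x * partial_deriv i \<zeta> x) * \<psi> x)"
proof -
  note li = has_weak_gradient_locally_integrable[OF assms(2)]
  have d: "partial_deriv i (\<lambda>x. \<zeta> x * \<psi> x) x = \<zeta> x * partial_deriv i \<psi> x + partial_deriv i \<zeta> x * \<psi> x" for x
    using assms(3,4) by (intro partial_deriv_mult smooth_differentiable)
  have i1: "integrable (lebesgue_on U) (\<lambda>x. v x * partial_deriv i (\<lambda>x. \<zeta> x * \<psi> x) x)"
    by (rule locally_integrable_times_test[OF assms(1) li(1) C0_infinity_partial_deriv[OF assms(5)]])
  have "(LINT x|lebesgue_on U. (\<zeta> x * v x) * partial_deriv i \<psi> x) =
      (LINT x|lebesgue_on U. v x * partial_deriv i (\<lambda>x. \<zeta> x * \<psi> x) x - v x * (\<psi> x * partial_deriv i \<zeta> x))"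
    unfolding d by (simp add: algebra_simps)
  also have "\<dots> = - (LINT x|lebesgue_on U. g x $ i * (\<zeta> x * \<psi> x))
      - (LINT x|lebesgue_on U. v x * (\<psi> x * partial_deriv i \<zeta> x))"
    using has_weak_gradientD[OF assms(2,5), of i] i1 assms(6) by simp
  also have "\<dots> = - (LINT x|lebesgue_on U. g x $ i * (\<zeta> x * \<psi> x) + v x * (\<psi> x * partial_deriv i \<zeta> x))"
    using assms(6,7) by simp
  finally show ?thesis by (simp add: algebra_simps)
qed

lemma has_weak_gradient_mult_smooth:
  assumes "open U" "has_weak_gradient U v g" "smooth \<zeta>"
  shows "has_weak_gradient U (\<lambda>x. \<zeta> x * v x) (\<lambda>x. \<zeta> x *\<^sub>R g x + v x *\<^sub>R (\<chi> i. partial_deriv i \<zeta> x))"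
  unfolding has_weak_gradient_def
proof (intro conjI ballI allI)
  note li = has_weak_gradient_locally_integrable[OF assms(2)]
  show "locally_integrable_on U (\<lambda>x. \<zeta> x * v x)"
    using locally_integrable_continuous_scaleR[OF li(1) smooth_continuous[OF assms(3)]] by simp
  have cd: "continuous_on UNIV (\<lambda>x. \<chi> i. partial_deriv i \<zeta> x)"
    by (intro continuous_on_vec_lambda smooth_continuous smooth_partial_deriv[OF assms(3)])
  have "locally_integrable_on U (\<lambda>x. v x *\<^sub>R (\<chi> i. partial_deriv i \<zeta> x))"
    unfolding locally_integrable_on_def
  proof (intro allI impI)
    fix K assume K: "compact K \<and> K \<subseteq> U"
    have "integrable (lebesgue_on K) (\<lambda>x. (v x *\<^sub>R (\<chi> i. partial_deriv i \<zeta> x)) $ j)" for j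
      using locally_integrable_continuous_scaleR[OF li(1) smooth_continuous[OF smooth_partial_deriv[OF assms(3)]], of j] K
      by (simp add: locally_integrable_on_def mult.commute)
    then show "integrable (lebesgue_on K) (\<lambda>x. v x *\<^sub>R (\<chi> i. partial_deriv i \<zeta> x))"
      using K compact_sets_lebesgue by (subst integrable_iff_component) auto
  qed
  then show "locally_integrable_on U (\<lambda>x. \<zeta> x *\<^sub>R g x + v x *\<^sub>R (\<chi> i. partial_deriv i \<zeta> x))"
    using locally_integrable_lincomb[OF locally_integrable_continuous_scaleR[OF li(2) smooth_continuous[OF assms(3)]], of _ 1 1]
    by simp
  fix \<phi> i assume \<phi>: "\<phi> \<in> C0_infinity U"
  have \<zeta>\<phi>: "(\<lambda>x. \<zeta> x * \<phi> x) \<in> C0_infinity U"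
    using C0_infinity_mult[OF \<phi> assms(3)] by (simp add: mult.commute)
  have "(LINT x|lebesgue_on U. (\<zeta> x * v x) * partial_deriv i \<phi> x) =
    - (LINT x|lebesgue_on U. (\<zeta> x * g x $ i + v x * partial_deriv i \<zeta> x) * \<phi> x)"
    by (intro integral_mult_smooth_partial_deriv[OF assms C0_infinity_smooth[OF \<phi>] \<zeta>\<phi>]
        locally_integrable_times_test assms li(1) locally_integrable_component[OF li(2)] \<zeta>\<phi>
        C0_infinity_mult \<phi> smooth_partial_deriv)
  then show "(LINT x|lebesgue_on U. \<zeta> x * v x * partial_deriv i \<phi> x) =
       - (LINT x|lebesgue_on U. (\<zeta> x *\<^sub>R g x + v x *\<^sub>R (\<chi> i. partial_deriv i \<zeta> x)) $ i * \<phi> x)"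
    by simp
qed

lemma has_weak_gradient_subset:
  assumes "open U" "open U'" "U' \<subseteq> U" "has_weak_gradient U v g"
  shows "has_weak_gradient U' v g"
  unfolding has_weak_gradient_def
proof (intro conjI ballI allI)
  note li = has_weak_gradient_locally_integrable[OF assms(4)]
  show "locally_integrable_on U' v" "locally_integrable_on U' g"
    by (intro locally_integrable_on_subset[OF _ assms(3)] li)+
  fix \<phi> i assume \<phi>: "\<phi> \<in> C0_infinity U'"
  have eq: "(LINT x|lebesgue_on U'. h x * \<psi> x) = (LINT x|lebesgue_on U. h x * \<psi> x)"
    if "\<psi> \<in> C0_infinity U'" for h \<psi>
  proof -
    have z: "x \<notin> U' \<Longrightarrow> h x * \<psi> x = 0" for x using C0_infinity_eq_0[OF that] by simp
    then have "x \<notin> U \<Longrightarrow> h x * \<psi> x = 0" for x using assms(3) by blast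
    then show ?thesis
      using z LINT_on_eq_LINT_lebesgue(1)[of U "\<lambda>x. h x * \<psi> x"]
        LINT_on_eq_LINT_lebesgue(1)[of U' "\<lambda>x. h x * \<psi> x"] assms(1,2) by auto
  qed
  show "(LINT x|lebesgue_on U'. v x * partial_deriv i \<phi> x) = - (LINT x|lebesgue_on U'. g x $ i * \<phi> x)"
    using has_weak_gradientD[OF assms(4) C0_infinity_mono[OF \<phi> assms(3)], of i]
    by (simp add: eq[OF \<phi>] eq[OF C0_infinity_partial_deriv[OF \<phi>]])
qed

lemma has_weak_gradient_cong:
  assumes "\<And>x. x \<in> U \<Longrightarrow> v x = w x" "has_weak_gradient U v g"
  shows "has_weak_gradient U w g"
proof -
  have "(LINT x|lebesgue_on U. v x * h x) = (LINT x|lebesgue_on U. w x * h x)" for h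
    by (rule Bochner_Integration.integral_cong) (use assms(1) in auto)
  moreover have "locally_integrable_on U w"
    by (rule locally_integrable_cong[OF assms(1) has_weak_gradient_locally_integrable(1)[OF assms(2)]])
  ultimately show ?thesis using assms(2) unfolding has_weak_gradient_def by simp
qed


section \<open>Weighted Lebesgue spaces\<close>

lemma square_integrable_times:
  fixes F G :: "'a \<Rightarrow> real"
  assumes "F \<in> borel_measurable M" "G \<in> borel_measurable M"
    and "integrable M (\<lambda>x. (F x)\<^sup>2)" "integrable M (\<lambda>x. (G x)\<^sup>2)"
  shows "integrable M (\<lambda>x. F x * G x)"
proof (rule Bochner_Integration.integrable_bound)
  show "integrable M (\<lambda>x. (F x)\<^sup>2 + (G x)\<^sup>2)" using assms by simp
  show "(\<lambda>x. F x * G x) \<in> borel_measurable M" using assms by simp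
  have "\<bar>a * b\<bar> \<le> a\<^sup>2 + b\<^sup>2" for a b :: real
    using sum_squares_bound[of a b] sum_squares_bound[of a "- b"] zero_le_power2[of a] zero_le_power2[of b]
    by (simp add: abs_le_iff)
  then show "AE x in M. norm (F x * G x) \<le> norm ((F x)\<^sup>2 + (G x)\<^sup>2)" by (intro AE_I2) simp
qed

lemma integral_Cauchy_Schwarz:
  fixes F G :: "'a \<Rightarrow> real"
  assumes "F \<in> borel_measurable M" "G \<in> borel_measurable M"
    and "integrable M (\<lambda>x. (F x)\<^sup>2)" "integrable M (\<lambda>x. (G x)\<^sup>2)"
  shows "\<bar>LINT x|M. F x * G x\<bar> \<le> sqrt (LINT x|M. (F x)\<^sup>2) * sqrt (LINT x|M. (G x)\<^sup>2)"
proof -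
  define A B C where "A = (LINT x|M. (F x)\<^sup>2)" and "B = (LINT x|M. (G x)\<^sup>2)"
    and "C = (LINT x|M. F x * G x)"
  note FG = square_integrable_times[OF assms]
  have "0 \<le> A" "0 \<le> B" unfolding A_def B_def by simp_all
  have q: "0 \<le> A - 2 * t * C + t\<^sup>2 * B" for t
  proof -
    have "0 \<le> (LINT x|M. (F x - t * G x)\<^sup>2)" by simp
    also have "\<dots> = (LINT x|M. (F x)\<^sup>2 - 2 * t * (F x * G x) + t\<^sup>2 * (G x)\<^sup>2)"
      by (intro Bochner_Integration.integral_cong refl) (simp add: power2_eq_square algebra_simps)
    also have "\<dots> = A - 2 * t * C + t\<^sup>2 * B"
      unfolding A_def B_def C_def using FG assms by simp
    finally show ?thesis .
  qed
  have "C\<^sup>2 \<le> A * B"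
  proof (cases "B = 0")
    case True
    have "C = 0"
    proof (rule ccontr)
      assume "C \<noteq> 0"
      then show False using q[of "(A + 1) / (2 * C)"] True by simp
    qed
    then show ?thesis using \<open>0 \<le> A\<close> True by simp
  next
    case False
    then have "0 \<le> A - C\<^sup>2 / B" using q[of "C / B"] by (simp add: power2_eq_square)
    then show ?thesis using False \<open>0 \<le> B\<close> by (simp add: field_simps)
  qed
  then have "\<bar>C\<bar> \<le> sqrt (A * B)" by (simp add: real_le_rsqrt)
  then show ?thesis by (simp add: A_def B_def C_def real_sqrt_mult)
qed

text \<open>What is used of the \<open>A2\<close> condition on a bounded set.  The properties are symmetric in \<open>\<omega>\<close> and its
  reciprocal.  Integrability of both is what puts bounded functions into both weighted spaces and the
  weighted spaces into \<open>L\<^sup>1\<close>.\<close>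

definition weight_on :: "(real^2) set \<Rightarrow> scalar \<Rightarrow> bool" where
  "weight_on \<Omega> \<omega> \<longleftrightarrow> open \<Omega> \<and> bounded \<Omega> \<and> (\<forall>x. 0 \<le> \<omega> x) \<and> (AE x in lebesgue_on \<Omega>. 0 < \<omega> x) \<and>
     integrable (lebesgue_on \<Omega>) \<omega> \<and> integrable (lebesgue_on \<Omega>) (inv_weight \<omega>)"

lemma weight_onD:
  assumes "weight_on \<Omega> \<omega>"
  shows "open \<Omega>" "bounded \<Omega>" "0 \<le> \<omega> x" "AE x in lebesgue_on \<Omega>. 0 < \<omega> x"
    "integrable (lebesgue_on \<Omega>) \<omega>" "integrable (lebesgue_on \<Omega>) (inv_weight \<omega>)"
    "\<omega> \<in> borel_measurable (lebesgue_on \<Omega>)"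
  using assms unfolding weight_on_def by auto

lemma inv_inv_weight [simp]: "inv_weight (inv_weight \<omega>) = \<omega>"
  by (simp add: inv_weight_def)

lemma weight_on_inv: "weight_on \<Omega> \<omega> \<Longrightarrow> weight_on \<Omega> (inv_weight \<omega>)"
  unfolding weight_on_def using inv_inv_weight[of \<omega>] by (auto simp: inv_weight_def)

lemma weight_on_1:
  assumes "open \<Omega>" "bounded \<Omega>"
  shows "weight_on \<Omega> (\<lambda>_. 1)"
proof -
  have "\<Omega> \<in> lmeasurable" using assms lmeasurable_open by blast
  then have "integrable lebesgue (indicat_real \<Omega>)" by (simp add: lmeasurable_iff_integrable)
  moreover have "indicat_real \<Omega> = (\<lambda>x. if x \<in> \<Omega> then 1 else 0)" by auto
  ultimately have "integrable (lebesgue_on \<Omega>) (\<lambda>_. 1::real)"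
    using Lebesgue_Measure.integrable_restrict_UNIV[of \<Omega> "\<lambda>_. 1::real"] assms(1) by simp
  then show ?thesis unfolding weight_on_def using assms by (simp add: inv_weight_def)
qed

lemma LpD:
  assumes "g \<in> Lp n \<omega> \<Omega>"
  shows "g \<in> borel_measurable (lebesgue_on \<Omega>)" "integrable (lebesgue_on \<Omega>) (\<lambda>x. norm (g x) ^ n * \<omega> x)"
  using assms by (simp_all add: Lp_def)

lemma Lp_norm_2: "Lp_norm 2 \<omega> \<Omega> g = sqrt (LINT x|lebesgue_on \<Omega>. (norm (g x))\<^sup>2 * \<omega> x)"
  by (simp add: Lp_norm_def sqrt_def)

lemma Lp_norm_ge_0:
  assumes "weight_on \<Omega> \<omega>"
  shows "0 \<le> Lp_norm n \<omega> \<Omega> g"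
  unfolding Lp_norm_def using weight_onD(3)[OF assms]
  by (cases "n = 0") (auto intro!: real_root_ge_zero integral_nonneg_AE AE_I2)

lemma Lp_norm_mono:
  assumes "weight_on \<Omega> \<omega>" "g \<in> Lp 2 \<omega> \<Omega>" "f \<in> borel_measurable (lebesgue_on \<Omega>)"
    and "AE x in lebesgue_on \<Omega>. norm (f x) \<le> c * norm (g x)" "0 \<le> c"
  shows "f \<in> Lp 2 \<omega> \<Omega>" "Lp_norm 2 \<omega> \<Omega> f \<le> c * Lp_norm 2 \<omega> \<Omega> g"
proof -
  note w = weight_onD[OF assms(1)] and g = LpD[OF assms(2)]
  have le: "AE x in lebesgue_on \<Omega>. (norm (f x))\<^sup>2 * \<omega> x \<le> c\<^sup>2 * ((norm (g x))\<^sup>2 * \<omega> x)"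
    using assms(4)
  proof eventually_elim
    case (elim x)
    then have "(norm (f x))\<^sup>2 \<le> (c * norm (g x))\<^sup>2" by (intro power_mono) auto
    from mult_right_mono[OF this w(3)[of x]] show ?case by (simp add: power_mult_distrib mult.assoc)
  qed
  have i: "integrable (lebesgue_on \<Omega>) (\<lambda>x. (norm (f x))\<^sup>2 * \<omega> x)"
  proof (rule Bochner_Integration.integrable_bound)
    show "integrable (lebesgue_on \<Omega>) (\<lambda>x. c\<^sup>2 * ((norm (g x))\<^sup>2 * \<omega> x))" using g(2) by simp
    show "(\<lambda>x. (norm (f x))\<^sup>2 * \<omega> x) \<in> borel_measurable (lebesgue_on \<Omega>)" using assms(3) w(7) by simp
    show "AE x in lebesgue_on \<Omega>. norm ((norm (f x))\<^sup>2 * \<omega> x) \<le> norm (c\<^sup>2 * ((norm (g x))\<^sup>2 * \<omega> x))"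
      using le by eventually_elim (use w(3) in \<open>simp add: abs_mult\<close>)
  qed
  then show "f \<in> Lp 2 \<omega> \<Omega>" using assms(3) by (simp add: Lp_def)
  have "(LINT x|lebesgue_on \<Omega>. (norm (f x))\<^sup>2 * \<omega> x) \<le> (LINT x|lebesgue_on \<Omega>. c\<^sup>2 * ((norm (g x))\<^sup>2 * \<omega> x))"
    by (rule integral_mono_AE[OF i _ le]) (use g(2) in simp)
  then have "sqrt (LINT x|lebesgue_on \<Omega>. (norm (f x))\<^sup>2 * \<omega> x) \<le> sqrt (c\<^sup>2 * (LINT x|lebesgue_on \<Omega>. (norm (g x))\<^sup>2 * \<omega> x))"
    by simp
  then show "Lp_norm 2 \<omega> \<Omega> f \<le> c * Lp_norm 2 \<omega> \<Omega> g"
    using assms(5) by (simp add: Lp_norm_2 real_sqrt_mult)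
qed

lemma Lp_norm_cong:
  assumes "weight_on \<Omega> \<omega>" "g \<in> Lp 2 \<omega> \<Omega>" "f \<in> borel_measurable (lebesgue_on \<Omega>)"
    and "AE x in lebesgue_on \<Omega>. f x = g x"
  shows "f \<in> Lp 2 \<omega> \<Omega>" "Lp_norm 2 \<omega> \<Omega> f = Lp_norm 2 \<omega> \<Omega> g"
proof -
  have 1: "AE x in lebesgue_on \<Omega>. norm (f x) \<le> 1 * norm (g x)"
      "AE x in lebesgue_on \<Omega>. norm (g x) \<le> 1 * norm (f x)"
    using assms(4) by (auto elim: eventually_mono)
  show f: "f \<in> Lp 2 \<omega> \<Omega>" by (rule Lp_norm_mono(1)[OF assms(1-3) 1(1)]) simp
  show "Lp_norm 2 \<omega> \<Omega> f = Lp_norm 2 \<omega> \<Omega> g"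
    using Lp_norm_mono(2)[OF assms(1-3) 1(1)] Lp_norm_mono(2)[OF assms(1) f LpD(1)[OF assms(2)] 1(2)]
    by simp
qed

text \<open>The spaces with weights \<open>\<omega>\<close> and \<open>\<omega>\<^sup>-\<^sup>1\<close> are dual to each other: the roots of the two weights
  cancel in the Cauchy-Schwarz inequality.\<close>

lemma Lp_pairing:
  fixes f :: "real^2 \<Rightarrow> 'b::real_normed_vector" and g :: "real^2 \<Rightarrow> 'c::real_normed_vector"
  assumes "weight_on \<Omega> \<omega>" "f \<in> Lp 2 \<omega> \<Omega>" "g \<in> Lp 2 (inv_weight \<omega>) \<Omega>"
  shows "integrable (lebesgue_on \<Omega>) (\<lambda>x. norm (f x) * norm (g x))"
    and "(LINT x|lebesgue_on \<Omega>. norm (f x) * norm (g x)) \<le> Lp_norm 2 \<omega> \<Omega> f * Lp_norm 2 (inv_weight \<omega>) \<Omega> g"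
proof -
  note w = weight_onD[OF assms(1)] and f = LpD[OF assms(2)] and g = LpD[OF assms(3)]
  define F where "F x = norm (f x) * sqrt (\<omega> x)" for x
  define G where "G x = norm (g x) * sqrt (inv_weight \<omega> x)" for x
  have Fsq: "(F x)\<^sup>2 = (norm (f x))\<^sup>2 * \<omega> x" "(G x)\<^sup>2 = (norm (g x))\<^sup>2 * inv_weight \<omega> x" for x
    using w(3)[of x] by (simp_all add: F_def G_def power_mult_distrib inv_weight_def)
  have m: "F \<in> borel_measurable (lebesgue_on \<Omega>)" "G \<in> borel_measurable (lebesgue_on \<Omega>)"
    using f(1) g(1) w(7) unfolding F_def G_def inv_weight_def by measurable
  have i: "integrable (lebesgue_on \<Omega>) (\<lambda>x. (F x)\<^sup>2)" "integrable (lebesgue_on \<Omega>) (\<lambda>x. (G x)\<^sup>2)"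
    using f(2) g(2) by (simp_all add: Fsq)
  have eq: "AE x in lebesgue_on \<Omega>. F x * G x = norm (f x) * norm (g x)"
    using w(4)
  proof eventually_elim
    case (elim x)
    then have "sqrt (\<omega> x) * sqrt (inverse (\<omega> x)) = 1" by (simp flip: real_sqrt_mult)
    then show ?case by (simp add: F_def G_def inv_weight_def)
  qed
  have mm: "(\<lambda>x. norm (f x) * norm (g x)) \<in> borel_measurable (lebesgue_on \<Omega>)" using f(1) g(1) by simp
  have FG: "integrable (lebesgue_on \<Omega>) (\<lambda>x. F x * G x)" by (rule square_integrable_times[OF m i])
  show "integrable (lebesgue_on \<Omega>) (\<lambda>x. norm (f x) * norm (g x))"
    using integrable_cong_AE[THEN iffD1, OF _ mm eq FG] m by simp
  have "(LINT x|lebesgue_on \<Omega>. norm (f x) * norm (g x)) = (LINT x|lebesgue_on \<Omega>. F x * G x)"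
    by (rule integral_cong_AE) (use mm m eq in \<open>auto elim: eventually_mono\<close>)
  also have "\<dots> \<le> sqrt (LINT x|lebesgue_on \<Omega>. (F x)\<^sup>2) * sqrt (LINT x|lebesgue_on \<Omega>. (G x)\<^sup>2)"
    using integral_Cauchy_Schwarz[OF m i] by simp
  also have "\<dots> = Lp_norm 2 \<omega> \<Omega> f * Lp_norm 2 (inv_weight \<omega>) \<Omega> g"
    by (simp add: Lp_norm_2 Fsq)
  finally show "(LINT x|lebesgue_on \<Omega>. norm (f x) * norm (g x)) \<le> Lp_norm 2 \<omega> \<Omega> f * Lp_norm 2 (inv_weight \<omega>) \<Omega> g" .
qed

lemma Lp_pairing_bound:
  fixes h :: scalar
  assumes "weight_on \<Omega> \<omega>" "f \<in> Lp 2 \<omega> \<Omega>" "g \<in> Lp 2 (inv_weight \<omega>) \<Omega>"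
    and "h \<in> borel_measurable (lebesgue_on \<Omega>)" "\<And>x. \<bar>h x\<bar> \<le> norm (f x) * norm (g x)"
  shows "integrable (lebesgue_on \<Omega>) h"
    and "\<bar>LINT x|lebesgue_on \<Omega>. h x\<bar> \<le> Lp_norm 2 \<omega> \<Omega> f * Lp_norm 2 (inv_weight \<omega>) \<Omega> g"
proof -
  note p = Lp_pairing[OF assms(1-3)]
  show i: "integrable (lebesgue_on \<Omega>) h"
    by (rule Bochner_Integration.integrable_bound[OF p(1) assms(4)]) (use assms(5) in auto)
  have "\<bar>LINT x|lebesgue_on \<Omega>. h x\<bar> \<le> (LINT x|lebesgue_on \<Omega>. \<bar>h x\<bar>)" by (rule integral_abs_bound)
  also have "\<dots> \<le> (LINT x|lebesgue_on \<Omega>. norm (f x) * norm (g x))"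
    by (rule integral_mono) (use i p(1) assms(5) in auto)
  finally show "\<bar>LINT x|lebesgue_on \<Omega>. h x\<bar> \<le> Lp_norm 2 \<omega> \<Omega> f * Lp_norm 2 (inv_weight \<omega>) \<Omega> g"
    using p(2) by simp
qed

lemma Lp_lincomb:
  fixes f g :: "real^2 \<Rightarrow> 'b::{real_normed_vector,second_countable_topology}"
  assumes "weight_on \<Omega> \<omega>" "f \<in> Lp 2 \<omega> \<Omega>" "g \<in> Lp 2 \<omega> \<Omega>"
  shows "(\<lambda>x. a *\<^sub>R f x + b *\<^sub>R g x) \<in> Lp 2 \<omega> \<Omega>"
    and "Lp_norm 2 \<omega> \<Omega> (\<lambda>x. a *\<^sub>R f x + b *\<^sub>R g x) \<le> \<bar>a\<bar> * Lp_norm 2 \<omega> \<Omega> f + \<bar>b\<bar> * Lp_norm 2 \<omega> \<Omega> g"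
proof -
  note w = weight_onD[OF assms(1)] and f = LpD[OF assms(2)] and g = LpD[OF assms(3)]
  define F where "F x = \<bar>a\<bar> * norm (f x) * sqrt (\<omega> x)" for x
  define G where "G x = \<bar>b\<bar> * norm (g x) * sqrt (\<omega> x)" for x
  define A B where "A = (LINT x|lebesgue_on \<Omega>. (F x)\<^sup>2)" and "B = (LINT x|lebesgue_on \<Omega>. (G x)\<^sup>2)"
  have sq: "(F x)\<^sup>2 = a\<^sup>2 * ((norm (f x))\<^sup>2 * \<omega> x)" "(G x)\<^sup>2 = b\<^sup>2 * ((norm (g x))\<^sup>2 * \<omega> x)" for x
    using w(3)[of x] by (simp_all add: F_def G_def power_mult_distrib)
  have m: "F \<in> borel_measurable (lebesgue_on \<Omega>)" "G \<in> borel_measurable (lebesgue_on \<Omega>)"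
    using f(1) g(1) w(7) unfolding F_def G_def by measurable
  have i: "integrable (lebesgue_on \<Omega>) (\<lambda>x. (F x)\<^sup>2)" "integrable (lebesgue_on \<Omega>) (\<lambda>x. (G x)\<^sup>2)"
    using f(2) g(2) by (simp_all add: sq)
  note FG = square_integrable_times[OF m i]
  have AB: "0 \<le> A" "0 \<le> B" by (simp_all add: A_def B_def)
  have ms: "(\<lambda>x. a *\<^sub>R f x + b *\<^sub>R g x) \<in> borel_measurable (lebesgue_on \<Omega>)" using f(1) g(1) by simp
  let ?h = "\<lambda>x. (norm (a *\<^sub>R f x + b *\<^sub>R g x))\<^sup>2 * \<omega> x"
  have le: "?h x \<le> (F x)\<^sup>2 + 2 * (F x * G x) + (G x)\<^sup>2" for x
  proof -
    have "norm (a *\<^sub>R f x + b *\<^sub>R g x) \<le> \<bar>a\<bar> * norm (f x) + \<bar>b\<bar> * norm (g x)"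
      using norm_triangle_ineq[of "a *\<^sub>R f x" "b *\<^sub>R g x"] by simp
    then have "(norm (a *\<^sub>R f x + b *\<^sub>R g x))\<^sup>2 \<le> (\<bar>a\<bar> * norm (f x) + \<bar>b\<bar> * norm (g x))\<^sup>2"
      by (intro power_mono) auto
    then have "?h x \<le> (\<bar>a\<bar> * norm (f x) + \<bar>b\<bar> * norm (g x))\<^sup>2 * (sqrt (\<omega> x))\<^sup>2"
      using w(3)[of x] by (simp add: mult_right_mono)
    also have "\<dots> = (F x)\<^sup>2 + 2 * (F x * G x) + (G x)\<^sup>2"
      unfolding F_def G_def by (simp only: power2_eq_square) algebra
    finally show ?thesis .
  qed
  have int: "integrable (lebesgue_on \<Omega>) ?h"
  proof (rule Bochner_Integration.integrable_bound)
    show "integrable (lebesgue_on \<Omega>) (\<lambda>x. (F x)\<^sup>2 + 2 * (F x * G x) + (G x)\<^sup>2)" using i FG by simp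
    show "?h \<in> borel_measurable (lebesgue_on \<Omega>)" using ms w(7) by simp
    show "AE x in lebesgue_on \<Omega>. norm (?h x) \<le> norm ((F x)\<^sup>2 + 2 * (F x * G x) + (G x)\<^sup>2)"
    proof (rule AE_I2)
      fix x
      have "0 \<le> ?h x" using w(3)[of x] by simp
      then show "norm (?h x) \<le> norm ((F x)\<^sup>2 + 2 * (F x * G x) + (G x)\<^sup>2)" using le[of x] by simp
    qed
  qed
  then show "(\<lambda>x. a *\<^sub>R f x + b *\<^sub>R g x) \<in> Lp 2 \<omega> \<Omega>" using ms by (simp add: Lp_def)
  have "(LINT x|lebesgue_on \<Omega>. ?h x) \<le> (LINT x|lebesgue_on \<Omega>. (F x)\<^sup>2 + 2 * (F x * G x) + (G x)\<^sup>2)"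
    by (rule integral_mono[OF int]) (use i FG le in auto)
  also have "\<dots> = A + 2 * (LINT x|lebesgue_on \<Omega>. F x * G x) + B"
    unfolding A_def B_def using i FG by simp
  also have "\<dots> \<le> A + 2 * (sqrt A * sqrt B) + B"
    using integral_Cauchy_Schwarz[OF m i] by (simp add: A_def B_def)
  also have "\<dots> = (sqrt A + sqrt B)\<^sup>2" using AB by (simp add: power2_sum)
  finally have "sqrt (LINT x|lebesgue_on \<Omega>. ?h x) \<le> sqrt A + sqrt B"
    using AB by (intro real_le_lsqrt) auto
  moreover have "sqrt A = \<bar>a\<bar> * Lp_norm 2 \<omega> \<Omega> f" "sqrt B = \<bar>b\<bar> * Lp_norm 2 \<omega> \<Omega> g"
    unfolding A_def B_def sq by (simp_all add: Lp_norm_2 real_sqrt_mult)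
  ultimately show "Lp_norm 2 \<omega> \<Omega> (\<lambda>x. a *\<^sub>R f x + b *\<^sub>R g x) \<le> \<bar>a\<bar> * Lp_norm 2 \<omega> \<Omega> f + \<bar>b\<bar> * Lp_norm 2 \<omega> \<Omega> g"
    by (simp add: Lp_norm_2)
qed

lemma Lp_diff:
  fixes f g :: "real^2 \<Rightarrow> 'b::{real_normed_vector,second_countable_topology}"
  assumes "weight_on \<Omega> \<omega>" "f \<in> Lp 2 \<omega> \<Omega>" "g \<in> Lp 2 \<omega> \<Omega>"
  shows "(\<lambda>x. f x - g x) \<in> Lp 2 \<omega> \<Omega>"
  using Lp_lincomb(1)[OF assms, of 1 "- 1"] by simp

lemma Lp_times_bounded:
  fixes f :: "real^2 \<Rightarrow> 'b::{real_normed_vector,second_countable_topology}"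
  assumes "weight_on \<Omega> \<omega>" "f \<in> Lp 2 \<omega> \<Omega>" "s \<in> borel_measurable (lebesgue_on \<Omega>)"
    and "\<And>x. \<bar>s x\<bar> \<le> c" "0 \<le> c"
  shows "(\<lambda>x. s x *\<^sub>R f x) \<in> Lp 2 \<omega> \<Omega>" "Lp_norm 2 \<omega> \<Omega> (\<lambda>x. s x *\<^sub>R f x) \<le> c * Lp_norm 2 \<omega> \<Omega> f"
proof -
  have m: "(\<lambda>x. s x *\<^sub>R f x) \<in> borel_measurable (lebesgue_on \<Omega>)"
    by (rule borel_measurable_scaleR[OF assms(3) LpD(1)[OF assms(2)]])
  have "AE x in lebesgue_on \<Omega>. norm (s x *\<^sub>R f x) \<le> c * norm (f x)"
    using assms(4) by (intro AE_I2) (simp add: mult_right_mono)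
  from Lp_norm_mono[OF assms(1,2) m this assms(5)]
  show "(\<lambda>x. s x *\<^sub>R f x) \<in> Lp 2 \<omega> \<Omega>" "Lp_norm 2 \<omega> \<Omega> (\<lambda>x. s x *\<^sub>R f x) \<le> c * Lp_norm 2 \<omega> \<Omega> f" .
qed

lemma Lp_scaleR_bounded:
  fixes F :: "real^2 \<Rightarrow> 'b::{real_normed_vector,second_countable_topology}"
  assumes "weight_on \<Omega> \<omega>" "f \<in> Lp 2 \<omega> \<Omega>" "F \<in> borel_measurable (lebesgue_on \<Omega>)"
    and "\<And>x. norm (F x) \<le> c" "0 \<le> c"
  shows "(\<lambda>x. f x *\<^sub>R F x) \<in> Lp 2 \<omega> \<Omega>" "Lp_norm 2 \<omega> \<Omega> (\<lambda>x. f x *\<^sub>R F x) \<le> c * Lp_norm 2 \<omega> \<Omega> f"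
proof -
  have m: "(\<lambda>x. f x *\<^sub>R F x) \<in> borel_measurable (lebesgue_on \<Omega>)"
    by (rule borel_measurable_scaleR[OF LpD(1)[OF assms(2)] assms(3)])
  have "AE x in lebesgue_on \<Omega>. norm (f x *\<^sub>R F x) \<le> c * norm (f x)"
    using assms(4) by (intro AE_I2) (simp add: mult.commute[of c] mult_left_mono)
  from Lp_norm_mono[OF assms(1,2) m this assms(5)]
  show "(\<lambda>x. f x *\<^sub>R F x) \<in> Lp 2 \<omega> \<Omega>" "Lp_norm 2 \<omega> \<Omega> (\<lambda>x. f x *\<^sub>R F x) \<le> c * Lp_norm 2 \<omega> \<Omega> f" .
qed

lemma Lp_4_times:
  fixes u w :: vfield
  assumes "weight_on \<Omega> \<omega>" "u \<in> Lp 4 \<omega> \<Omega>" "w \<in> Lp 4 \<omega> \<Omega>"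
  shows "(\<lambda>x. norm (u x) * norm (w x)) \<in> Lp 2 \<omega> \<Omega>"
    and "Lp_norm 2 \<omega> \<Omega> (\<lambda>x. norm (u x) * norm (w x)) \<le> Lp_norm 4 \<omega> \<Omega> u * Lp_norm 4 \<omega> \<Omega> w"
proof -
  note wt = weight_onD[OF assms(1)] and u = LpD[OF assms(2)] and w = LpD[OF assms(3)]
  define F where "F x = (norm (u x))\<^sup>2 * sqrt (\<omega> x)" for x
  define G where "G x = (norm (w x))\<^sup>2 * sqrt (\<omega> x)" for x
  have sq: "(F x)\<^sup>2 = norm (u x) ^ 4 * \<omega> x" "(G x)\<^sup>2 = norm (w x) ^ 4 * \<omega> x"
    "F x * G x = (norm (norm (u x) * norm (w x)))\<^sup>2 * \<omega> x" for x
    using wt(3)[of x] by (simp_all add: F_def G_def power_mult_distrib flip: power_mult)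
  have m: "F \<in> borel_measurable (lebesgue_on \<Omega>)" "G \<in> borel_measurable (lebesgue_on \<Omega>)"
    using u(1) w(1) wt(7) unfolding F_def G_def by measurable
  have i: "integrable (lebesgue_on \<Omega>) (\<lambda>x. (F x)\<^sup>2)" "integrable (lebesgue_on \<Omega>) (\<lambda>x. (G x)\<^sup>2)"
    using u(2) w(2) by (simp_all add: sq)
  show "(\<lambda>x. norm (u x) * norm (w x)) \<in> Lp 2 \<omega> \<Omega>"
    using square_integrable_times[OF m i] u(1) w(1) unfolding Lp_def by (simp add: sq)
  have r4: "sqrt (sqrt y) = root 4 y" for y
    using real_root_mult_exp[of 2 2 y] by (simp add: sqrt_def)
  have "Lp_norm 2 \<omega> \<Omega> (\<lambda>x. norm (u x) * norm (w x)) = sqrt (LINT x|lebesgue_on \<Omega>. F x * G x)"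
    by (simp add: Lp_norm_2 sq)
  also have "\<dots> \<le> sqrt (sqrt (LINT x|lebesgue_on \<Omega>. (F x)\<^sup>2) * sqrt (LINT x|lebesgue_on \<Omega>. (G x)\<^sup>2))"
    using integral_Cauchy_Schwarz[OF m i] by simp
  also have "\<dots> = Lp_norm 4 \<omega> \<Omega> u * Lp_norm 4 \<omega> \<Omega> w"
    by (simp add: real_sqrt_mult r4 sq Lp_norm_def)
  finally show "Lp_norm 2 \<omega> \<Omega> (\<lambda>x. norm (u x) * norm (w x)) \<le> Lp_norm 4 \<omega> \<Omega> u * Lp_norm 4 \<omega> \<Omega> w" .
qed

text \<open>The Hoelder inequality against a constant field of length one.\<close>

lemma Lp_norm_2_le_Lp_norm_4:
  fixes u :: vfield
  assumes "weight_on \<Omega> \<omega>" "u \<in> Lp 4 \<omega> \<Omega>"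
  shows "Lp_norm 2 \<omega> \<Omega> u \<le> Lp_norm 4 \<omega> \<Omega> (\<lambda>_. axis 1 1 :: real^2) * Lp_norm 4 \<omega> \<Omega> u"
proof -
  have 1: "(\<lambda>_. axis 1 1 :: real^2) \<in> Lp 4 \<omega> \<Omega>" using weight_onD[OF assms(1)] by (simp add: Lp_def)
  show ?thesis using Lp_4_times(2)[OF assms(1) 1 assms(2)] by (simp add: Lp_norm_2)
qed

lemma bounded_in_Lp:
  assumes "weight_on \<Omega> \<omega>" "f \<in> borel_measurable (lebesgue_on \<Omega>)" "\<And>x. x \<in> \<Omega> \<Longrightarrow> norm (f x) \<le> B"
  shows "f \<in> Lp 2 \<omega> \<Omega>"
proof (rule Lp_norm_mono(1)[OF assms(1) _ assms(2)])
  show "(\<lambda>_. 1::real) \<in> Lp 2 \<omega> \<Omega>" using weight_onD[OF assms(1)] by (simp add: Lp_def)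
  show "AE x in lebesgue_on \<Omega>. norm (f x) \<le> max B 0 * norm (1::real)"
    using assms(3) by (intro AE_I2) (fastforce simp: weight_onD(1)[OF assms(1)])
qed simp

lemma Lp_integrable:
  fixes f :: "real^2 \<Rightarrow> 'b::{banach,second_countable_topology}"
  assumes "weight_on \<Omega> \<omega>" "f \<in> Lp 2 \<omega> \<Omega>"
  shows "integrable (lebesgue_on \<Omega>) f"
    and "(LINT x|lebesgue_on \<Omega>. norm (f x)) \<le> Lp_norm 2 \<omega> \<Omega> f * Lp_norm 2 (inv_weight \<omega>) \<Omega> (\<lambda>_. 1::real)"
proof -
  have 1: "(\<lambda>_. 1::real) \<in> Lp 2 (inv_weight \<omega>) \<Omega>"
    using weight_onD[OF weight_on_inv[OF assms(1)]] by (simp add: Lp_def)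
  note p = Lp_pairing[OF assms 1]
  show "(LINT x|lebesgue_on \<Omega>. norm (f x)) \<le> Lp_norm 2 \<omega> \<Omega> f * Lp_norm 2 (inv_weight \<omega>) \<Omega> (\<lambda>_. 1::real)"
    using p(2) by simp
  show "integrable (lebesgue_on \<Omega>) f"
    using p(1) LpD(1)[OF assms(2)] by (simp add: integrable_norm_iff)
qed


section \<open>Weighted Sobolev spaces\<close>

abbreviation gradient :: "scalar \<Rightarrow> vfield" where
  "gradient \<phi> \<equiv> (\<lambda>x. \<chi> i. partial_deriv i \<phi> x)"

lemma locally_integrable_measurable:
  fixes g :: "real^2 \<Rightarrow> 'b::{banach,second_countable_topology}"
  assumes "open U" "locally_integrable_on U g"
  shows "g \<in> borel_measurable (lebesgue_on U)"
proof (rule measurableI)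
  obtain C where C: "\<And>n. compact (C n)" "\<And>n::nat. C n \<subseteq> U" "\<Union>(range C) = U"
    using open_Union_compact_subsets[OF assms(1)] by metis
  fix A :: "'b set" assume A: "A \<in> sets borel"
  have "g -` A \<inter> C n \<in> sets lebesgue" for n
  proof -
    have "g \<in> borel_measurable (lebesgue_on (C n))"
      using assms(2)[unfolded locally_integrable_on_def, rule_format, of "C n"] C(1,2)[of n]
      by (intro borel_measurable_integrable) simp
    from measurable_sets[OF this A] show ?thesis
      using compact_sets_lebesgue[OF C(1)[of n]] by (simp add: sets_restrict_space_iff)
  qed
  then have "(\<Union>n. g -` A \<inter> C n) \<in> sets lebesgue" by blast
  moreover have "(\<Union>n. g -` A \<inter> C n) = g -` A \<inter> U" using C(3) by blast
  ultimately show "g -` A \<inter> space (lebesgue_on U) \<in> sets (lebesgue_on U)"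
    using assms(1) by (simp add: sets_restrict_space_iff)
qed simp



lemma vec_in_Lp:
  fixes G :: "real^2 \<Rightarrow> 'b::euclidean_space ^ 2"
  assumes "\<And>i. (\<lambda>x. G x $ i) \<in> Lp 2 \<omega> \<Omega>"
  shows "G \<in> Lp 2 \<omega> \<Omega>"
  unfolding Lp_def
proof (intro CollectI conjI)
  show "G \<in> borel_measurable (lebesgue_on \<Omega>)"
  proof (subst borel_measurable_euclidean_space, rule ballI)
    fix b :: "'b ^ 2" assume "b \<in> Basis"
    then obtain i u where "b = axis i u" by (auto simp: Basis_vec_def)
    then show "(\<lambda>x. G x \<bullet> b) \<in> borel_measurable (lebesgue_on \<Omega>)"
      using LpD(1)[OF assms[of i]] by (simp add: inner_axis)
  qed
  show "integrable (lebesgue_on \<Omega>) (\<lambda>x. (norm (G x))\<^sup>2 * \<omega> x)"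
    using LpD(2)[OF assms] by (simp add: norm_vec_squared sum_distrib_right)
qed

lemma H1_weak_grad:
  assumes "weight_on \<Omega> \<omega>" "v \<in> H1 \<omega> \<Omega>"
  shows "v \<in> Lp 2 \<omega> \<Omega>" "has_weak_gradient \<Omega> v (weak_grad \<Omega> v)" "weak_grad \<Omega> v \<in> Lp 2 \<omega> \<Omega>"
proof -
  note w = weight_onD[OF assms(1)]
  obtain g where g: "g \<in> Lp 2 \<omega> \<Omega>" "has_weak_gradient \<Omega> v g" using assms(2) by (auto simp: H1_def)
  show "v \<in> Lp 2 \<omega> \<Omega>" using assms(2) by (simp add: H1_def)
  show h: "has_weak_gradient \<Omega> v (weak_grad \<Omega> v)" by (rule has_weak_gradient_weak_grad[OF w(1) g(2)])
  show "weak_grad \<Omega> v \<in> Lp 2 \<omega> \<Omega>"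
    by (rule Lp_norm_cong(1)[OF assms(1) g(1) _ weak_grad_AE(1)[OF w(1) g(2)]])
      (rule locally_integrable_measurable[OF w(1) has_weak_gradient_locally_integrable(2)[OF h]])
qed

lemma C0_infinity_measurable:
  assumes "\<phi> \<in> C0_infinity U" "open \<Omega>"
  shows "\<phi> \<in> borel_measurable (lebesgue_on \<Omega>)"
  by (rule continuous_imp_measurable_on_sets_lebesgue[OF smooth_continuous[OF C0_infinity_smooth[OF assms(1)]]])
    (rule open_sets_lebesgue[OF assms(2)])

lemma C0_infinity_in_Lp:
  assumes "weight_on \<Omega> \<omega>" "\<phi> \<in> C0_infinity U"
  shows "\<phi> \<in> Lp 2 \<omega> \<Omega>" "gradient \<phi> \<in> Lp 2 \<omega> \<Omega>"
proof -
  have L: "\<psi> \<in> Lp 2 \<omega> \<Omega>" if \<psi>: "\<psi> \<in> C0_infinity U" for \<psi>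
  proof -
    obtain B where "\<And>x. \<bar>\<psi> x\<bar> \<le> B" using C0_infinity_bounded[OF \<psi>] by blast
    then show ?thesis
      by (intro bounded_in_Lp[OF assms(1) C0_infinity_measurable[OF \<psi> weight_onD(1)[OF assms(1)]]]) simp
  qed
  show "\<phi> \<in> Lp 2 \<omega> \<Omega>" by (rule L[OF assms(2)])
  show "gradient \<phi> \<in> Lp 2 \<omega> \<Omega>"
    by (rule vec_in_Lp) (use L[OF C0_infinity_partial_deriv[OF assms(2)]] in simp)
qed

lemma H1I:
  assumes "v \<in> Lp 2 \<omega> \<Omega>" "g \<in> Lp 2 \<omega> \<Omega>" "has_weak_gradient \<Omega> v g"
  shows "v \<in> H1 \<omega> \<Omega>"
  using assms by (auto simp: H1_def)

lemma sqrt_sum_squares_bounds: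
  fixes a b e :: real
  assumes "0 \<le> a" "0 \<le> b"
  shows "sqrt (a\<^sup>2 + b\<^sup>2) \<le> a + b" "a \<le> sqrt (a\<^sup>2 + b\<^sup>2)" "b \<le> sqrt (a\<^sup>2 + b\<^sup>2)"
  using assms sqrt_sum_squares_le_sum[of a b] by (auto intro!: real_le_rsqrt)

text \<open>The weak gradient chosen for the difference may be replaced by the difference of the gradients,
  so that approximation in \<open>H10\<close> can be checked with explicit gradients.\<close>

lemma H1_norm_diff_test:
  assumes "weight_on \<Omega> \<omega>" "has_weak_gradient \<Omega> v g" "g \<in> Lp 2 \<omega> \<Omega>" "\<phi> \<in> C0_infinity \<Omega>"
  shows "H1_norm \<omega> \<Omega> (\<lambda>x. v x - \<phi> x) =
    sqrt ((Lp_norm 2 \<omega> \<Omega> (\<lambda>x. v x - \<phi> x))\<^sup>2 + (Lp_norm 2 \<omega> \<Omega> (\<lambda>x. g x - gradient \<phi> x))\<^sup>2)"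
proof -
  note w = weight_onD[OF assms(1)]
  have h: "has_weak_gradient \<Omega> (\<lambda>x. v x - \<phi> x) (\<lambda>x. g x - gradient \<phi> x)"
    using has_weak_gradient_lincomb[OF w(1) assms(2) smooth_has_weak_gradient[OF w(1) C0_infinity_smooth[OF assms(4)]], of 1 "- 1"]
    by simp
  note L = Lp_diff[OF assms(1,3) C0_infinity_in_Lp(2)[OF assms(1,4)]]
  note h' = has_weak_gradient_weak_grad[OF w(1) h]
  have "Lp_norm 2 \<omega> \<Omega> (weak_grad \<Omega> (\<lambda>x. v x - \<phi> x)) = Lp_norm 2 \<omega> \<Omega> (\<lambda>x. g x - gradient \<phi> x)"
    by (rule Lp_norm_cong(2)[OF assms(1) L _ weak_grad_AE(1)[OF w(1) h]])
      (rule locally_integrable_measurable[OF w(1) has_weak_gradient_locally_integrable(2)[OF h']])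
  then show ?thesis by (simp add: H1_norm_def)
qed

lemma H10I:
  assumes "weight_on \<Omega> \<omega>" "v \<in> Lp 2 \<omega> \<Omega>" "g \<in> Lp 2 \<omega> \<Omega>" "has_weak_gradient \<Omega> v g"
    and "\<And>\<epsilon>. 0 < \<epsilon> \<Longrightarrow> \<exists>\<phi> \<in> C0_infinity \<Omega>. Lp_norm 2 \<omega> \<Omega> (\<lambda>x. v x - \<phi> x) < \<epsilon> \<and>
      Lp_norm 2 \<omega> \<Omega> (\<lambda>x. g x - gradient \<phi> x) < \<epsilon>"
  shows "v \<in> H10 \<omega> \<Omega>"
  unfolding H10_def
proof (intro CollectI conjI allI impI)
  show "v \<in> H1 \<omega> \<Omega>" by (rule H1I[OF assms(2-4)])
  fix \<epsilon> :: real assume "0 < \<epsilon>"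
  then obtain \<phi> where \<phi>: "\<phi> \<in> C0_infinity \<Omega>" "Lp_norm 2 \<omega> \<Omega> (\<lambda>x. v x - \<phi> x) < \<epsilon> / 2"
      "Lp_norm 2 \<omega> \<Omega> (\<lambda>x. g x - gradient \<phi> x) < \<epsilon> / 2"
    using assms(5)[of "\<epsilon> / 2"] by auto
  have "H1_norm \<omega> \<Omega> (\<lambda>x. v x - \<phi> x) < \<epsilon>"
    unfolding H1_norm_diff_test[OF assms(1,4,3) \<phi>(1)]
    using sqrt_sum_squares_bounds(1)[OF Lp_norm_ge_0[OF assms(1)] Lp_norm_ge_0[OF assms(1)],
        of 2 "\<lambda>x. v x - \<phi> x" 2 "\<lambda>x. g x - gradient \<phi> x"] \<phi>(2,3) by linarith
  then show "\<exists>\<phi>\<in>C0_infinity \<Omega>. H1_norm \<omega> \<Omega> (\<lambda>x. v x - \<phi> x) < \<epsilon>" using \<phi>(1) by blast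
qed

lemma H10_H1: "v \<in> H10 \<omega> \<Omega> \<Longrightarrow> v \<in> H1 \<omega> \<Omega>"
  by (simp add: H10_def)

lemma H10_approx:
  assumes "weight_on \<Omega> \<omega>" "v \<in> H10 \<omega> \<Omega>" "0 < \<epsilon>"
  obtains \<phi> where "\<phi> \<in> C0_infinity \<Omega>" "Lp_norm 2 \<omega> \<Omega> (\<lambda>x. v x - \<phi> x) < \<epsilon>"
    "Lp_norm 2 \<omega> \<Omega> (\<lambda>x. weak_grad \<Omega> v x - gradient \<phi> x) < \<epsilon>"
proof -
  note H = H1_weak_grad[OF assms(1) H10_H1[OF assms(2)]]
  obtain \<phi> where \<phi>: "\<phi> \<in> C0_infinity \<Omega>" "H1_norm \<omega> \<Omega> (\<lambda>x. v x - \<phi> x) < \<epsilon>"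
    using assms(2,3) unfolding H10_def by blast
  note e = \<phi>(2)[unfolded H1_norm_diff_test[OF assms(1) H(2,3) \<phi>(1)]]
  note b = sqrt_sum_squares_bounds(2,3)[OF Lp_norm_ge_0[OF assms(1)] Lp_norm_ge_0[OF assms(1)]]
  show thesis
    by (rule that[OF \<phi>(1)]) (rule le_less_trans[OF b(1) e], rule le_less_trans[OF b(2) e])
qed

lemma gradient_lincomb:
  assumes "\<phi> \<in> C0_infinity U" "\<psi> \<in> C0_infinity U"
  shows "gradient (\<lambda>x. a * \<phi> x + b * \<psi> x) x = a *\<^sub>R gradient \<phi> x + b *\<^sub>R gradient \<psi> x"
proof -
  have c: "partial_deriv i (\<lambda>x. c * \<eta> x) x = c * partial_deriv i \<eta> x" if \<eta>: "\<eta> \<in> C0_infinity U" for i c \<eta>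
    using partial_deriv_mult[OF differentiable_const smooth_differentiable[OF C0_infinity_smooth[OF \<eta>]], of i c x]
      has_derivative_partial_deriv[OF has_derivative_const[of c "at x"], of i] by simp
  have d: "(\<lambda>x. c * \<eta> x) differentiable (at x)" if "\<eta> \<in> C0_infinity U" for c \<eta>
    by (rule smooth_differentiable[OF C0_infinity_smooth[OF C0_infinity_cmult[OF that]]])
  show ?thesis
    using partial_deriv_add[OF d[OF assms(1), of a] d[OF assms(2), of b]] assms by (simp add: vec_eq_iff c)
qed

lemma weak_grad_lincomb_AE:
  assumes "weight_on \<Omega> \<omega>" "v \<in> H1 \<omega> \<Omega>" "w \<in> H1 \<omega> \<Omega>"
  shows "AE x in lebesgue_on \<Omega>. weak_grad \<Omega> (\<lambda>x. a * v x + b * w x) x = a *\<^sub>R weak_grad \<Omega> v x + b *\<^sub>R weak_grad \<Omega> w x"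
  by (rule weak_grad_AE(1)[OF weight_onD(1)[OF assms(1)]
        has_weak_gradient_lincomb[OF weight_onD(1)[OF assms(1)] H1_weak_grad(2)[OF assms(1,2)] H1_weak_grad(2)[OF assms(1,3)]]])

lemma H10_lincomb:
  assumes "weight_on \<Omega> \<omega>" "v \<in> H10 \<omega> \<Omega>" "w \<in> H10 \<omega> \<Omega>"
  shows "(\<lambda>x. a * v x + b * w x) \<in> H10 \<omega> \<Omega>"
proof (rule H10I[OF assms(1)])
  note V = H1_weak_grad[OF assms(1) H10_H1[OF assms(2)]]
  note W = H1_weak_grad[OF assms(1) H10_H1[OF assms(3)]]
  let ?g = "\<lambda>x. a *\<^sub>R weak_grad \<Omega> v x + b *\<^sub>R weak_grad \<Omega> w x"
  show "(\<lambda>x. a * v x + b * w x) \<in> Lp 2 \<omega> \<Omega>" using Lp_lincomb(1)[OF assms(1) V(1) W(1), of a b] by simp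
  show "?g \<in> Lp 2 \<omega> \<Omega>" by (rule Lp_lincomb(1)[OF assms(1) V(3) W(3)])
  show "has_weak_gradient \<Omega> (\<lambda>x. a * v x + b * w x) ?g"
    by (rule has_weak_gradient_lincomb[OF weight_onD(1)[OF assms(1)] V(2) W(2)])
  fix \<epsilon> :: real assume \<epsilon>: "0 < \<epsilon>"
  define d where "d = \<epsilon> / (\<bar>a\<bar> + \<bar>b\<bar> + 1)"
  have d: "0 < d" "(\<bar>a\<bar> + \<bar>b\<bar>) * d < \<epsilon>"
    using \<epsilon> by (simp_all add: d_def field_simps add_pos_nonneg add_nonneg_pos)
  obtain \<phi> where \<phi>: "\<phi> \<in> C0_infinity \<Omega>" "Lp_norm 2 \<omega> \<Omega> (\<lambda>x. v x - \<phi> x) < d"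
      "Lp_norm 2 \<omega> \<Omega> (\<lambda>x. weak_grad \<Omega> v x - gradient \<phi> x) < d"
    by (rule H10_approx[OF assms(1,2) d(1)])
  obtain \<psi> where \<psi>: "\<psi> \<in> C0_infinity \<Omega>" "Lp_norm 2 \<omega> \<Omega> (\<lambda>x. w x - \<psi> x) < d"
      "Lp_norm 2 \<omega> \<Omega> (\<lambda>x. weak_grad \<Omega> w x - gradient \<psi> x) < d"
    by (rule H10_approx[OF assms(1,3) d(1)])
  have ab: "\<bar>a\<bar> * A + \<bar>b\<bar> * B < \<epsilon>" if "A < d" "B < d" for A B
  proof -
    have "\<bar>a\<bar> * A + \<bar>b\<bar> * B \<le> \<bar>a\<bar> * d + \<bar>b\<bar> * d"
      using that by (intro add_mono mult_left_mono) auto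
    then show ?thesis using d(2) by (simp add: distrib_right)
  qed
  note sub = Lp_diff[OF assms(1)]
  note T\<phi> = C0_infinity_in_Lp[OF assms(1) \<phi>(1)] and T\<psi> = C0_infinity_in_Lp[OF assms(1) \<psi>(1)]
  let ?\<eta> = "\<lambda>x. a * \<phi> x + b * \<psi> x"
  have "Lp_norm 2 \<omega> \<Omega> (\<lambda>x. a *\<^sub>R (v x - \<phi> x) + b *\<^sub>R (w x - \<psi> x)) < \<epsilon>"
    using Lp_lincomb(2)[OF assms(1) sub[OF V(1) T\<phi>(1)] sub[OF W(1) T\<psi>(1)], of a b]
      ab[OF \<phi>(2) \<psi>(2)] by linarith
  moreover have "(\<lambda>x. a *\<^sub>R (v x - \<phi> x) + b *\<^sub>R (w x - \<psi> x)) = (\<lambda>x. (a * v x + b * w x) - ?\<eta> x)"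
    by (auto simp: algebra_simps)
  moreover have "Lp_norm 2 \<omega> \<Omega> (\<lambda>x. a *\<^sub>R (weak_grad \<Omega> v x - gradient \<phi> x) + b *\<^sub>R (weak_grad \<Omega> w x - gradient \<psi> x)) < \<epsilon>"
    using Lp_lincomb(2)[OF assms(1) sub[OF V(3) T\<phi>(2)] sub[OF W(3) T\<psi>(2)], of a b]
      ab[OF \<phi>(3) \<psi>(3)] by linarith
  moreover have "(\<lambda>x. a *\<^sub>R (weak_grad \<Omega> v x - gradient \<phi> x) + b *\<^sub>R (weak_grad \<Omega> w x - gradient \<psi> x)) =
      (\<lambda>x. ?g x - gradient ?\<eta> x)"
    by (rule ext) (simp only: gradient_lincomb[OF \<phi>(1) \<psi>(1)], simp add: algebra_simps)
  moreover have "?\<eta> \<in> C0_infinity \<Omega>"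
    by (intro C0_infinity_add C0_infinity_cmult \<phi>(1) \<psi>(1))
  ultimately show "\<exists>\<phi>\<in>C0_infinity \<Omega>. Lp_norm 2 \<omega> \<Omega> (\<lambda>x. a * v x + b * w x - \<phi> x) < \<epsilon> \<and>
      Lp_norm 2 \<omega> \<Omega> (\<lambda>x. ?g x - gradient \<phi> x) < \<epsilon>"
    by (intro bexI[of _ ?\<eta>]) auto
qed


lemma C_k_sqrt:
  assumes "\<And>x. 0 < f x"
  shows "C_k k f \<Longrightarrow> C_k k (\<lambda>x. sqrt (f x))"
proof (induction k)
  case 0
  then show ?case by (auto intro: continuous_on_real_sqrt)
next
  case (Suc k)
  have D: "(sqrt has_real_derivative inverse (sqrt (f x)) / 2) (at (f x))" for x
    by (rule DERIV_real_sqrt[OF assms])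
  have d: "\<And>x. f differentiable (at x)" using Suc.prems by simp
  then have "partial_deriv i (\<lambda>x. sqrt (f x)) =
      (\<lambda>x. 1 / 2 * inverse (sqrt (f x)) * partial_deriv i f x)" for i
    using partial_deriv_chain(2)[OF _ D] by (intro ext) simp
  moreover have "C_k k (\<lambda>x. 1 / 2 * inverse (sqrt (f x)) * partial_deriv i f x)" for i
    using Suc.IH[OF C_k_Suc_imp[OF Suc.prems]] Suc.prems assms
    by (intro C_k_mult C_k_const C_k_inverse) (auto simp: less_imp_neq[symmetric])
  ultimately show ?case using partial_deriv_chain(1)[OF d D] by simp
qed

text \<open>Integrating \<open>\<partial>\<^sub>1 (x\<^sub>1 s)\<close> for \<open>s = sqrt (\<phi>\<^sup>2 + \<delta>\<^sup>2) - \<delta>\<close>, a smooth substitute for \<open>\<bar>\<phi>\<bar>\<close>, gives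
  \<open>\<integral> s = - \<integral> x\<^sub>1 \<partial>\<^sub>1 s\<close>.\<close>

lemma Poincare_L1:
  assumes "open \<Omega>" "\<phi> \<in> C0_infinity \<Omega>" "\<And>x. x \<in> \<Omega> \<Longrightarrow> norm x \<le> R"
  shows "(LINT x|lborel. \<bar>\<phi> x\<bar>) \<le> R * (LINT x|lborel. \<bar>partial_deriv 1 \<phi> x\<bar>)"
proof -
  note sm = C0_infinity_smooth[OF assms(2)] and cs = C0_infinity_compact[OF assms(2)]
  let ?S = "closure {x. \<phi> x \<noteq> 0}"
  define m where "m = measure lborel ?S"
  have S: "?S \<in> sets borel" "emeasure lborel ?S < \<infinity>"
    using emeasure_bounded_finite[OF compact_imp_bounded[OF cs]] by simp_all
  have D\<phi>: "partial_deriv 1 \<phi> \<in> C0_infinity \<Omega>" by (rule C0_infinity_partial_deriv[OF assms(2)])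
  have iD: "integrable lborel (\<lambda>x. \<bar>partial_deriv 1 \<phi> x\<bar>)"
    using C0_infinity_integrable[OF D\<phi>] by simp
  have i\<phi>: "integrable lborel (\<lambda>x. \<bar>\<phi> x\<bar>)" using C0_infinity_integrable[OF assms(2)] by simp
  have key: "(LINT x|lborel. \<bar>\<phi> x\<bar>) \<le> R * (LINT x|lborel. \<bar>partial_deriv 1 \<phi> x\<bar>) + \<delta> * m" if \<delta>: "0 < \<delta>" for \<delta>
  proof -
    define q where "q x = (\<phi> x)\<^sup>2 + \<delta>\<^sup>2" for x
    define s where "s x = sqrt (q x) - \<delta>" for x
    have q: "0 < q x" for x using \<delta> by (simp add: q_def add_nonneg_pos)
    have qs: "smooth q" unfolding q_def
      by (intro allI C_k_add C_k_power C_k_const) (use sm in blast)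
    have ss: "smooth s" unfolding s_def
      by (intro allI C_k_diff C_k_const C_k_sqrt q) (use qs in blast)
    have s0: "s x = 0" if "\<phi> x = 0" for x using that \<delta> by (simp add: s_def q_def)
    have sC: "s \<in> C0_infinity \<Omega>"
    proof (rule C0_infinityI[OF _ cs C0_infinity_subset[OF assms(2)] ss])
      fix x assume "x \<notin> ?S"
      then show "s x = 0" by (intro s0) (rule eq_0_off_support)
    qed
    have xC: "(\<lambda>x. s x * x $ 1) \<in> C0_infinity \<Omega>"
      by (intro C0_infinity_mult sC allI C_k_coord)
    have Ds: "partial_deriv 1 s x = \<phi> x / sqrt (q x) * partial_deriv 1 \<phi> x" for x
    proof -
      have d: "\<phi> differentiable (at x)" by (rule smooth_differentiable[OF sm])
      have H: "((\<lambda>t. sqrt (t\<^sup>2 + \<delta>\<^sup>2) - \<delta>) has_real_derivative \<phi> x / sqrt (q x)) (at (\<phi> x))"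
        using q[of x] by (auto intro!: derivative_eq_intros simp: q_def divide_simps)
      have "s = (\<lambda>x. sqrt ((\<phi> x)\<^sup>2 + \<delta>\<^sup>2) - \<delta>)" by (rule ext) (simp add: s_def q_def)
      then show ?thesis using partial_deriv_chain(2)[OF d H] by simp
    qed
    have Dle: "\<bar>partial_deriv 1 s x\<bar> \<le> \<bar>partial_deriv 1 \<phi> x\<bar>" for x
    proof -
      have "\<bar>\<phi> x\<bar> \<le> sqrt (q x)" by (rule real_le_rsqrt) (simp add: q_def)
      then have "\<bar>\<phi> x / sqrt (q x)\<bar> \<le> 1" using q[of x] by (simp add: abs_divide)
      then show ?thesis unfolding Ds abs_mult by (rule mult_left_le_one_le[OF abs_ge_zero abs_ge_zero])
    qed
    have ints: "integrable lborel s" by (rule C0_infinity_integrable[OF sC])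
    have DsC: "(\<lambda>x. partial_deriv 1 s x * x $ 1) \<in> C0_infinity \<Omega>"
      by (intro C0_infinity_mult C0_infinity_partial_deriv sC allI C_k_coord)
    have "0 = (LINT x|lborel. partial_deriv 1 (\<lambda>x. s x * x $ 1) x)"
      using integral_partial_deriv_eq_0[OF xC] by simp
    also have "\<dots> = (LINT x|lborel. s x + partial_deriv 1 s x * x $ 1)"
    proof (rule Bochner_Integration.integral_cong[OF refl])
      fix x :: "real^2"
      show "partial_deriv 1 (\<lambda>x. s x * x $ 1) x = s x + partial_deriv 1 s x * x $ 1"
        using partial_deriv_mult[OF smooth_differentiable[OF ss], of "\<lambda>x. x $ 1" x 1]
          smooth_differentiable[of "\<lambda>x. x $ 1"] C_k_coord[of _ 1] by (simp add: partial_deriv_coord)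
    qed
    also have "\<dots> = (LINT x|lborel. s x) + (LINT x|lborel. partial_deriv 1 s x * x $ 1)"
      by (rule Bochner_Integration.integral_add[OF ints C0_infinity_integrable[OF DsC]])
    finally have "(LINT x|lborel. s x) \<le> \<bar>LINT x|lborel. partial_deriv 1 s x * x $ 1\<bar>" by simp
    also have "\<dots> \<le> (LINT x|lborel. \<bar>partial_deriv 1 s x * x $ 1\<bar>)" by (rule integral_abs_bound)
    also have "\<dots> \<le> (LINT x|lborel. R * \<bar>partial_deriv 1 \<phi> x\<bar>)"
    proof (rule integral_mono)
      show "integrable lborel (\<lambda>x. \<bar>partial_deriv 1 s x * x $ 1\<bar>)"
        using C0_infinity_integrable[OF DsC] by simp
      show "integrable lborel (\<lambda>x. R * \<bar>partial_deriv 1 \<phi> x\<bar>)" using iD by simp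
      show "\<bar>partial_deriv 1 s x * x $ 1\<bar> \<le> R * \<bar>partial_deriv 1 \<phi> x\<bar>" for x
      proof (cases "x \<in> \<Omega>")
        case True
        have "\<bar>x $ 1\<bar> \<le> R" using component_le_norm_cart[of x 1] assms(3)[OF True] by simp
        then have "\<bar>partial_deriv 1 s x\<bar> * \<bar>x $ 1\<bar> \<le> \<bar>partial_deriv 1 \<phi> x\<bar> * R"
          using Dle by (intro mult_mono) auto
        then show ?thesis by (simp add: abs_mult mult.commute)
      next
        case False
        then show ?thesis
          using C0_infinity_eq_0[OF D\<phi>] C0_infinity_eq_0[OF C0_infinity_partial_deriv[OF sC]] by simp
      qed
    qed
    finally have A: "(LINT x|lborel. s x) \<le> R * (LINT x|lborel. \<bar>partial_deriv 1 \<phi> x\<bar>)" by simp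
    have im: "integrable lborel (\<lambda>x. \<delta> * indicat_real ?S x)" using S by (simp add: integrable_indicator_iff)
    have "(LINT x|lborel. \<bar>\<phi> x\<bar>) \<le> (LINT x|lborel. s x + \<delta> * indicat_real ?S x)"
    proof (rule integral_mono[OF i\<phi>])
      show "integrable lborel (\<lambda>x. s x + \<delta> * indicat_real ?S x)" using ints im by simp
      show "\<bar>\<phi> x\<bar> \<le> s x + \<delta> * indicat_real ?S x" for x
      proof (cases "x \<in> ?S")
        case True
        have "\<bar>\<phi> x\<bar> \<le> sqrt (q x)" by (rule real_le_rsqrt) (simp add: q_def)
        then show ?thesis using True by (simp add: s_def)
      next
        case False
        then have "\<phi> x = 0" by (rule eq_0_off_support)
        then show ?thesis using False s0 by simp
      qed
    qed
    also have "\<dots> = (LINT x|lborel. s x) + \<delta> * m" using ints im S by (simp add: m_def)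
    finally show ?thesis using A by simp
  qed
  show ?thesis
  proof (rule field_le_epsilon)
    fix e :: real assume "0 < e"
    have m: "0 \<le> m" by (simp add: m_def)
    have "e / (m + 1) * m \<le> e" using \<open>0 < e\<close> m by (simp add: field_simps)
    moreover have "0 < e / (m + 1)" using \<open>0 < e\<close> m by simp
    ultimately show "(LINT x|lborel. \<bar>\<phi> x\<bar>) \<le> R * (LINT x|lborel. \<bar>partial_deriv 1 \<phi> x\<bar>) + e"
      using key[of "e / (m + 1)"] by linarith
  qed
qed

text \<open>The approximating test functions are small in \<open>L\<^sup>1\<close> by \<open>Poincare_L1\<close>, and the weighted
  space embeds continuously into \<open>L\<^sup>1\<close>.\<close>

lemma H10_gradient_0_imp_0:
  assumes "weight_on \<Omega> \<omega>" "v \<in> H10 \<omega> \<Omega>" "Lp_norm 2 \<omega> \<Omega> (weak_grad \<Omega> v) = 0"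
  shows "AE x in lebesgue_on \<Omega>. v x = 0"
proof -
  note w = weight_onD[OF assms(1)] and H = H1_weak_grad[OF assms(1) H10_H1[OF assms(2)]]
  obtain R where R: "0 \<le> R" "\<And>x. x \<in> \<Omega> \<Longrightarrow> norm x \<le> R"
    using w(2) bounded_pos[of \<Omega>] by (metis less_imp_le)
  define c where "c = Lp_norm 2 (inv_weight \<omega>) \<Omega> (\<lambda>_. 1::real)"
  have c: "0 \<le> c" unfolding c_def by (rule Lp_norm_ge_0[OF weight_on_inv[OF assms(1)]])
  have iv: "integrable (lebesgue_on \<Omega>) v" by (rule Lp_integrable(1)[OF assms(1) H(1)])
  have "(LINT x|lebesgue_on \<Omega>. \<bar>v x\<bar>) \<le> \<epsilon> * (c + R * c)" if \<epsilon>: "0 < \<epsilon>" for \<epsilon>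
  proof -
    obtain \<phi> where \<phi>: "\<phi> \<in> C0_infinity \<Omega>" "Lp_norm 2 \<omega> \<Omega> (\<lambda>x. v x - \<phi> x) < \<epsilon>"
        "Lp_norm 2 \<omega> \<Omega> (\<lambda>x. weak_grad \<Omega> v x - gradient \<phi> x) < \<epsilon>"
      by (rule H10_approx[OF assms(1,2) \<epsilon>])
    note T = C0_infinity_in_Lp[OF assms(1) \<phi>(1)]
    have on: "(LINT x|lebesgue_on \<Omega>. \<bar>\<psi> x\<bar>) = (LINT x|lborel. \<bar>\<psi> x\<bar>)" if \<psi>: "\<psi> \<in> C0_infinity \<Omega>" for \<psi>
      using C0_infinity_eq_0[OF \<psi>] smooth_measurable[OF C0_infinity_smooth[OF \<psi>]] w(1)
      by (intro LINT_on_eq_LINT_lborel) auto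
    note dv = Lp_diff[OF assms(1) H(1) T(1)]
    have i\<phi>: "integrable (lebesgue_on \<Omega>) \<phi>" by (rule Lp_integrable(1)[OF assms(1) T(1)])
    have "(LINT x|lebesgue_on \<Omega>. \<bar>v x\<bar>) \<le> (LINT x|lebesgue_on \<Omega>. \<bar>v x - \<phi> x\<bar> + \<bar>\<phi> x\<bar>)"
      by (rule integral_mono) (use iv i\<phi> in auto)
    also have "\<dots> = (LINT x|lebesgue_on \<Omega>. \<bar>v x - \<phi> x\<bar>) + (LINT x|lebesgue_on \<Omega>. \<bar>\<phi> x\<bar>)"
      using iv i\<phi> by simp
    finally have 1: "(LINT x|lebesgue_on \<Omega>. \<bar>v x\<bar>) \<le>
        (LINT x|lebesgue_on \<Omega>. \<bar>v x - \<phi> x\<bar>) + (LINT x|lebesgue_on \<Omega>. \<bar>\<phi> x\<bar>)" .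
    have "(LINT x|lebesgue_on \<Omega>. \<bar>v x - \<phi> x\<bar>) \<le> Lp_norm 2 \<omega> \<Omega> (\<lambda>x. v x - \<phi> x) * c"
      using Lp_integrable(2)[OF assms(1) dv] by (simp add: c_def)
    also have "\<dots> \<le> \<epsilon> * c" using \<phi>(2) c by (intro mult_right_mono) auto
    finally have 2: "(LINT x|lebesgue_on \<Omega>. \<bar>v x - \<phi> x\<bar>) \<le> \<epsilon> * c" .
    have dg: "Lp_norm 2 \<omega> \<Omega> (gradient \<phi>) \<le> \<epsilon>"
    proof -
      note s = Lp_diff[OF assms(1) H(3) T(2)]
      have "Lp_norm 2 \<omega> \<Omega> (\<lambda>x. 1 *\<^sub>R weak_grad \<Omega> v x + (- 1) *\<^sub>R (weak_grad \<Omega> v x - gradient \<phi> x)) \<le>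
          \<bar>1\<bar> * Lp_norm 2 \<omega> \<Omega> (weak_grad \<Omega> v) + \<bar>- 1\<bar> * Lp_norm 2 \<omega> \<Omega> (\<lambda>x. weak_grad \<Omega> v x - gradient \<phi> x)"
        by (rule Lp_lincomb(2)[OF assms(1) H(3) s])
      then show ?thesis using assms(3) \<phi>(3) by simp
    qed
    have "(LINT x|lebesgue_on \<Omega>. \<bar>\<phi> x\<bar>) \<le> R * (LINT x|lebesgue_on \<Omega>. \<bar>partial_deriv 1 \<phi> x\<bar>)"
      using Poincare_L1[OF w(1) \<phi>(1) R(2)] on[OF \<phi>(1)] on[OF C0_infinity_partial_deriv[OF \<phi>(1)]] by simp
    also have "\<dots> \<le> R * (LINT x|lebesgue_on \<Omega>. norm (gradient \<phi> x))"
    proof (intro mult_left_mono integral_mono R)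
      show "integrable (lebesgue_on \<Omega>) (\<lambda>x. norm (gradient \<phi> x))"
        using Lp_integrable(1)[OF assms(1) T(2)] by simp
      show "integrable (lebesgue_on \<Omega>) (\<lambda>x. \<bar>partial_deriv 1 \<phi> x\<bar>)"
        using Lp_integrable(1)[OF assms(1) C0_infinity_in_Lp(1)[OF assms(1) C0_infinity_partial_deriv[OF \<phi>(1)]]] by simp
      show "\<bar>partial_deriv 1 \<phi> x\<bar> \<le> norm (gradient \<phi> x)" for x
        using component_le_norm_cart[of "gradient \<phi> x" 1] by simp
    qed
    also have "\<dots> \<le> R * (Lp_norm 2 \<omega> \<Omega> (gradient \<phi>) * c)"
      using Lp_integrable(2)[OF assms(1) T(2)] R(1) by (simp add: c_def mult_left_mono)
    also have "\<dots> \<le> R * (\<epsilon> * c)" using dg R(1) c by (intro mult_left_mono mult_right_mono) auto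
    finally show ?thesis using 1 2 by (simp add: algebra_simps)
  qed
  then have le: "(LINT x|lebesgue_on \<Omega>. \<bar>v x\<bar>) \<le> 0 + e" if "0 < e" for e
  proof -
    have k: "0 \<le> c + R * c" using c R(1) by simp
    have "(LINT x|lebesgue_on \<Omega>. \<bar>v x\<bar>) \<le> e / (c + R * c + 1) * (c + R * c)"
      using \<open>\<And>\<epsilon>. 0 < \<epsilon> \<Longrightarrow> _\<close>[of "e / (c + R * c + 1)"] k that by simp
    also have "\<dots> \<le> e" using k that by (simp add: field_simps)
    finally show ?thesis by simp
  qed
  have "(LINT x|lebesgue_on \<Omega>. \<bar>v x\<bar>) = 0"
    using field_le_epsilon[OF le] by (simp add: antisym)
  then have "AE x in lebesgue_on \<Omega>. \<bar>v x\<bar> = 0"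
    using integral_nonneg_eq_0_iff_AE[of "lebesgue_on \<Omega>" "\<lambda>x. \<bar>v x\<bar>"] iv by simp
  then show ?thesis by simp
qed

section \<open>Weighted Sobolev spaces of vector fields\<close>

lemma H10_vec_Lp:
  assumes "weight_on \<Omega> \<omega>" "v \<in> H10_vec \<omega> \<Omega>"
  shows "v \<in> Lp 2 \<omega> \<Omega>" "grad \<Omega> v \<in> Lp 2 \<omega> \<Omega>"
proof -
  have H: "(\<lambda>x. v x $ i) \<in> H1 \<omega> \<Omega>" for i using assms(2) by (simp add: H10_vec_def H10_H1)
  note w = H1_weak_grad[OF assms(1) H]
  show "v \<in> Lp 2 \<omega> \<Omega>" by (rule vec_in_Lp) (rule w(1))
  show "grad \<Omega> v \<in> Lp 2 \<omega> \<Omega>" by (rule vec_in_Lp) (use w(3) in \<open>simp add: grad_def\<close>)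
qed

lemma H10_vec_lincomb:
  assumes "weight_on \<Omega> \<omega>" "v \<in> H10_vec \<omega> \<Omega>" "w \<in> H10_vec \<omega> \<Omega>"
  shows "lincomb a v b w \<in> H10_vec \<omega> \<Omega>"
  unfolding H10_vec_def lincomb_def
proof (intro CollectI allI)
  fix i
  have "(\<lambda>x. a * v x $ i + b * w x $ i) \<in> H10 \<omega> \<Omega>"
    using assms(2,3) by (intro H10_lincomb[OF assms(1)]) (simp_all add: H10_vec_def)
  then show "(\<lambda>x. (a *\<^sub>R v x + b *\<^sub>R w x) $ i) \<in> H10 \<omega> \<Omega>" by simp
qed



lemma grad_lincomb_AE:
  assumes "weight_on \<Omega> \<omega>" "v \<in> H10_vec \<omega> \<Omega>" "w \<in> H10_vec \<omega> \<Omega>"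
  shows "AE x in lebesgue_on \<Omega>. grad \<Omega> (lincomb a v b w) x = a *\<^sub>R grad \<Omega> v x + b *\<^sub>R grad \<Omega> w x"
proof -
  have H: "(\<lambda>x. v x $ i) \<in> H1 \<omega> \<Omega>" "(\<lambda>x. w x $ i) \<in> H1 \<omega> \<Omega>" for i
    using assms(2,3) by (simp_all add: H10_vec_def H10_H1)
  have "AE x in lebesgue_on \<Omega>. \<forall>i. weak_grad \<Omega> (\<lambda>x. a * v x $ i + b * w x $ i) x =
      a *\<^sub>R weak_grad \<Omega> (\<lambda>x. v x $ i) x + b *\<^sub>R weak_grad \<Omega> (\<lambda>x. w x $ i) x"
    by (rule eventually_all_finite) (rule weak_grad_lincomb_AE[OF assms(1) H])
  then show ?thesis
    by (rule eventually_mono) (simp add: vec_eq_iff grad_def lincomb_def)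
qed

lemma grad_norm_nonneg: "weight_on \<Omega> \<omega> \<Longrightarrow> 0 \<le> grad_norm \<omega> \<Omega> v"
  unfolding grad_norm_def by (rule Lp_norm_ge_0)

lemma grad_norm_lincomb:
  assumes "weight_on \<Omega> \<omega>" "v \<in> H10_vec \<omega> \<Omega>" "w \<in> H10_vec \<omega> \<Omega>"
  shows "grad_norm \<omega> \<Omega> (lincomb a v b w) = Lp_norm 2 \<omega> \<Omega> (\<lambda>x. a *\<^sub>R grad \<Omega> v x + b *\<^sub>R grad \<Omega> w x)"
    and "grad_norm \<omega> \<Omega> (lincomb a v b w) \<le> \<bar>a\<bar> * grad_norm \<omega> \<Omega> v + \<bar>b\<bar> * grad_norm \<omega> \<Omega> w"
proof -
  note L = H10_vec_Lp(2)[OF assms(1,2)] H10_vec_Lp(2)[OF assms(1,3)]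
  show eq: "grad_norm \<omega> \<Omega> (lincomb a v b w) = Lp_norm 2 \<omega> \<Omega> (\<lambda>x. a *\<^sub>R grad \<Omega> v x + b *\<^sub>R grad \<Omega> w x)"
    unfolding grad_norm_def
    by (rule Lp_norm_cong(2)[OF assms(1) Lp_lincomb(1)[OF assms(1) L]
          LpD(1)[OF H10_vec_Lp(2)[OF assms(1) H10_vec_lincomb[OF assms]]]
          grad_lincomb_AE[OF assms]])
  show "grad_norm \<omega> \<Omega> (lincomb a v b w) \<le> \<bar>a\<bar> * grad_norm \<omega> \<Omega> v + \<bar>b\<bar> * grad_norm \<omega> \<Omega> w"
    unfolding eq using Lp_lincomb(2)[OF assms(1) L] by (simp add: grad_norm_def)
qed

lemma Lp_norm_0_AE:
  assumes "weight_on \<Omega> \<omega>" "g \<in> Lp 2 \<omega> \<Omega>" "Lp_norm 2 \<omega> \<Omega> g = 0"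
  shows "AE x in lebesgue_on \<Omega>. g x = 0"
proof -
  note w = weight_onD[OF assms(1)] and g = LpD[OF assms(2)]
  have "(LINT x|lebesgue_on \<Omega>. (norm (g x))\<^sup>2 * \<omega> x) = 0" using assms(3) by (simp add: Lp_norm_2)
  then have "AE x in lebesgue_on \<Omega>. (norm (g x))\<^sup>2 * \<omega> x = 0"
    using integral_nonneg_eq_0_iff_AE[OF g(2)] w(3) by simp
  with w(4) show ?thesis by eventually_elim simp
qed

lemma H10_vec_gradient_0_imp_0:
  assumes "weight_on \<Omega> \<omega>" "v \<in> H10_vec \<omega> \<Omega>" "grad_norm \<omega> \<Omega> v = 0"
  shows "AE x in lebesgue_on \<Omega>. v x = 0" "AE x in lebesgue_on \<Omega>. grad \<Omega> v x = 0"
proof -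
  show g0: "AE x in lebesgue_on \<Omega>. grad \<Omega> v x = 0"
    using Lp_norm_0_AE[OF assms(1) H10_vec_Lp(2)[OF assms(1,2)]] assms(3) by (simp add: grad_norm_def)
  have "AE x in lebesgue_on \<Omega>. v x $ i = 0" for i
  proof (rule H10_gradient_0_imp_0[OF assms(1)])
    show H: "(\<lambda>x. v x $ i) \<in> H10 \<omega> \<Omega>" using assms(2) by (simp add: H10_vec_def)
    have z: "(\<lambda>x. 0 :: real^2) \<in> Lp 2 \<omega> \<Omega>" by (simp add: Lp_def)
    have "AE x in lebesgue_on \<Omega>. weak_grad \<Omega> (\<lambda>x. v x $ i) x = 0"
      using g0 by (rule eventually_mono) (auto simp: grad_def vec_eq_iff)
    from Lp_norm_cong(2)[OF assms(1) z LpD(1)[OF H1_weak_grad(3)[OF assms(1) H10_H1[OF H]]] this]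
    show "Lp_norm 2 \<omega> \<Omega> (weak_grad \<Omega> (\<lambda>x. v x $ i)) = 0" by (simp add: Lp_norm_2)
  qed
  then have "AE x in lebesgue_on \<Omega>. \<forall>i. v x $ i = 0" by (rule eventually_all_finite)
  then show "AE x in lebesgue_on \<Omega>. v x = 0" by (rule eventually_mono) (simp add: vec_eq_iff)
qed

text \<open>Zero is a weak gradient of such a field, and weak gradients are unique.\<close>

lemma H10_vec_0_imp_gradient_0:
  assumes "weight_on \<Omega> \<omega>" "v \<in> H10_vec \<omega> \<Omega>" "AE x in lebesgue_on \<Omega>. v x = 0"
  shows "AE x in lebesgue_on \<Omega>. grad \<Omega> v x = 0"
proof -
  note w = weight_onD[OF assms(1)]
  have "AE x in lebesgue_on \<Omega>. weak_grad \<Omega> (\<lambda>x. v x $ i) x = 0" for i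
  proof -
    have "(\<lambda>x. v x $ i) \<in> H1 \<omega> \<Omega>" using assms(2) by (simp add: H10_vec_def H10_H1)
    note H = H1_weak_grad[OF assms(1) this]
    have "has_weak_gradient \<Omega> (\<lambda>x. v x $ i) (\<lambda>x. 0)"
      unfolding has_weak_gradient_def
    proof (intro conjI ballI allI)
      show "locally_integrable_on \<Omega> (\<lambda>x. v x $ i)" by (rule has_weak_gradient_locally_integrable(1)[OF H(2)])
      show "locally_integrable_on \<Omega> (\<lambda>x. 0 :: real^2)" by (simp add: locally_integrable_on_def)
      fix \<phi> j
      have "(LINT x|lebesgue_on \<Omega>. v x $ i * partial_deriv j \<phi> x) = 0"
        by (rule integral_eq_zero_AE) (use assms(3) in \<open>auto elim: eventually_mono\<close>)
      then show "(LINT x|lebesgue_on \<Omega>. v x $ i * partial_deriv j \<phi> x) =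
          - (LINT x|lebesgue_on \<Omega>. (0 :: real^2) $ j * \<phi> x)" by simp
    qed
    from has_weak_gradient_unique[OF w(1) H(2) this] show ?thesis .
  qed
  then have "AE x in lebesgue_on \<Omega>. \<forall>i. weak_grad \<Omega> (\<lambda>x. v x $ i) x = 0" by (rule eventually_all_finite)
  then show ?thesis by (rule eventually_mono) (simp add: grad_def vec_eq_iff)
qed


section \<open>Mollification\<close>

definition convolution :: "scalar \<Rightarrow> scalar \<Rightarrow> scalar" where
  "convolution f \<rho> x = (LINT y|lborel. f y * \<rho> (x - y))"

lemma convolution_eq_integral:
  assumes "continuous_on UNIV f" "\<And>x. x \<notin> cbox a b \<Longrightarrow> f x = 0" "continuous_on UNIV \<rho>"
  shows "convolution f \<rho> x = integral (cbox a b) (\<lambda>y. f y * \<rho> (x - y))"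
proof -
  have c: "continuous_on UNIV (\<lambda>y. f y * \<rho> (x - y))"
    by (intro continuous_intros assms(1) continuous_on_compose2[OF assms(3)]) auto
  have z: "f y * \<rho> (x - y) = 0" if "y \<notin> cbox a b" for y using assms(2)[OF that] by simp
  have i: "integrable lborel (\<lambda>y. f y * \<rho> (x - y))"
    by (rule continuous_compact_support_integrable[OF c compact_cbox z])
  have "convolution f \<rho> x = integral UNIV (\<lambda>y. f y * \<rho> (x - y))"
    unfolding convolution_def using integral_lborel[OF i] by simp
  also have "\<dots> = integral UNIV (\<lambda>y. if y \<in> cbox a b then f y * \<rho> (x - y) else 0)"
    by (rule arg_cong[where f = "integral UNIV"]) (use z in auto)
  also have "\<dots> = integral (cbox a b) (\<lambda>y. f y * \<rho> (x - y))" by (rule Henstock_Kurzweil_Integration.integral_restrict_UNIV)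
  finally show ?thesis .
qed

text \<open>Differentiation under the integral sign moves every derivative to the smooth factor.\<close>

lemma convolution_has_derivative:
  assumes "continuous_on UNIV f" "\<And>x. x \<notin> cbox a b \<Longrightarrow> f x = 0" "smooth \<rho>"
  shows "convolution f \<rho> differentiable (at x)"
    and "partial_deriv i (convolution f \<rho>) x = convolution f (partial_deriv i \<rho>) x"
proof -
  define fx where "fx x t = f t *\<^sub>R blinfun_inner_left (gradient \<rho> (x - t))" for x t :: "real^2"
  have cg: "continuous_on UNIV (gradient \<rho>)"
    by (intro continuous_on_vec_lambda smooth_continuous smooth_partial_deriv[OF assms(3)])
  have c: "continuous_on S (\<lambda>z. fx (p z) (q z))" if "continuous_on S p" "continuous_on S q" for p q and S :: "'c::topological_space set"
  proof -
    have cf: "continuous_on S (\<lambda>z. f (q z))" by (rule continuous_on_compose2[OF assms(1) that(2)]) simp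
    have "continuous_on S (\<lambda>z. gradient \<rho> (p z - q z))"
      by (rule continuous_on_compose2[OF cg continuous_on_diff[OF that]]) simp
    then have "continuous_on S (\<lambda>z. blinfun_inner_left (gradient \<rho> (p z - q z)))"
      by (rule bounded_linear.continuous_on[OF bounded_linear_blinfun_inner_left])
    then show ?thesis unfolding fx_def by (rule continuous_on_scaleR[OF cf])
  qed
  have D: "((\<lambda>x. f t * \<rho> (x - t)) has_derivative blinfun_apply (fx x t)) (at x within UNIV)" for x t
  proof -
    have "(\<rho> has_derivative (\<lambda>h. \<Sum>i\<in>UNIV. h $ i * partial_deriv i \<rho> (x - t))) (at (x - t))"
      by (rule derivative_eq_sum_partial_deriv[OF smooth_differentiable[OF assms(3)]])
    moreover have "((\<lambda>x. x - t) has_derivative (\<lambda>h. h)) (at x)" by (auto intro!: derivative_eq_intros)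
    ultimately have "((\<lambda>x. \<rho> (x - t)) has_derivative (\<lambda>h. \<Sum>i\<in>UNIV. h $ i * partial_deriv i \<rho> (x - t))) (at x)"
      using has_derivative_compose[of "\<lambda>x. x - t" "\<lambda>h. h" x UNIV \<rho>] by simp
    then have "((\<lambda>x. f t * \<rho> (x - t)) has_derivative (\<lambda>h. f t * (\<Sum>i\<in>UNIV. h $ i * partial_deriv i \<rho> (x - t)))) (at x)"
      by (rule has_derivative_mult_right)
    moreover have "(\<lambda>h. f t * (\<Sum>i\<in>UNIV. h $ i * partial_deriv i \<rho> (x - t))) = blinfun_apply (fx x t)"
      by (rule ext) (simp add: fx_def scaleR_blinfun.rep_eq inner_vec_def)
    ultimately show ?thesis by simp
  qed
  have I: "(\<lambda>y. f y * \<rho> (x - y)) integrable_on cbox a b" for x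
    by (intro integrable_continuous continuous_intros continuous_on_subset[OF assms(1)]
        continuous_on_compose2[OF smooth_continuous[OF assms(3)]]) auto
  have L: "((\<lambda>x. integral (cbox a b) (\<lambda>y. f y * \<rho> (x - y))) has_derivative integral (cbox a b) (fx x)) (at x within UNIV)"
    by (rule leibniz_rule[OF D I]) (auto simp: split_beta intro!: c continuous_intros)
  moreover have "(\<lambda>x. integral (cbox a b) (\<lambda>y. f y * \<rho> (x - y))) = convolution f \<rho>"
    by (rule ext) (simp add: convolution_eq_integral[OF assms(1,2) smooth_continuous[OF assms(3)]])
  ultimately have L': "(convolution f \<rho> has_derivative integral (cbox a b) (fx x)) (at x)" by simp
  then show "convolution f \<rho> differentiable (at x)" by (auto simp: differentiable_def)
  have ifx: "fx x integrable_on cbox a b"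
    by (rule integrable_continuous) (rule c[of _ "\<lambda>_. x" "\<lambda>t. t"], auto intro: continuous_intros)
  have "partial_deriv i (convolution f \<rho>) x = blinfun_apply (integral (cbox a b) (fx x)) (axis i 1)"
    by (rule has_derivative_partial_deriv[OF L'])
  also have "\<dots> = integral (cbox a b) ((\<lambda>B. blinfun_apply B (axis i 1)) \<circ> fx x)"
    by (rule integral_linear[symmetric, OF ifx]) (rule blinfun.bounded_linear_left)
  also have "(\<lambda>B. blinfun_apply B (axis i 1)) \<circ> fx x = (\<lambda>y. f y * partial_deriv i \<rho> (x - y))"
    by (rule ext) (simp add: fx_def scaleR_blinfun.rep_eq inner_axis' )
  also have "integral (cbox a b) \<dots> = convolution f (partial_deriv i \<rho>) x"
    by (rule convolution_eq_integral[symmetric, OF assms(1,2) smooth_continuous[OF smooth_partial_deriv[OF assms(3)]]])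
  finally show "partial_deriv i (convolution f \<rho>) x = convolution f (partial_deriv i \<rho>) x" .
qed

lemma smooth_convolution:
  assumes "continuous_on UNIV f" "\<And>x. x \<notin> cbox a b \<Longrightarrow> f x = 0" "smooth \<rho>"
  shows "smooth (convolution f \<rho>)"
proof
  fix k show "C_k k (convolution f \<rho>)"
    using assms(3)
  proof (induction k arbitrary: \<rho>)
    case 0
    then show ?case
      using convolution_has_derivative(1)[OF assms(1,2)]
      by (auto intro!: differentiable_imp_continuous_on simp: differentiable_on_def)
  next
    case (Suc k)
    have "partial_deriv i (convolution f \<rho>) = convolution f (partial_deriv i \<rho>)" for i
      by (rule ext) (rule convolution_has_derivative(2)[OF assms(1,2) Suc.prems])
    then show ?case
      using Suc.IH[OF smooth_partial_deriv[OF Suc.prems]]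
        convolution_has_derivative(1)[OF assms(1,2) Suc.prems] by simp
  qed
qed

definition mollifier :: "real \<Rightarrow> scalar" where
  "mollifier \<epsilon> z = bump 0 \<epsilon> z / (LINT y|lborel. bump 0 \<epsilon> y)"

lemma bump_C0_infinity:
  assumes "0 < r"
  shows "bump c r \<in> C0_infinity UNIV"
proof (rule C0_infinityI[of "cball c r"])
  fix x assume "x \<notin> cball c r"
  then have "\<not> 0 < bump c r x" unfolding bump_pos_iff[OF assms] by simp
  then show "bump c r x = 0" using bump_nonneg[of c r x] by simp
qed (use smooth_bump in auto)

lemma bump_integral_pos:
  assumes "0 < r"
  shows "0 < (LINT y|lborel. bump 0 r y)"
proof (rule ccontr)
  have i: "integrable lborel (bump 0 r)" by (rule C0_infinity_integrable[OF bump_C0_infinity[OF assms]])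
  assume "\<not> ?thesis"
  then have "(LINT y|lborel. bump 0 r y) = 0"
    using Bochner_Integration.integral_nonneg[of lborel "bump 0 r"] bump_nonneg by (simp add: antisym)
  then have "AE y in lborel. bump 0 r y = 0"
    using integral_nonneg_eq_0_iff_AE[OF i] bump_nonneg by simp
  then have "AE y in lborel. (y::real^2) \<notin> ball 0 r"
  proof eventually_elim
    case (elim y)
    then show ?case using bump_pos_iff[OF assms, of 0 y] by simp
  qed
  then have "ball (0::real^2) r \<in> null_sets lborel" by (subst AE_iff_null_sets) auto
  then have "negligible (ball (0::real^2) r)"
    by (simp add: negligible_iff_null_sets null_sets_completionI)
  then show False using assms open_not_negligible[of "ball (0::real^2) r"] by simp
qed

lemma mollifier_smooth: "smooth (mollifier \<epsilon>)"
  using smooth_bump C_k_cmult[of _ "bump 0 \<epsilon>" "inverse (LINT y|lborel. bump 0 \<epsilon> y)"]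
  unfolding mollifier_def by (simp add: divide_inverse mult.commute)

lemma mollifier_nonneg: "0 < \<epsilon> \<Longrightarrow> 0 \<le> mollifier \<epsilon> z"
  using bump_nonneg bump_integral_pos by (simp add: mollifier_def less_imp_le)

lemma mollifier_eq_0:
  assumes "0 < \<epsilon>" "\<epsilon> \<le> dist x y"
  shows "mollifier \<epsilon> (x - y) = 0"
proof -
  have "\<not> 0 < bump 0 \<epsilon> (x - y)" unfolding bump_pos_iff[OF assms(1)] using assms(2) by (simp add: dist_norm norm_minus_commute)
  then show ?thesis using bump_nonneg[of 0 \<epsilon> "x - y"] by (simp add: mollifier_def)
qed

lemma mollifier_integral:
  assumes "0 < \<epsilon>"
  shows "(LINT y|lborel. mollifier \<epsilon> (x - y)) = 1" "integrable lborel (\<lambda>y. mollifier \<epsilon> (x - y))"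
proof -
  define N where "N = (LINT y|lborel. bump 0 \<epsilon> y)"
  have N: "0 < N" unfolding N_def by (rule bump_integral_pos[OF assms])
  have eq: "bump 0 \<epsilon> (x - y) = bump x \<epsilon> y" for y by (simp add: bump_def power2_commute)
  have "(LINT y|lborel. bump x \<epsilon> y) = (LINT y|distr lborel borel ((+) x). bump x \<epsilon> y)"
    by (simp only: lborel_distr_plus)
  also have "\<dots> = (LINT y|lborel. bump x \<epsilon> (x + y))"
    by (rule integral_distr) (use smooth_measurable[OF smooth_bump] in auto)
  also have "\<dots> = N" by (simp add: N_def bump_def)
  finally show "(LINT y|lborel. mollifier \<epsilon> (x - y)) = 1"
    using N by (simp add: mollifier_def eq flip: N_def)
  show "integrable lborel (\<lambda>y. mollifier \<epsilon> (x - y))"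
    using C0_infinity_integrable[OF bump_C0_infinity[OF assms, of x]] by (simp add: mollifier_def eq)
qed

text \<open>A mollified value is an average over a small ball; with \<open>c = 0\<close> this bounds it, with \<open>c\<close> the
  value at the centre it gives convergence at points of continuity.\<close>

lemma mollifier_average_bound:
  fixes h :: scalar
  assumes "0 < \<epsilon>" "h \<in> borel_measurable lebesgue"
    and "AE y in lebesgue. dist x y < \<epsilon> \<longrightarrow> \<bar>h y - c\<bar> \<le> d"
  shows "integrable lebesgue (\<lambda>y. h y * mollifier \<epsilon> (x - y))"
    and "\<bar>(LINT y|lebesgue. h y * mollifier \<epsilon> (x - y)) - c\<bar> \<le> d"
proof -
  let ?K = "\<lambda>y. mollifier \<epsilon> (x - y)"
  have mK: "?K \<in> borel_measurable lborel"
    using borel_measurable_integrable[OF mollifier_integral(2)[OF assms(1)]] .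
  have K: "integrable lebesgue ?K" "(LINT y|lebesgue. ?K y) = 1"
    using mollifier_integral[OF assms(1), of x] integrable_completion[OF mK] integral_completion[OF mK] by simp_all
  have mK': "?K \<in> borel_measurable lebesgue" using K(1) by simp
  have le: "AE y in lebesgue. \<bar>(h y - c) * ?K y\<bar> \<le> d * ?K y"
    using assms(3)
  proof eventually_elim
    case (elim y)
    show ?case
    proof (cases "dist x y < \<epsilon>")
      case True
      then show ?thesis using elim mollifier_nonneg[OF assms(1)] by (simp add: abs_mult mult_right_mono)
    next
      case False
      then have "?K y = 0" by (intro mollifier_eq_0 assms) simp
      then show ?thesis by simp
    qed
  qed
  have dK: "integrable lebesgue (\<lambda>y. d * ?K y)" using K by simp
  have i: "integrable lebesgue (\<lambda>y. (h y - c) * ?K y)"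
  proof (rule Bochner_Integration.integrable_bound[OF dK])
    show "(\<lambda>y. (h y - c) * ?K y) \<in> borel_measurable lebesgue"
      using mK' assms(2) by (intro borel_measurable_times borel_measurable_diff) auto
    show "AE y in lebesgue. norm ((h y - c) * ?K y) \<le> norm (d * ?K y)"
      using le by eventually_elim simp
  qed
  have eq: "(\<lambda>y. h y * ?K y) = (\<lambda>y. (h y - c) * ?K y + c * ?K y)" by (auto simp: algebra_simps)
  have cK: "integrable lebesgue (\<lambda>y. c * ?K y)" using K by simp
  show "integrable lebesgue (\<lambda>y. h y * ?K y)"
    unfolding eq by (rule Bochner_Integration.integrable_add[OF i cK])
  have "(LINT y|lebesgue. h y * ?K y) - c = (LINT y|lebesgue. (h y - c) * ?K y)"
    unfolding eq using Bochner_Integration.integral_add[OF i cK] K(2) by simp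
  then have "\<bar>(LINT y|lebesgue. h y * ?K y) - c\<bar> \<le> (LINT y|lebesgue. \<bar>(h y - c) * ?K y\<bar>)"
    using integral_abs_bound by simp
  also have "\<dots> \<le> (LINT y|lebesgue. d * ?K y)"
    by (rule integral_mono_AE[OF _ dK le]) (use i in simp)
  also have "\<dots> = d" using K(2) by simp
  finally show "\<bar>(LINT y|lebesgue. h y * ?K y) - c\<bar> \<le> d" .
qed

lemma mollifier_tendsto:
  fixes h :: scalar
  assumes "h \<in> borel_measurable lebesgue" "AE y in lebesgue. h y = k y" "isCont k x"
    and "\<And>n. 0 < \<epsilon> n" "\<epsilon> \<longlonglongrightarrow> 0"
  shows "(\<lambda>n. LINT y|lebesgue. h y * mollifier (\<epsilon> n) (x - y)) \<longlonglongrightarrow> k x"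
proof (rule LIMSEQ_I)
  fix d :: real assume "0 < d"
  then obtain s where s: "0 < s" "\<And>y. dist y x < s \<Longrightarrow> dist (k y) (k x) < d / 2"
    using assms(3) unfolding continuous_at_eps_delta by (metis half_gt_zero)
  obtain N where N: "\<And>n. N \<le> n \<Longrightarrow> \<epsilon> n < s"
    using order_tendstoD(2)[OF assms(5) s(1)] by (auto simp: eventually_sequentially)
  have "norm ((LINT y|lebesgue. h y * mollifier (\<epsilon> n) (x - y)) - k x) < d" if "N \<le> n" for n
  proof -
    have "AE y in lebesgue. dist x y < \<epsilon> n \<longrightarrow> \<bar>h y - k x\<bar> \<le> d / 2"
      using assms(2)
    proof eventually_elim
      case (elim y)
      show ?case using s(2)[of y] N[OF that] elim by (auto simp: dist_commute dist_real_def abs_minus_commute)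
    qed
    from mollifier_average_bound(2)[OF assms(4,1) this] show ?thesis using \<open>0 < d\<close> by simp
  qed
  then show "\<exists>N. \<forall>n\<ge>N. norm ((LINT y|lebesgue. h y * mollifier (\<epsilon> n) (x - y)) - k x) < d" by blast
qed

lemma Lp_norm_tendsto_0:
  fixes h :: "nat \<Rightarrow> real^2 \<Rightarrow> 'b::{real_normed_vector,second_countable_topology}"
  assumes "weight_on \<Omega> \<omega>" "\<And>n. h n \<in> borel_measurable (lebesgue_on \<Omega>)"
    and "\<And>n. AE x in lebesgue_on \<Omega>. norm (h n x) \<le> B"
    and "AE x in lebesgue_on \<Omega>. (\<lambda>n. h n x) \<longlonglongrightarrow> 0"
  shows "(\<lambda>n. Lp_norm 2 \<omega> \<Omega> (h n)) \<longlonglongrightarrow> 0"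
proof -
  note w = weight_onD[OF assms(1)]
  have "(\<lambda>n. LINT x|lebesgue_on \<Omega>. (norm (h n x))\<^sup>2 * \<omega> x) \<longlonglongrightarrow> (LINT x|lebesgue_on \<Omega>. 0)"
  proof (rule integral_dominated_convergence)
    show "(\<lambda>x. (norm (h n x))\<^sup>2 * \<omega> x) \<in> borel_measurable (lebesgue_on \<Omega>)" for n
      using assms(2) w(7) by simp
    show "integrable (lebesgue_on \<Omega>) (\<lambda>x. B\<^sup>2 * \<omega> x)" using w(5) by simp
    show "AE x in lebesgue_on \<Omega>. norm ((norm (h n x))\<^sup>2 * \<omega> x) \<le> B\<^sup>2 * \<omega> x" for n
      using assms(3)[of n]
    proof eventually_elim
      case (elim x)
      then have "(norm (h n x))\<^sup>2 \<le> B\<^sup>2" by (intro power_mono) auto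
      then show ?case using w(3)[of x] by (simp add: mult_right_mono)
    qed
    show "AE x in lebesgue_on \<Omega>. (\<lambda>n. (norm (h n x))\<^sup>2 * \<omega> x) \<longlonglongrightarrow> 0"
      using assms(4)
    proof eventually_elim
      case (elim x)
      have "(\<lambda>n. (norm (h n x))\<^sup>2 * \<omega> x) \<longlonglongrightarrow> (norm (0::'b))\<^sup>2 * \<omega> x"
        by (intro tendsto_intros elim)
      then show ?case by simp
    qed
  qed simp
  then have "(\<lambda>n. sqrt (LINT x|lebesgue_on \<Omega>. (norm (h n x))\<^sup>2 * \<omega> x)) \<longlonglongrightarrow> sqrt 0"
    by (intro tendsto_real_sqrt) simp
  then show ?thesis by (simp add: Lp_norm_2)
qed


lemma C0_infinity_gradient_bounded:
  assumes "\<phi> \<in> C0_infinity U"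
  obtains Z where "0 \<le> Z" "\<And>x. norm (gradient \<phi> x) \<le> Z"
proof -
  obtain Z1 where Z1: "\<And>x. \<bar>partial_deriv 1 \<phi> x\<bar> \<le> Z1"
    using C0_infinity_bounded[OF C0_infinity_partial_deriv[OF assms]] by blast
  obtain Z2 where Z2: "\<And>x. \<bar>partial_deriv 2 \<phi> x\<bar> \<le> Z2"
    using C0_infinity_bounded[OF C0_infinity_partial_deriv[OF assms]] by blast
  have n: "norm (gradient \<phi> x) \<le> Z1 + Z2" for x
    using norm_le_l1_cart[of "gradient \<phi> x"] Z1[of x] Z2[of x] by (simp add: sum_2)
  then show thesis using that[of "Z1 + Z2"] order_trans[OF norm_ge_zero n[of 0]] by blast
qed

text \<open>The derivative of the mollified function is the mollified weak gradient.  It is bounded since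
  the weak gradient is, and it converges at the points where some representative of the weak gradient
  is continuous; hence dominated convergence applies for every integrable weight.\<close>

lemma mollification_dense:
  assumes "weight_on \<Omega> \<omega>" "\<zeta> \<in> C0_infinity \<Omega>"
    and "continuous_on \<Omega> v" "\<And>x. x \<in> \<Omega> \<Longrightarrow> \<bar>v x\<bar> \<le> Bv" "has_weak_gradient \<Omega> v G"
    and "AE x in lebesgue_on \<Omega>. G x = k x" "AE x in lebesgue_on \<Omega>. isCont k x"
    and "AE x in lebesgue_on \<Omega>. norm (G x) \<le> M"
    and "0 < e"
  shows "\<exists>\<phi>\<in>C0_infinity \<Omega>. Lp_norm 2 \<omega> \<Omega> (\<lambda>x. \<zeta> x * v x - \<phi> x) < e \<and>
    Lp_norm 2 \<omega> \<Omega> (\<lambda>x. (\<zeta> x *\<^sub>R G x + v x *\<^sub>R gradient \<zeta> x) - gradient \<phi> x) < e"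
proof -
  note w = weight_onD[OF assms(1)] and li = has_weak_gradient_locally_integrable[OF assms(5)]
  define f where "f x = \<zeta> x * v x" for x
  define F where "F x = \<zeta> x *\<^sub>R G x + v x *\<^sub>R gradient \<zeta> x" for x
  \<comment> \<open>the representative of the components of \<open>F\<close> that is continuous wherever \<open>k\<close> is\<close>
  define kk where "kk i x = (if x \<in> \<Omega> then \<zeta> x * k x $ i + v x * partial_deriv i \<zeta> x else 0)" for i x
  note sm = C0_infinity_smooth[OF assms(2)]
  note D\<zeta> = C0_infinity_partial_deriv[OF assms(2)]
  let ?S = "closure {x. \<zeta> x \<noteq> 0}"
  have S: "compact ?S" "?S \<subseteq> \<Omega>" using C0_infinity_compact[OF assms(2)] C0_infinity_subset[OF assms(2)] .
  have fS: "f x = 0" if "x \<notin> ?S" for x using eq_0_off_support[OF that] by (simp add: f_def)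
  have off: "f x = 0" "F x = 0" if "x \<notin> \<Omega>" for x
    using C0_infinity_eq_0[OF assms(2) that] C0_infinity_eq_0[OF D\<zeta> that]
    by (simp_all add: f_def F_def vec_eq_iff)
  have fc: "continuous_on UNIV f"
  proof -
    have "continuous_on \<Omega> f" unfolding f_def
      by (intro continuous_on_mult smooth_continuous[OF sm] assms(3))
    moreover have "continuous_on (- ?S) f"
    proof -
      have "continuous_on (- ?S) f \<longleftrightarrow> continuous_on (- ?S) (\<lambda>x. 0 :: real)"
        by (rule continuous_on_cong) (use fS in auto)
      then show ?thesis by simp
    qed
    ultimately have "continuous_on (\<Omega> \<union> - ?S) f" using w(1) by (intro continuous_on_open_Un) auto
    moreover have "\<Omega> \<union> - ?S = UNIV" using S(2) by blast
    ultimately show ?thesis by simp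
  qed
  obtain a where a: "?S \<subseteq> cbox (- a) a"
    using bounded_subset_cbox_symmetric[OF compact_imp_bounded[OF S(1)]] by blast
  have fbox: "f x = 0" if "x \<notin> cbox (- a) a" for x using a that by (intro fS) blast
  obtain \<epsilon>0 L where \<epsilon>0: "0 < \<epsilon>0" and L: "compact L" "L \<subseteq> \<Omega>" "\<And>x y. x \<in> ?S \<Longrightarrow> dist x y \<le> \<epsilon>0 \<Longrightarrow> y \<in> L"
    using compact_neighbourhood_in_open[OF S(1) w(1) S(2)] by metis
  define \<epsilon> where "\<epsilon> n = \<epsilon>0 / real (Suc n)" for n
  have \<epsilon>: "0 < \<epsilon> n" "\<epsilon> n \<le> \<epsilon>0" for n
    using \<epsilon>0 by (simp_all add: \<epsilon>_def divide_le_eq mult_left_mono)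
  have \<epsilon>lim: "\<epsilon> \<longlonglongrightarrow> 0"
    using tendsto_mult_right_zero[OF LIMSEQ_inverse_real_of_nat, of \<epsilon>0] by (simp add: \<epsilon>_def[abs_def] divide_inverse)
  define w' where "w' n = convolution f (mollifier (\<epsilon> n))" for n
  obtain B\<zeta> where B\<zeta>: "0 \<le> B\<zeta>" "\<And>x. \<bar>\<zeta> x\<bar> \<le> B\<zeta>" using C0_infinity_bounded[OF assms(2)] by blast
  have sm': "smooth (w' n)" for n
    unfolding w'_def by (rule smooth_convolution[OF fc fbox mollifier_smooth])
  have w'C: "w' n \<in> C0_infinity \<Omega>" for n
  proof (rule C0_infinityI[OF _ L(1,2) sm'])
    fix x assume x: "x \<notin> L"
    have "f y * mollifier (\<epsilon> n) (x - y) = 0" for y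
    proof (cases "y \<in> ?S")
      case True
      then have "\<epsilon> n \<le> dist x y"
        using L(3)[OF True, of x] x \<epsilon>(2)[of n] by (force simp: dist_commute)
      then show ?thesis using mollifier_eq_0[OF \<epsilon>(1)] by simp
    next
      case False
      then show ?thesis using fS by simp
    qed
    then have "(\<lambda>y. f y * mollifier (\<epsilon> n) (x - y)) = (\<lambda>y. 0)" by (rule ext)
    then show "w' n x = 0" unfolding w'_def convolution_def by (simp only: Bochner_Integration.integral_zero)
  qed
  have fm: "f \<in> borel_measurable lborel" using borel_measurable_continuous_onI[OF fc] by simp
  have fml: "f \<in> borel_measurable lebesgue" using measurable_completion[OF fm] .
  have mol_m: "(\<lambda>y. mollifier (\<epsilon> n) (x - y)) \<in> borel_measurable lborel" for n x
    using borel_measurable_integrable[OF mollifier_integral(2)[OF \<epsilon>(1)]] .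
  have w'_eq: "w' n x = (LINT y|lebesgue. f y * mollifier (\<epsilon> n) (x - y))" for n x
    unfolding w'_def convolution_def
    by (rule integral_completion[symmetric]) (rule borel_measurable_times[OF fm mol_m])
  have Dw'_eq: "partial_deriv i (w' n) x = (LINT y|lebesgue. F y $ i * mollifier (\<epsilon> n) (x - y))" for i n x
  proof -
    define \<psi> where "\<psi> y = mollifier (\<epsilon> n) (x - y)" for y
    have \<psi>_eq: "\<psi> = (\<lambda>y. inverse (LINT z|lborel. bump 0 (\<epsilon> n) z) * bump x (\<epsilon> n) y)"
      by (rule ext) (simp add: \<psi>_def mollifier_def bump_def power2_commute divide_inverse)
    have \<psi>: "smooth \<psi>" unfolding \<psi>_eq using smooth_bump C_k_cmult by blast
    have D\<psi>: "partial_deriv i \<psi> y = - partial_deriv i (mollifier (\<epsilon> n)) (x - y)" for y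
    proof -
      have "((\<lambda>y. x - y) has_derivative (\<lambda>h. - h)) (at y)" by (auto intro!: derivative_eq_intros)
      from has_derivative_compose[OF this
          derivative_eq_sum_partial_deriv[OF smooth_differentiable[OF mollifier_smooth[of "\<epsilon> n"], of "x - y"]]]
      have "(\<psi> has_derivative (\<lambda>h. \<Sum>j\<in>UNIV. (- h) $ j * partial_deriv j (mollifier (\<epsilon> n)) (x - y))) (at y)"
        by (simp add: \<psi>_def[abs_def])
      from has_derivative_partial_deriv[OF this, of i] show ?thesis
        by (simp add: axis_def if_distrib if_distribR sum_negf cong: if_cong)
    qed
    have \<zeta>\<psi>: "(\<lambda>x. \<zeta> x * \<psi> x) \<in> C0_infinity \<Omega>" by (rule C0_infinity_mult[OF assms(2) \<psi>])
    have "(\<lambda>x. partial_deriv i \<zeta> x * \<psi> x) \<in> C0_infinity \<Omega>" by (rule C0_infinity_mult[OF D\<zeta> \<psi>])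
    then have D\<zeta>\<psi>: "(\<lambda>x. \<psi> x * partial_deriv i \<zeta> x) \<in> C0_infinity \<Omega>" by (simp add: mult.commute)
    have "partial_deriv i (w' n) x = (LINT y|lborel. f y * partial_deriv i (mollifier (\<epsilon> n)) (x - y))"
      unfolding w'_def convolution_def[of f "partial_deriv i (mollifier (\<epsilon> n))", symmetric]
      by (rule convolution_has_derivative(2)[OF fc fbox mollifier_smooth])
    also have "\<dots> = - (LINT y|lborel. f y * partial_deriv i \<psi> y)"
      by (simp add: D\<psi>)
    also have "(LINT y|lborel. f y * partial_deriv i \<psi> y) = (LINT y|lebesgue_on \<Omega>. f y * partial_deriv i \<psi> y)"
      using off(1) fm smooth_measurable[OF smooth_partial_deriv[OF \<psi>], of i] w(1)
      by (intro LINT_on_eq_LINT_lborel[symmetric]) auto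
    also have "\<dots> = - (LINT y|lebesgue_on \<Omega>. F y $ i * \<psi> y)"
      unfolding f_def F_def
      using integral_mult_smooth_partial_deriv[OF w(1) assms(5) sm \<psi> \<zeta>\<psi>
          locally_integrable_times_test[OF w(1) li(1) D\<zeta>\<psi>]
          locally_integrable_times_test[OF w(1) locally_integrable_component[OF li(2)] \<zeta>\<psi>]]
      by simp
    also have "(LINT y|lebesgue_on \<Omega>. F y $ i * \<psi> y) = (LINT y|lebesgue. F y $ i * \<psi> y)"
      using off(2) w(1) by (intro LINT_on_eq_LINT_lebesgue(1)) auto
    finally show ?thesis by (simp add: \<psi>_def)
  qed
  have Fm: "(\<lambda>y. F y $ i) \<in> borel_measurable lebesgue" for i
  proof -
    have "locally_integrable_on \<Omega> F" unfolding F_def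
      using has_weak_gradient_locally_integrable(2)[OF has_weak_gradient_mult_smooth[OF w(1) assms(5) sm]] .
    then have "(\<lambda>y. F y $ i) \<in> borel_measurable (lebesgue_on \<Omega>)"
      using locally_integrable_measurable[OF w(1) locally_integrable_component] by blast
    then have "(\<lambda>y. if y \<in> \<Omega> then F y $ i else 0) \<in> borel_measurable lebesgue"
      using w(1) by (simp add: borel_measurable_if)
    moreover have "(\<lambda>y. if y \<in> \<Omega> then F y $ i else 0) = (\<lambda>y. F y $ i)" using off(2) by auto
    ultimately show ?thesis by simp
  qed
  have AE_on: "AE x in lebesgue. x \<in> \<Omega> \<longrightarrow> P x" if "AE x in lebesgue_on \<Omega>. P x" for P
    using that w(1) by (subst (asm) AE_restrict_space_iff) auto
  have Fk: "AE y in lebesgue. F y $ i = kk i y" for i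
    using AE_on[OF assms(6)]
  proof eventually_elim
    case (elim y)
    show ?case
    proof (cases "y \<in> \<Omega>")
      case True
      then show ?thesis using elim by (simp add: kk_def F_def)
    next
      case False
      then show ?thesis using off(2) by (simp add: kk_def)
    qed
  qed
  obtain Z where Z0: "\<And>x. norm (gradient \<zeta> x) \<le> Z"
    using C0_infinity_gradient_bounded[OF assms(2)] by blast
  have Z: "\<bar>partial_deriv i \<zeta> x\<bar> \<le> Z" for i x
    using component_le_norm_cart[of "gradient \<zeta> x" i] Z0[of x] by simp
  define M1 where "M1 = B\<zeta> * \<bar>M\<bar> + \<bar>Bv\<bar> * \<bar>Z\<bar>"
  have M1: "0 \<le> M1" using B\<zeta>(1) by (simp add: M1_def)
  have Fb: "AE y in lebesgue. \<forall>i. \<bar>F y $ i\<bar> \<le> M1"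
    using AE_on[OF assms(8)]
  proof eventually_elim
    case (elim y)
    show ?case
    proof (cases "y \<in> \<Omega>")
      case True
      show ?thesis
      proof
        fix i
        have "\<bar>G y $ i\<bar> \<le> \<bar>M\<bar>" using elim True component_le_norm_cart[of "G y" i] by simp
        then have "\<bar>\<zeta> y * G y $ i\<bar> \<le> B\<zeta> * \<bar>M\<bar>" unfolding abs_mult using B\<zeta> by (intro mult_mono) auto
        moreover have "\<bar>v y * partial_deriv i \<zeta> y\<bar> \<le> \<bar>Bv\<bar> * \<bar>Z\<bar>"
          unfolding abs_mult using assms(4)[OF True] Z[of i y] by (intro mult_mono) auto
        ultimately show "\<bar>F y $ i\<bar> \<le> M1" unfolding F_def M1_def by simp
      qed
    next
      case False
      then show ?thesis using off(2) M1 by simp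
    qed
  qed
  have Dwb: "\<bar>partial_deriv i (w' n) x\<bar> \<le> M1" for i n x
  proof -
    have "AE y in lebesgue. dist x y < \<epsilon> n \<longrightarrow> \<bar>F y $ i - 0\<bar> \<le> M1"
      using Fb by eventually_elim simp
    from mollifier_average_bound(2)[OF \<epsilon>(1) Fm this] show ?thesis by (simp add: Dw'_eq)
  qed
  have fb: "\<bar>f y\<bar> \<le> B\<zeta> * \<bar>Bv\<bar>" for y
  proof (cases "y \<in> \<Omega>")
    case True
    then show ?thesis unfolding f_def abs_mult using B\<zeta> assms(4)[OF True] by (intro mult_mono) auto
  next
    case False
    then show ?thesis using off(1) B\<zeta>(1) by simp
  qed
  have wb: "\<bar>w' n x\<bar> \<le> B\<zeta> * \<bar>Bv\<bar>" for n x
    using mollifier_average_bound(2)[OF \<epsilon>(1) fml, of x n 0] fb by (simp add: w'_eq)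
  have m_on: "h \<in> borel_measurable (lebesgue_on \<Omega>)" if "h \<in> borel_measurable lebesgue" for h :: "real^2 \<Rightarrow> real"
    using that by (rule measurable_restrict_space1)
  have l1: "(\<lambda>n. Lp_norm 2 \<omega> \<Omega> (\<lambda>x. f x - w' n x)) \<longlonglongrightarrow> 0"
  proof (rule Lp_norm_tendsto_0[OF assms(1)])
    show "(\<lambda>x. f x - w' n x) \<in> borel_measurable (lebesgue_on \<Omega>)" for n
      by (intro borel_measurable_diff m_on[OF fml] C0_infinity_measurable[OF w'C w(1)])
    show "AE x in lebesgue_on \<Omega>. norm (f x - w' n x) \<le> 2 * (B\<zeta> * \<bar>Bv\<bar>)" for n
    proof (rule AE_I2)
      fix x
      show "norm (f x - w' n x) \<le> 2 * (B\<zeta> * \<bar>Bv\<bar>)" using fb[of x] wb[of n x] by simp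
    qed
    show "AE x in lebesgue_on \<Omega>. (\<lambda>n. f x - w' n x) \<longlonglongrightarrow> 0"
    proof (rule AE_I2)
      fix x
      have "isCont f x" using fc by (simp add: continuous_on_eq_continuous_at)
      then have "(\<lambda>n. w' n x) \<longlonglongrightarrow> f x"
        unfolding w'_eq by (intro mollifier_tendsto[OF fml _ _ \<epsilon>(1) \<epsilon>lim]) simp_all
      from tendsto_diff[OF tendsto_const[of "f x"] this] show "(\<lambda>n. f x - w' n x) \<longlonglongrightarrow> 0" by simp
    qed
  qed
  have l2: "(\<lambda>n. Lp_norm 2 \<omega> \<Omega> (\<lambda>x. F x - gradient (w' n) x)) \<longlonglongrightarrow> 0"
  proof (rule Lp_norm_tendsto_0[OF assms(1)])
    show "(\<lambda>x. F x - gradient (w' n) x) \<in> borel_measurable (lebesgue_on \<Omega>)" for n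
    proof (rule borel_measurable_diff)
      show "gradient (w' n) \<in> borel_measurable (lebesgue_on \<Omega>)"
        by (rule LpD(1)[OF C0_infinity_in_Lp(2)[OF assms(1) w'C]])
      have "locally_integrable_on \<Omega> F" unfolding F_def
        using has_weak_gradient_locally_integrable(2)[OF has_weak_gradient_mult_smooth[OF w(1) assms(5) sm]] .
      then show "F \<in> borel_measurable (lebesgue_on \<Omega>)" by (rule locally_integrable_measurable[OF w(1)])
    qed
    have "AE x in lebesgue_on \<Omega>. \<forall>i. \<bar>F x $ i\<bar> \<le> M1"
      using Fb w(1) by (subst AE_restrict_space_iff) (auto elim: eventually_mono)
    then show "AE x in lebesgue_on \<Omega>. norm (F x - gradient (w' n) x) \<le> 4 * M1" for n
    proof eventually_elim
      case (elim x)
      have "norm (F x - gradient (w' n) x) \<le> (\<Sum>i\<in>UNIV. \<bar>(F x - gradient (w' n) x) $ i\<bar>)"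
        by (rule norm_le_l1_cart)
      also have "\<dots> \<le> (\<Sum>i\<in>(UNIV :: 2 set). 2 * M1)"
      proof (rule sum_mono)
        fix i :: 2
        show "\<bar>(F x - gradient (w' n) x) $ i\<bar> \<le> 2 * M1" using elim Dwb[of i n x] by (simp add: abs_le_iff) (smt (verit) abs_le_iff)
      qed
      finally show ?case by simp
    qed
    have "AE x in lebesgue_on \<Omega>. \<forall>i. F x $ i = kk i x"
    proof (rule eventually_all_finite)
      show "AE x in lebesgue_on \<Omega>. F x $ i = kk i x" for i
        using Fk[of i] w(1) by (subst AE_restrict_space_iff) (auto elim: eventually_mono)
    qed
    then show "AE x in lebesgue_on \<Omega>. (\<lambda>n. F x - gradient (w' n) x) \<longlonglongrightarrow> 0"
      using assms(7) AE_space
    proof eventually_elim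
      case (elim x)
      then have x: "x \<in> \<Omega>" by simp
      have "(\<lambda>n. partial_deriv i (w' n) x) \<longlonglongrightarrow> F x $ i" for i
      proof -
        have cv: "isCont v x" using assms(3) w(1) x by (simp add: continuous_on_eq_continuous_at)
        have cz: "isCont \<zeta> x" "isCont (partial_deriv i \<zeta>) x"
          using smooth_continuous[OF sm, of UNIV] smooth_continuous[OF smooth_partial_deriv[OF sm], of UNIV i]
          by (simp_all add: continuous_on_eq_continuous_at)
        have "isCont (\<lambda>x. \<zeta> x * k x $ i + v x * partial_deriv i \<zeta> x) x"
          using cv cz elim(2) by (intro continuous_intros)
        moreover have "\<forall>\<^sub>F y in nhds x. \<zeta> y * k y $ i + v y * partial_deriv i \<zeta> y = kk i y"
          using eventually_nhds_in_open[OF w(1) x] by (rule eventually_mono) (simp add: kk_def)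
        ultimately have "isCont (kk i) x" using isCont_cong by fastforce
        from mollifier_tendsto[OF Fm Fk this \<epsilon>(1) \<epsilon>lim] show ?thesis using elim(1) by (simp add: Dw'_eq)
      qed
      then have "(\<lambda>n. F x - gradient (w' n) x) \<longlonglongrightarrow> F x - F x"
        by (intro tendsto_diff tendsto_const vec_tendstoI) simp
      then show ?case by simp
    qed
  qed
  have "\<forall>\<^sub>F n in sequentially. Lp_norm 2 \<omega> \<Omega> (\<lambda>x. f x - w' n x) < e \<and>
      Lp_norm 2 \<omega> \<Omega> (\<lambda>x. F x - gradient (w' n) x) < e"
    using order_tendstoD(2)[OF l1 assms(9)] order_tendstoD(2)[OF l2 assms(9)] by (rule eventually_conj)
  then obtain n where "Lp_norm 2 \<omega> \<Omega> (\<lambda>x. f x - w' n x) < e"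
      "Lp_norm 2 \<omega> \<Omega> (\<lambda>x. F x - gradient (w' n) x) < e"
    by (auto simp: eventually_sequentially)
  then show ?thesis unfolding f_def F_def using w'C by blast
qed


definition bounded_near_frontier :: "(real^2) set \<Rightarrow> scalar \<Rightarrow> bool" where
  "bounded_near_frontier \<Omega> \<omega> \<longleftrightarrow> (\<exists>\<epsilon>>0. \<exists>B\<ge>0. \<forall>x\<in>\<Omega>. infdist x (frontier \<Omega>) < \<epsilon> \<longrightarrow> \<omega> x \<le> B)"

lemma Lp_change_weight:
  assumes "weight_on \<Omega> \<omega>" "h \<in> Lp 2 (\<lambda>_. 1) \<Omega>" "\<And>x. x \<in> \<Omega> \<Longrightarrow> h x \<noteq> 0 \<Longrightarrow> \<omega> x \<le> B" "0 \<le> B"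
  shows "h \<in> Lp 2 \<omega> \<Omega>" "Lp_norm 2 \<omega> \<Omega> h \<le> sqrt B * Lp_norm 2 (\<lambda>_. 1) \<Omega> h"
proof -
  note w = weight_onD[OF assms(1)] and h = LpD[OF assms(2)]
  have le: "AE x in lebesgue_on \<Omega>. (norm (h x))\<^sup>2 * \<omega> x \<le> B * (norm (h x))\<^sup>2"
  proof (rule AE_I2)
    fix x assume "x \<in> space (lebesgue_on \<Omega>)"
    then have x: "x \<in> \<Omega>" by simp
    show "(norm (h x))\<^sup>2 * \<omega> x \<le> B * (norm (h x))\<^sup>2"
      using assms(3)[OF x] by (cases "h x = 0") (auto simp: mult.commute[of B] intro!: mult_left_mono)
  qed
  have iB: "integrable (lebesgue_on \<Omega>) (\<lambda>x. B * (norm (h x))\<^sup>2)" using h(2) by simp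
  have i: "integrable (lebesgue_on \<Omega>) (\<lambda>x. (norm (h x))\<^sup>2 * \<omega> x)"
  proof (rule Bochner_Integration.integrable_bound[OF iB])
    show "(\<lambda>x. (norm (h x))\<^sup>2 * \<omega> x) \<in> borel_measurable (lebesgue_on \<Omega>)" using h(1) w(7) by simp
    show "AE x in lebesgue_on \<Omega>. norm ((norm (h x))\<^sup>2 * \<omega> x) \<le> norm (B * (norm (h x))\<^sup>2)"
      using le by eventually_elim (use w(3) assms(4) in \<open>simp add: abs_mult\<close>)
  qed
  then show "h \<in> Lp 2 \<omega> \<Omega>" using h(1) by (simp add: Lp_def)
  have "(LINT x|lebesgue_on \<Omega>. (norm (h x))\<^sup>2 * \<omega> x) \<le> B * (LINT x|lebesgue_on \<Omega>. (norm (h x))\<^sup>2)"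
    using integral_mono_AE[OF i iB le] by simp
  then show "Lp_norm 2 \<omega> \<Omega> h \<le> sqrt B * Lp_norm 2 (\<lambda>_. 1) \<Omega> h"
    by (simp add: Lp_norm_2 flip: real_sqrt_mult)
qed

text \<open>With a cutoff \<open>\<zeta>\<close> that is 1 away from the boundary, \<open>\<zeta> v\<close> is approximated by its
  mollifications, and \<open>(1 - \<zeta>) v\<close>, which lives where the weight is bounded, by \<open>(1 - \<zeta>) \<phi>\<close> with
  \<open>\<phi>\<close> close to \<open>v\<close> in the unweighted space.\<close>

theorem H10_change_weight:
  assumes "weight_on \<Omega> \<omega>" "bounded_near_frontier \<Omega> \<omega>"
    and "v \<in> H10 (\<lambda>_. 1) \<Omega>" "continuous_on (closure \<Omega>) v"
    and "AE x in lebesgue_on \<Omega>. weak_grad \<Omega> v x = k x" "AE x in lebesgue_on \<Omega>. isCont k x"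
    and "AE x in lebesgue_on \<Omega>. norm (weak_grad \<Omega> v x) \<le> M"
  shows "v \<in> H10 \<omega> \<Omega>"
proof -
  note w = weight_onD[OF assms(1)]
  note w1 = weight_on_1[OF w(1,2)]
  note H = H1_weak_grad[OF w1 H10_H1[OF assms(3)]]
  let ?G = "weak_grad \<Omega> v"
  obtain \<epsilon> B where \<epsilon>: "0 < \<epsilon>" "0 \<le> B" "\<And>x. x \<in> \<Omega> \<Longrightarrow> infdist x (frontier \<Omega>) < \<epsilon> \<Longrightarrow> \<omega> x \<le> B"
    using assms(2) by (auto simp: bounded_near_frontier_def)
  have "compact (v ` closure \<Omega>)" using w(2) by (intro compact_continuous_image assms(4)) (simp add: compact_closure)
  then obtain Bv where Bv: "\<And>x. x \<in> closure \<Omega> \<Longrightarrow> \<bar>v x\<bar> \<le> Bv"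
    using compact_imp_bounded[of "v ` closure \<Omega>"] by (auto simp: bounded_iff)
  have vb: "\<bar>v x\<bar> \<le> Bv" if "x \<in> \<Omega>" for x using Bv[of x] that closure_subset[of \<Omega>] by (meson subsetD)
  have cv: "continuous_on \<Omega> v" by (rule continuous_on_subset[OF assms(4) closure_subset])
  have vL: "v \<in> Lp 2 \<omega> \<Omega>" by (rule bounded_in_Lp[OF assms(1) LpD(1)[OF H(1)]]) (use vb in simp)
  have GL: "?G \<in> Lp 2 \<omega> \<Omega>"
  proof (rule Lp_norm_mono(1)[OF assms(1) _ LpD(1)[OF H(3)]])
    show "(\<lambda>_. 1::real) \<in> Lp 2 \<omega> \<Omega>" using w by (simp add: Lp_def)
    show "AE x in lebesgue_on \<Omega>. norm (?G x) \<le> \<bar>M\<bar> * norm (1::real)"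
      using assms(7) by eventually_elim simp
  qed simp
  define K where "K = {x \<in> closure \<Omega>. \<epsilon> \<le> infdist x (frontier \<Omega>)}"
  have K: "compact K" "K \<subseteq> \<Omega>"
  proof -
    have "closed {x. \<epsilon> \<le> infdist x (frontier \<Omega>)}"
      by (intro closed_Collect_le continuous_intros)
    then have "compact (closure \<Omega> \<inter> {x. \<epsilon> \<le> infdist x (frontier \<Omega>)})"
      using w(2) by (intro compact_Int_closed) (simp_all add: compact_closure)
    then show "compact K" by (simp add: K_def Int_def)
    show "K \<subseteq> \<Omega>"
    proof
      fix x assume x: "x \<in> K"
      have "x \<notin> frontier \<Omega>" using x \<epsilon>(1) by (auto simp: K_def)
      then show "x \<in> \<Omega>" using x w(1) by (simp add: K_def frontier_def interior_open)
    qed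
  qed
  obtain \<zeta> where \<zeta>: "\<zeta> \<in> C0_infinity \<Omega>" "\<And>x. 0 \<le> \<zeta> x" "\<And>x. \<zeta> x \<le> 1" "\<And>x. x \<in> K \<Longrightarrow> \<zeta> x = 1"
    using cutoff_exists[OF K(1) w(1) K(2)] by blast
  note sm = C0_infinity_smooth[OF \<zeta>(1)]
  have DK: "gradient \<zeta> x = 0" if "x \<in> K" for x
  proof -
    \<comment> \<open>\<open>\<zeta>\<close> attains its maximum 1 at \<open>x\<close>.\<close>
    obtain D where D: "(\<zeta> has_derivative D) (at x)"
      using smooth_differentiable[OF sm, of x] by (auto simp: differentiable_def)
    have "D = (\<lambda>v. 0)"
      by (rule differential_zero_maxmin[OF UNIV_I open_UNIV D]) (use \<zeta>(3,4) that in simp)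
    then show ?thesis using has_derivative_partial_deriv[OF D] by (simp add: vec_eq_iff)
  qed
  have out: "\<omega> x \<le> B" if "x \<in> \<Omega>" "x \<notin> K" for x
    using \<epsilon>(3)[OF that(1)] that closure_subset[of \<Omega>] by (force simp: K_def)
  obtain Z where Z: "0 \<le> Z" "\<And>x. norm (gradient \<zeta> x) \<le> Z"
    using C0_infinity_gradient_bounded[OF \<zeta>(1)] by blast
  show ?thesis
  proof (rule H10I[OF assms(1) vL GL H(2)])
    fix e :: real assume e: "0 < e"
    \<comment> \<open>The factor \<open>sqrt B * (1 + Z)\<close> is what the outer part loses in the change of weight and in the
      product rule.\<close>
    define q where "q = sqrt B * (1 + Z) + 1"
    define d where "d = e / 2 / q"
    have den: "0 < q" using \<epsilon>(2) Z(1) by (simp add: q_def add_nonneg_pos)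
    have d: "0 < d" using e den by (simp add: d_def)
    have dB: "sqrt B * (d + Z * d) \<le> e / 2"
    proof -
      have "sqrt B * (d + Z * d) \<le> q * d" using d by (simp add: q_def algebra_simps)
      also have "\<dots> = e / 2" using den by (simp add: d_def)
      finally show ?thesis .
    qed
    have dB1: "sqrt B * d \<le> e / 2"
      using dB mult_nonneg_nonneg[OF Z(1) less_imp_le[OF d]] \<epsilon>(2)
      by (smt (verit, best) mult_left_mono real_sqrt_ge_zero)
    obtain \<phi>1 where \<phi>1: "\<phi>1 \<in> C0_infinity \<Omega>" "Lp_norm 2 \<omega> \<Omega> (\<lambda>x. \<zeta> x * v x - \<phi>1 x) < e / 2"
        "Lp_norm 2 \<omega> \<Omega> (\<lambda>x. (\<zeta> x *\<^sub>R ?G x + v x *\<^sub>R gradient \<zeta> x) - gradient \<phi>1 x) < e / 2"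
      using mollification_dense[OF assms(1) \<zeta>(1) cv vb H(2) assms(5,6,7), of "e / 2"] e by auto
    obtain \<phi> where \<phi>: "\<phi> \<in> C0_infinity \<Omega>" "Lp_norm 2 (\<lambda>_. 1) \<Omega> (\<lambda>x. v x - \<phi> x) < d"
        "Lp_norm 2 (\<lambda>_. 1) \<Omega> (\<lambda>x. ?G x - gradient \<phi> x) < d"
      by (rule H10_approx[OF w1 assms(3) d])
    note T = C0_infinity_in_Lp[OF w1 \<phi>(1)] and T1 = C0_infinity_in_Lp[OF assms(1) \<phi>1(1)]
      and T\<zeta> = C0_infinity_in_Lp[OF assms(1) \<zeta>(1)]
    define r where "r x = (1 - \<zeta> x) * (v x - \<phi> x)" for x
    define R where "R x = 1 *\<^sub>R ((1 - \<zeta> x) *\<^sub>R (?G x - gradient \<phi> x)) + (- 1) *\<^sub>R ((v x - \<phi> x) *\<^sub>R gradient \<zeta> x)" for x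
    have z1: "\<bar>1 - \<zeta> x\<bar> \<le> 1" for x using \<zeta>(2,3)[of x] by (simp add: abs_le_iff)
    have zm: "\<zeta> \<in> borel_measurable (lebesgue_on \<Omega>)" by (rule LpD(1)[OF T\<zeta>(1)])
    have zm': "(\<lambda>x. 1 - \<zeta> x) \<in> borel_measurable (lebesgue_on \<Omega>)"
      by (rule borel_measurable_diff[OF borel_measurable_const zm])
    note dv = Lp_diff[OF w1 H(1) T(1)] and dG = Lp_diff[OF w1 H(3) T(2)]
    have r1: "r \<in> Lp 2 (\<lambda>_. 1) \<Omega>" "Lp_norm 2 (\<lambda>_. 1) \<Omega> r \<le> 1 * Lp_norm 2 (\<lambda>_. 1) \<Omega> (\<lambda>x. v x - \<phi> x)"
      using Lp_times_bounded[OF w1 dv zm' z1] by (simp_all add: r_def[abs_def])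
    note Ra = Lp_times_bounded[OF w1 dG zm' z1 zero_le_one]
    note Rb = Lp_scaleR_bounded[OF w1 dv LpD(1)[OF T\<zeta>(2)] Z(2,1)]
    have R1: "R \<in> Lp 2 (\<lambda>_. 1) \<Omega>" "Lp_norm 2 (\<lambda>_. 1) \<Omega> R \<le> d + Z * d"
    proof -
      show "R \<in> Lp 2 (\<lambda>_. 1) \<Omega>" unfolding R_def by (rule Lp_lincomb(1)[OF w1 Ra(1) Rb(1)])
      have "Lp_norm 2 (\<lambda>_. 1) \<Omega> R \<le> Lp_norm 2 (\<lambda>_. 1) \<Omega> (\<lambda>x. (1 - \<zeta> x) *\<^sub>R (?G x - gradient \<phi> x)) +
          Lp_norm 2 (\<lambda>_. 1) \<Omega> (\<lambda>x. (v x - \<phi> x) *\<^sub>R gradient \<zeta> x)"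
        using Lp_lincomb(2)[OF w1 Ra(1) Rb(1), of 1 "- 1"] by (simp add: R_def[abs_def])
      also have "\<dots> \<le> d + Z * d"
        using Ra(2) Rb(2) \<phi>(2,3) mult_left_mono[OF less_imp_le[OF \<phi>(2)] Z(1)] by simp
      finally show "Lp_norm 2 (\<lambda>_. 1) \<Omega> R \<le> d + Z * d" .
    qed
    have r0: "\<omega> x \<le> B" if "x \<in> \<Omega>" "r x \<noteq> 0" for x
      using out[OF that(1)] that(2) \<zeta>(4)[of x] by (auto simp: r_def)
    have R0: "\<omega> x \<le> B" if "x \<in> \<Omega>" "R x \<noteq> 0" for x
      using out[OF that(1)] that(2) \<zeta>(4)[of x] DK[of x] by (cases "x \<in> K") (simp_all add: R_def)
    note rw = Lp_change_weight[OF assms(1) r1(1) r0 \<epsilon>(2)] and Rw = Lp_change_weight[OF assms(1) R1(1) R0 \<epsilon>(2)]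
    have rlt: "Lp_norm 2 \<omega> \<Omega> r \<le> e / 2"
    proof -
      have "sqrt B * Lp_norm 2 (\<lambda>_. 1) \<Omega> r \<le> sqrt B * d" using r1(2) \<phi>(2) \<epsilon>(2) by (intro mult_left_mono) auto
      then show ?thesis using rw(2) dB1 by linarith
    qed
    have Rlt: "Lp_norm 2 \<omega> \<Omega> R \<le> e / 2"
    proof -
      have "sqrt B * Lp_norm 2 (\<lambda>_. 1) \<Omega> R \<le> sqrt B * (d + Z * d)" using R1(2) \<epsilon>(2) by (intro mult_left_mono) auto
      then show ?thesis using Rw(2) dB by linarith
    qed
    define \<phi>' where "\<phi>' x = 1 * \<phi>1 x + 1 * (\<phi> x * (1 - \<zeta> x))" for x
    have sm1: "smooth (\<lambda>x. 1 - \<zeta> x)" using C_k_diff[OF C_k_const] sm by blast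
    have c2: "(\<lambda>x. \<phi> x * (1 - \<zeta> x)) \<in> C0_infinity \<Omega>" by (rule C0_infinity_mult[OF \<phi>(1) sm1])
    have \<phi>'C: "\<phi>' \<in> C0_infinity \<Omega>" unfolding \<phi>'_def by (intro C0_infinity_add C0_infinity_cmult \<phi>1(1) c2)
    have D1z: "partial_deriv i (\<lambda>x. 1 - \<zeta> x) x = - partial_deriv i \<zeta> x" for i x
    proof -
      have "((\<lambda>x. 1 - \<zeta> x) has_derivative (\<lambda>h. - (\<Sum>j\<in>UNIV. h $ j * partial_deriv j \<zeta> x))) (at x)"
        by (auto intro!: derivative_eq_intros derivative_eq_sum_partial_deriv smooth_differentiable[OF sm])
      from has_derivative_partial_deriv[OF this, of i] show ?thesis
        by (simp add: axis_def if_distrib if_distribR cong: if_cong)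
    qed
    have g2: "gradient (\<lambda>x. \<phi> x * (1 - \<zeta> x)) x = (1 - \<zeta> x) *\<^sub>R gradient \<phi> x - \<phi> x *\<^sub>R gradient \<zeta> x" for x
      using partial_deriv_mult[OF smooth_differentiable[OF C0_infinity_smooth[OF \<phi>(1)]] smooth_differentiable[OF sm1]]
      by (simp add: vec_eq_iff D1z)
    have g': "gradient \<phi>' x = gradient \<phi>1 x + ((1 - \<zeta> x) *\<^sub>R gradient \<phi> x - \<phi> x *\<^sub>R gradient \<zeta> x)" for x
      unfolding \<phi>'_def gradient_lincomb[OF \<phi>1(1) c2] g2 by simp
    have z1': "\<bar>\<zeta> x\<bar> \<le> 1" for x using \<zeta>(2,3)[of x] by simp
    have zv: "(\<lambda>x. \<zeta> x * v x - \<phi>1 x) \<in> Lp 2 \<omega> \<Omega>"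
      using Lp_diff[OF assms(1) Lp_times_bounded(1)[OF assms(1) vL zm z1' zero_le_one] T1(1)] by simp
    have zG: "(\<lambda>x. (\<zeta> x *\<^sub>R ?G x + v x *\<^sub>R gradient \<zeta> x) - gradient \<phi>1 x) \<in> Lp 2 \<omega> \<Omega>"
      using Lp_diff[OF assms(1) Lp_lincomb(1)[OF assms(1) Lp_times_bounded(1)[OF assms(1) GL zm z1' zero_le_one]
            Lp_scaleR_bounded(1)[OF assms(1) vL LpD(1)[OF T\<zeta>(2)] Z(2,1)], of 1 1] T1(2)] by simp
    have "(\<lambda>x. v x - \<phi>' x) = (\<lambda>x. 1 *\<^sub>R (\<zeta> x * v x - \<phi>1 x) + 1 *\<^sub>R r x)"
      by (auto simp: \<phi>'_def r_def algebra_simps)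
    then have "Lp_norm 2 \<omega> \<Omega> (\<lambda>x. v x - \<phi>' x) < e"
      using Lp_lincomb(2)[OF assms(1) zv rw(1), of 1 1] \<phi>1(2) rlt by simp
    moreover have "(\<lambda>x. ?G x - gradient \<phi>' x) =
        (\<lambda>x. 1 *\<^sub>R ((\<zeta> x *\<^sub>R ?G x + v x *\<^sub>R gradient \<zeta> x) - gradient \<phi>1 x) + 1 *\<^sub>R R x)"
      by (rule ext) (simp only: g' R_def, simp add: algebra_simps)
    then have "Lp_norm 2 \<omega> \<Omega> (\<lambda>x. ?G x - gradient \<phi>' x) < e"
      using Lp_lincomb(2)[OF assms(1) zG Rw(1), of 1 1] \<phi>1(3) Rlt by simp
    ultimately show "\<exists>\<phi>\<in>C0_infinity \<Omega>. Lp_norm 2 \<omega> \<Omega> (\<lambda>x. v x - \<phi> x) < e \<and>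
        Lp_norm 2 \<omega> \<Omega> (\<lambda>x. ?G x - gradient \<phi> x) < e"
      using \<phi>'C by blast
  qed
qed


section \<open>Muckenhoupt weights on a polytope\<close>

lemma weight_integrable_bounded:
  fixes g :: scalar
  assumes "locally_integrable_on UNIV g" "bounded U" "U \<in> sets lebesgue"
  shows "integrable (lebesgue_on U) g"
proof -
  have c: "compact (closure U)" using assms(2) by (simp add: compact_closure)
  then have "integrable (lebesgue_on (closure U)) g" using assms(1) by (simp add: locally_integrable_on_def)
  then show ?thesis
    by (rule integrable_lebesgue_on_subset) (use c assms(3) closure_subset compact_sets_lebesgue in auto)
qed

text \<open>On a ball the average of an \<open>A2\<close> weight is positive, so the other factor of the \<open>A2\<close> product
  is finite.\<close>

lemma A2_inv_integrable_ball:
  assumes "A2 \<omega>" "0 < r"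
  shows "integrable (lebesgue_on (ball x r)) (inv_weight \<omega>)"
proof -
  let ?B = "ball x r" and ?M = "lebesgue_on (ball x r)"
  have nn: "\<And>x. 0 \<le> \<omega> x" and li: "locally_integrable_on UNIV \<omega>" and pos: "AE x in lebesgue. 0 < \<omega> x"
    and sup: "(SUP (x, r) \<in> UNIV \<times> {0<..}. average (ball x r) \<omega> * average (ball x r) (inv_weight \<omega>)) < \<infinity>"
    using assms(1) by (auto simp: A2_def weight_def)
  have Bs: "?B \<in> sets lebesgue" by simp
  have i: "integrable ?M \<omega>" by (rule weight_integrable_bounded[OF li _ Bs]) simp
  have m: "\<omega> \<in> borel_measurable ?M" using i by simp
  have mi: "inv_weight \<omega> \<in> borel_measurable ?M" using m unfolding inv_weight_def by measurable
  have fin: "emeasure lebesgue ?B < \<infinity>" using emeasure_bounded_finite[of ?B] by simp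
  have p: "average ?B \<omega> * average ?B (inv_weight \<omega>) < \<infinity>"
  proof -
    have "average ?B \<omega> * average ?B (inv_weight \<omega>) \<le>
        (SUP (x, r) \<in> UNIV \<times> {0<..}. average (ball x r) \<omega> * average (ball x r) (inv_weight \<omega>))"
      by (rule SUP_upper2[of "(x, r)"]) (use assms(2) in auto)
    then show ?thesis using sup by (rule le_less_trans)
  qed
  have "(\<integral>\<^sup>+x. ennreal (\<omega> x) \<partial>?M) \<noteq> 0"
  proof
    assume "(\<integral>\<^sup>+x. ennreal (\<omega> x) \<partial>?M) = 0"
    then have "AE x in ?M. ennreal (\<omega> x) = 0"
      using m by (subst (asm) nn_integral_0_iff_AE) auto
    then have "AE y in lebesgue. y \<in> ?B \<longrightarrow> ennreal (\<omega> y) = 0"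
      by (subst (asm) AE_restrict_space_iff) auto
    with pos have "AE y in lebesgue. y \<notin> ?B" by eventually_elim auto
    then have "?B \<in> null_sets lebesgue" by (subst AE_iff_null_sets) auto
    then have "negligible ?B" by (simp add: negligible_iff_null_sets)
    then show False using open_not_negligible[of ?B] assms(2) by simp
  qed
  then have "average ?B \<omega> \<noteq> 0" using fin by (simp add: average_def ennreal_divide_eq_0_iff less_top)
  then have "average ?B (inv_weight \<omega>) < \<infinity>" using p by (auto simp: ennreal_mult_less_top)
  then have "(\<integral>\<^sup>+x. ennreal (inv_weight \<omega> x) \<partial>?M) < \<infinity>"
    using fin by (simp add: average_def less_top[symmetric] ennreal_divide_eq_top_iff)
  then show ?thesis
    using mi nn by (intro integrableI_nonneg) (auto simp: inv_weight_def)
qed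

lemma A2_on_weight_on:
  assumes "convex_polytope_domain \<Omega>" "A2_on \<Omega> \<omega>"
  shows "weight_on \<Omega> \<omega>" "bounded_near_frontier \<Omega> \<omega>" "bounded_near_frontier \<Omega> (inv_weight \<omega>)"
proof -
  have o: "open \<Omega>" using assms(1) by (simp add: convex_polytope_domain_def)
  have "bounded (closure \<Omega>)"
    using assms(1) polytope_imp_bounded by (auto simp: convex_polytope_domain_def)
  then have b: "bounded \<Omega>" using closure_subset bounded_subset by blast
  have A: "A2 \<omega>" using assms(2) by (simp add: A2_on_def)
  have nn: "\<And>x. 0 \<le> \<omega> x" and li: "locally_integrable_on UNIV \<omega>" and pos: "AE x in lebesgue. 0 < \<omega> x"
    using A by (auto simp: A2_def weight_def)
  have i: "integrable (lebesgue_on \<Omega>) \<omega>" by (rule weight_integrable_bounded[OF li b]) (simp add: o)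
  obtain r where r: "0 < r" "\<Omega> \<subseteq> ball 0 r" using bounded_subset_ballD[OF b] by blast
  have "integrable (lebesgue_on \<Omega>) (inv_weight \<omega>)"
    by (rule integrable_lebesgue_on_subset[OF A2_inv_integrable_ball[OF A r(1)]]) (use o r in auto)
  moreover have "AE x in lebesgue_on \<Omega>. 0 < \<omega> x"
    using pos o by (subst AE_restrict_space_iff) (auto elim: eventually_mono)
  ultimately show "weight_on \<Omega> \<omega>" using o b nn i by (simp add: weight_on_def)
  obtain G \<epsilon> l where G: "open G" "G \<subseteq> \<Omega>" "0 < \<epsilon>" "0 < l" "{x \<in> \<Omega>. infdist x (frontier \<Omega>) < \<epsilon>} \<subseteq> G"
      "continuous_on (closure G) \<omega>" "\<forall>x \<in> closure G. l \<le> \<omega> x"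
    using assms(2) unfolding A2_on_def by blast
  have "bounded G" using b G(2) bounded_subset by blast
  then have "compact (\<omega> ` closure G)" by (intro compact_continuous_image G(6)) (simp add: compact_closure)
  then obtain B where B: "\<And>x. x \<in> closure G \<Longrightarrow> \<bar>\<omega> x\<bar> \<le> B"
    using compact_imp_bounded[of "\<omega> ` closure G"] by (auto simp: bounded_iff)
  have G': "x \<in> closure G" if "x \<in> \<Omega>" "infdist x (frontier \<Omega>) < \<epsilon>" for x
    using that G(5) closure_subset[of G] by blast
  have "\<omega> x \<le> max B 0" if "x \<in> \<Omega>" "infdist x (frontier \<Omega>) < \<epsilon>" for x
    using B[OF G'[OF that]] by simp
  then show "bounded_near_frontier \<Omega> \<omega>"
    unfolding bounded_near_frontier_def using G(3) by (intro exI[of _ \<epsilon>] conjI exI[of _ "max B 0"]) auto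
  have "inv_weight \<omega> x \<le> inverse l" if "x \<in> \<Omega>" "infdist x (frontier \<Omega>) < \<epsilon>" for x
    using G(4,7) G'[OF that] unfolding inv_weight_def by (intro le_imp_inverse_le) auto
  then show "bounded_near_frontier \<Omega> (inv_weight \<omega>)"
    unfolding bounded_near_frontier_def using G(3,4) by (intro exI[of _ \<epsilon>] conjI exI[of _ "inverse l"]) auto
qed

section \<open>Finite element functions\<close>

lemma smooth_polynomials: "g \<in> polynomials n \<Longrightarrow> smooth g"
proof -
  assume "g \<in> polynomials n"
  then obtain c where "\<And>x. g x = (\<Sum>(i, j) \<in> {(i, j). i + j \<le> n}. c i j * (x $ 1) ^ i * (x $ 2) ^ j)"
    by (auto simp: polynomials_def)
  then have g: "g = (\<lambda>x. \<Sum>z \<in> {(i, j). i + j \<le> n}. c (fst z) (snd z) * (x $ 1) ^ fst z * (x $ 2) ^ snd z)"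
    by (auto simp: case_prod_beta)
  show "smooth g" unfolding g
    by (intro allI C_k_sum C_k_mult C_k_power C_k_const C_k_coord)
qed

lemma polynomials_lincomb:
  assumes "g \<in> polynomials n" "h \<in> polynomials n"
  shows "(\<lambda>x. a * g x + b * h x) \<in> polynomials n"
proof -
  obtain c d where c: "\<And>x. g x = (\<Sum>(i, j) \<in> {(i, j). i + j \<le> n}. c i j * (x $ 1) ^ i * (x $ 2) ^ j)"
    and d: "\<And>x. h x = (\<Sum>(i, j) \<in> {(i, j). i + j \<le> n}. d i j * (x $ 1) ^ i * (x $ 2) ^ j)"
    using assms by (auto simp: polynomials_def)
  show ?thesis unfolding polynomials_def
    by (intro CollectI exI[of _ "\<lambda>i j. a * c i j + b * d i j"])
      (auto simp: c d sum_distrib_left sum.distrib[symmetric] case_prod_beta algebra_simps intro!: sum.cong)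
qed

lemma polynomials_1_iff: "l \<in> polynomials 1 \<longleftrightarrow> (\<exists>\<alpha> n. \<forall>x. l x = \<alpha> + n \<bullet> x)"
proof -
  have S: "{(i, j). i + j \<le> (1::nat)} = {(0, 0), (1, 0), (0, 1)}" by auto
  have *: "(\<Sum>(i, j) \<in> {(i, j). i + j \<le> (1::nat)}. c i j * (x $ 1) ^ i * (x $ 2) ^ j) =
      c 0 0 + (vector [c 1 0, c 0 1] :: real^2) \<bullet> x" for c and x :: "real^2"
    unfolding S by (simp add: inner_vec_def sum_2)
  show ?thesis
  proof
    assume "l \<in> polynomials 1"
    then show "\<exists>\<alpha> n. \<forall>x. l x = \<alpha> + n \<bullet> x" unfolding polynomials_def * by blast
  next
    assume "\<exists>\<alpha> n. \<forall>x. l x = \<alpha> + n \<bullet> x"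
    then obtain \<alpha> n where l: "\<And>x. l x = \<alpha> + n \<bullet> x" by blast
    define c where "c i j = (if i = 1 then n $ 1 else if j = 1 then n $ 2 else \<alpha>)" for i j :: nat
    have "(vector [c 1 0, c 0 1] :: real^2) = n" by (simp add: c_def vec_eq_iff forall_2)
    then have "\<forall>x. l x = c 0 0 + (vector [c 1 0, c 0 1] :: real^2) \<bullet> x" using l by (simp add: c_def)
    then show "l \<in> polynomials 1" unfolding polynomials_def * by blast
  qed
qed

text \<open>An affine function on the plane is determined by its values at the vertices of a triangle, and
  these can be prescribed, because the vertices are affinely independent and span the plane.\<close>

lemma barycentric_polynomial:
  assumes "2 simplex K" "z extreme_point_of K"
  shows "barycentric K z \<in> polynomials 1"
proof -
  obtain C where C: "\<not> affine_dependent C" "int (card C) = 3" "K = convex hull C"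
    using assms(1) by (auto simp: simplex_def)
  have fin: "finite C" using C(1) aff_independent_finite by blast
  have extr: "y extreme_point_of K \<longleftrightarrow> y \<in> C" for y
    unfolding C(3) by (rule extreme_point_of_convex_hull_affine_independent[OF C(1)])
  have z: "z \<in> C" using assms(2) extr by blast
  have full: "affine hull C = UNIV"
  proof -
    have "aff_dim C = 2" using aff_dim_affine_independent[OF C(1)] C(2) by simp
    then show ?thesis using aff_dim_eq_full[of C] by simp
  qed
  have "\<exists>a. a \<in> C \<and> a \<noteq> z"
  proof (rule ccontr)
    assume "\<not> ?thesis"
    then have "C \<subseteq> {z}" by blast
    then have "card C \<le> 1" using card_mono[of "{z}" C] by simp
    then show False using C(2) by simp
  qed
  then obtain a where a: "a \<in> C" "a \<noteq> z" by blast
  have "independent ((\<lambda>x. - a + x) ` (C - {a}))" using affine_dependent_iff_dependent2[OF a(1)] C(1) by blast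
  then obtain f where f: "linear f" "\<And>x. x \<in> (\<lambda>x. - a + x) ` (C - {a}) \<Longrightarrow> f x = (if x = z - a then 1 else 0 :: real)"
    using linear_independent_extend[of "(\<lambda>x. - a + x) ` (C - {a})" "\<lambda>x. if x = z - a then 1 else 0 :: real"] by blast
  interpret f: linear f by (rule f(1))
  define l where "l x = f x - f a" for x
  have lp: "l \<in> polynomials 1"
    unfolding polynomials_1_iff
  proof (intro exI allI)
    fix x
    have "f x = adjoint f 1 \<bullet> x" using adjoint_works[OF f(1), of x 1] by (simp add: inner_commute)
    then show "l x = - f a + adjoint f 1 \<bullet> x" by (simp add: l_def)
  qed
  have lv: "l y = (if y = z then 1 else 0)" if "y \<in> C" for y
  proof (cases "y = a")
    case True
    then show ?thesis using a by (simp add: l_def)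
  next
    case False
    then have "- a + y \<in> (\<lambda>x. - a + x) ` (C - {a})" using that by blast
    then have "f (- a + y) = (if y = z then 1 else 0)" using f(2)[of "- a + y"] by (auto simp: algebra_simps)
    then show ?thesis by (simp add: l_def f.diff)
  qed
  have "\<exists>!l. l \<in> polynomials 1 \<and> (\<forall>y. y extreme_point_of K \<longrightarrow> l y = (if y = z then 1 else 0))"
  proof (rule ex1I[of _ l])
    show "l \<in> polynomials 1 \<and> (\<forall>y. y extreme_point_of K \<longrightarrow> l y = (if y = z then 1 else 0))"
      using lp lv extr by blast
    fix k assume k: "k \<in> polynomials 1 \<and> (\<forall>y. y extreme_point_of K \<longrightarrow> k y = (if y = z then 1 else 0))"
    have "(\<lambda>x. 1 * k x + (- 1) * l x) \<in> polynomials 1" using polynomials_lincomb[of k 1 l 1 "- 1"] k lp by blast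
    then have "\<exists>\<alpha> n. \<forall>x. 1 * k x + (- 1) * l x = \<alpha> + n \<bullet> x" unfolding polynomials_1_iff .
    then obtain \<alpha> n where d: "\<And>x. k x - l x = \<alpha> + n \<bullet> x" by auto
    have "C \<subseteq> {x. n \<bullet> x = - \<alpha>}"
    proof
      fix x assume "x \<in> C"
      then have "k x - l x = 0" using k extr lv by auto
      then show "x \<in> {x. n \<bullet> x = - \<alpha>}" using d[of x] by simp
    qed
    then have "affine hull C \<subseteq> {x. n \<bullet> x = - \<alpha>}" by (rule hull_minimal) (rule affine_hyperplane)
    then have "n \<bullet> x = - \<alpha>" for x using full by blast
    then have "k x = l x" for x using d[of x] by simp
    then show "k = l" by (rule ext)
  qed
  from theI'[OF this] show ?thesis unfolding barycentric_def by blast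
qed

lemma smooth_bubble:
  assumes "2 simplex K"
  shows "smooth (bubble K)"
proof
  fix k
  have "bubble K = (\<lambda>x. \<Prod>z \<in> {z. z extreme_point_of K}. barycentric K z x)" by (rule ext) (simp add: bubble_def)
  moreover have "C_k k (\<lambda>x. \<Prod>z \<in> {z. z extreme_point_of K}. barycentric K z x)"
    by (rule C_k_prod) (use smooth_polynomials[OF barycentric_polynomial[OF assms]] in simp)
  ultimately show "C_k k (bubble K)" by simp
qed

definition piecewise_smooth :: "mesh \<Rightarrow> scalar \<Rightarrow> bool" where
  "piecewise_smooth \<T> v \<longleftrightarrow> (\<forall>K\<in>\<T>. \<exists>s. smooth s \<and> (\<forall>x\<in>K. v x = s x))"

lemma partial_deriv_cong_open:
  assumes "open U" "x \<in> U" "\<And>y. y \<in> U \<Longrightarrow> v y = s y" "s differentiable (at x)"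
  shows "partial_deriv i v x = partial_deriv i s x"
proof -
  obtain D where D: "(s has_derivative D) (at x)" using assms(4) by (auto simp: differentiable_def)
  have "(v has_derivative D) (at x)"
    by (rule has_derivative_transform_within_open[OF D assms(1,2)]) (simp add: assms(3))
  then show ?thesis using has_derivative_partial_deriv D by metis
qed

text \<open>Off the edges, a null set, the weak gradient of a piecewise smooth function is its classical
  gradient, which on each triangle is the restriction of a continuous function.\<close>

lemma piecewise_smooth_weak_grad:
  assumes "open \<Omega>" "finite \<T>" "\<And>K. K \<in> \<T> \<Longrightarrow> compact K \<and> convex K" "\<Omega> \<subseteq> \<Union>\<T>"
    and "piecewise_smooth \<T> v" "has_weak_gradient \<Omega> v G"
  shows "AE x in lebesgue_on \<Omega>. G x = gradient v x" "AE x in lebesgue_on \<Omega>. isCont (gradient v) x"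
    and "\<exists>M. AE x in lebesgue_on \<Omega>. norm (G x) \<le> M"
proof -
  have "\<exists>s. \<forall>K\<in>\<T>. smooth (s K) \<and> (\<forall>x\<in>K. v x = s K x)"
    using assms(5) unfolding piecewise_smooth_def by (rule bchoice)
  then obtain s where s: "\<And>K. K \<in> \<T> \<Longrightarrow> smooth (s K)" "\<And>K x. K \<in> \<T> \<Longrightarrow> x \<in> K \<Longrightarrow> v x = s K x" by blast
  define I where "I K = interior K \<inter> \<Omega>" for K
  have I: "open (I K)" "I K \<subseteq> \<Omega>" "I K \<subseteq> K" for K
    using assms(1) interior_subset[of K] by (auto simp: I_def)
  have grad: "gradient v x = gradient (s K) x" if "K \<in> \<T>" "x \<in> I K" for K x
    unfolding vec_eq_iff
    using partial_deriv_cong_open[OF I(1) that(2), of v "s K"] s(2)[OF that(1)] I(3)[of K]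
      smooth_differentiable[OF s(1)[OF that(1)]] by auto
  have cg: "isCont (gradient (s K)) x" if "K \<in> \<T>" for K x
  proof -
    have "continuous_on UNIV (gradient (s K))"
      by (intro continuous_on_vec_lambda smooth_continuous smooth_partial_deriv s that)
    then show ?thesis by (simp add: continuous_on_eq_continuous_at)
  qed
  have cont: "isCont (gradient v) x" if "K \<in> \<T>" "x \<in> I K" for K x
  proof -
    have "\<forall>\<^sub>F y in nhds x. gradient v y = gradient (s K) y"
      using eventually_nhds_in_open[OF I(1) that(2)] by (rule eventually_mono) (rule grad[OF that(1)])
    then show ?thesis using isCont_cong[of "gradient v" "gradient (s K)" x] cg[OF that(1)] by blast
  qed
  have eqK: "AE x in lebesgue. x \<in> I K \<longrightarrow> G x = gradient v x" if K: "K \<in> \<T>" for K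
  proof -
    have h1: "has_weak_gradient (I K) v G" by (rule has_weak_gradient_subset[OF assms(1) I(1) I(2) assms(6)])
    have h2: "has_weak_gradient (I K) v (gradient (s K))"
      by (rule has_weak_gradient_cong[OF _ smooth_has_weak_gradient[OF I(1) s(1)[OF K]]])
        (use s(2)[OF K] I(3)[of K] in auto)
    have "AE x in lebesgue. x \<in> I K \<longrightarrow> G x = gradient (s K) x"
      using has_weak_gradient_unique[OF I(1) h1 h2] I(1) by (subst (asm) AE_restrict_space_iff) auto
    then show ?thesis by eventually_elim (use grad[OF K] in auto)
  qed
  have cover: "AE x in lebesgue. x \<in> \<Omega> \<longrightarrow> (\<exists>K\<in>\<T>. x \<in> I K)"
  proof -
    have "negligible (\<Union>K\<in>\<T>. frontier K)"
      using assms(2,3) by (intro negligible_Union) (auto intro: negligible_convex_frontier)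
    then have "(\<Union>K\<in>\<T>. frontier K) \<in> null_sets lebesgue" by (simp add: negligible_iff_null_sets)
    then have "AE x in lebesgue. x \<notin> (\<Union>K\<in>\<T>. frontier K)" by (rule AE_not_in)
    then show ?thesis
    proof eventually_elim
      case (elim x)
      show ?case
      proof
        assume x: "x \<in> \<Omega>"
        then obtain K where K: "K \<in> \<T>" "x \<in> K" using assms(4) by blast
        then have "x \<in> interior K"
          using elim assms(3)[OF K(1)] by (auto simp: frontier_def compact_imp_closed)
        then show "\<exists>K\<in>\<T>. x \<in> I K" using K x by (auto simp: I_def)
      qed
    qed
  qed
  have on: "AE x in lebesgue_on \<Omega>. P x" if "AE x in lebesgue. x \<in> \<Omega> \<longrightarrow> P x" for P
    using that assms(1) by (subst AE_restrict_space_iff) auto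
  have all: "AE x in lebesgue. \<forall>K\<in>\<T>. x \<in> I K \<longrightarrow> G x = gradient v x"
    using assms(2) eqK by (subst AE_finite_all) auto
  show eq: "AE x in lebesgue_on \<Omega>. G x = gradient v x"
    by (rule on) (use all cover in eventually_elim, auto)
  show "AE x in lebesgue_on \<Omega>. isCont (gradient v) x"
    by (rule on) (use cover in eventually_elim, use cont in auto)
  have "\<exists>M. \<forall>x\<in>K. norm (gradient (s K) x) \<le> M" if "K \<in> \<T>" for K
  proof -
    have "continuous_on K (gradient (s K))"
      by (intro continuous_on_vec_lambda smooth_continuous smooth_partial_deriv s that)
    then have "compact (gradient (s K) ` K)" using assms(3)[OF that] by (intro compact_continuous_image) auto
    then show ?thesis using compact_imp_bounded[of "gradient (s K) ` K"] by (auto simp: bounded_iff)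
  qed
  then have "\<exists>M. \<forall>K\<in>\<T>. \<forall>x\<in>K. norm (gradient (s K) x) \<le> M K" by (intro bchoice ballI)
  then obtain M where M: "\<And>K x. K \<in> \<T> \<Longrightarrow> x \<in> K \<Longrightarrow> norm (gradient (s K) x) \<le> M K" by blast
  have "AE x in lebesgue_on \<Omega>. norm (G x) \<le> (\<Sum>K\<in>\<T>. \<bar>M K\<bar>)"
  proof (rule on, use all cover in eventually_elim, rule impI)
    fix x assume a: "\<forall>K\<in>\<T>. x \<in> I K \<longrightarrow> G x = gradient v x" "x \<in> \<Omega> \<longrightarrow> (\<exists>K\<in>\<T>. x \<in> I K)" "x \<in> \<Omega>"
    then obtain K where K: "K \<in> \<T>" "x \<in> I K" by blast
    then have "G x = gradient (s K) x" using a(1) grad[OF K] by auto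
    moreover have "x \<in> K" using K(2) I(3) by blast
    ultimately have "norm (G x) \<le> \<bar>M K\<bar>" using M[OF K(1)] by fastforce
    also have "\<dots> \<le> (\<Sum>K\<in>\<T>. \<bar>M K\<bar>)" by (rule member_le_sum[OF K(1) _ assms(2)]) simp
    finally show "norm (G x) \<le> (\<Sum>K\<in>\<T>. \<bar>M K\<bar>)" .
  qed
  then show "\<exists>M. AE x in lebesgue_on \<Omega>. norm (G x) \<le> M" by blast
qed

lemma mesh_properties:
  assumes "mesh_family \<Omega> TT" "\<T> \<in> TT"
  shows "finite \<T>" "\<And>K. K \<in> \<T> \<Longrightarrow> compact K \<and> convex K" "\<Omega> \<subseteq> \<Union>\<T>" "\<And>K. K \<in> \<T> \<Longrightarrow> 2 simplex K"
proof -
  have c: "conforming_mesh \<Omega> \<T>" using assms by (simp add: mesh_family_def)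
  show "finite \<T>" using c by (simp add: conforming_mesh_def triangulation_def)
  show s: "\<And>K. K \<in> \<T> \<Longrightarrow> 2 simplex K" using c by (simp add: conforming_mesh_def)
  show "\<Omega> \<subseteq> \<Union>\<T>" using c closure_subset[of \<Omega>] by (simp add: conforming_mesh_def)
  show "\<And>K. K \<in> \<T> \<Longrightarrow> compact K \<and> convex K" using s simplex_imp_polytope polytope_imp_compact polytope_imp_convex by blast
qed

lemma velocity_piecewise_smooth:
  assumes "mesh_family \<Omega> TT" "\<T> \<in> TT" "V = mini_velocity \<Omega> \<or> V = taylor_hood_velocity \<Omega>" "v \<in> V \<T>"
  shows "piecewise_smooth \<T> (\<lambda>x. v x $ i)"
  unfolding piecewise_smooth_def
proof
  fix K assume K: "K \<in> \<T>"
  note simplex = mesh_properties(4)[OF assms(1,2) K]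
  from assms(3) show "\<exists>s. smooth s \<and> (\<forall>x\<in>K. v x $ i = s x)"
  proof
    assume "V = mini_velocity \<Omega>"
    then obtain g \<beta> where g: "g \<in> polynomials 1" "\<forall>x\<in>K. v x $ i = g x + \<beta> * bubble K x"
      using assms(4) K unfolding mini_velocity_def by blast
    have "smooth (\<lambda>x. g x + \<beta> * bubble K x)"
      using C_k_add C_k_cmult smooth_polynomials[OF g(1)] smooth_bubble[OF simplex] by blast
    then show ?thesis using g(2) by blast
  next
    assume "V = taylor_hood_velocity \<Omega>"
    then obtain g where g: "g \<in> polynomials 2" "\<forall>x\<in>K. v x $ i = g x"
      using assms(4) K unfolding taylor_hood_velocity_def by blast
    then show ?thesis using smooth_polynomials by blast
  qed
qed

lemma velocity_basic:
  assumes "V = mini_velocity \<Omega> \<or> V = taylor_hood_velocity \<Omega>" "v \<in> V \<T>"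
  shows "v \<in> H10_vec (\<lambda>_. 1) \<Omega>" "continuous_on (closure \<Omega>) v"
  using assms unfolding mini_velocity_def taylor_hood_velocity_def by auto

lemma velocity_H10_vec:
  assumes "weight_on \<Omega> \<omega>" "bounded_near_frontier \<Omega> \<omega>" "mesh_family \<Omega> TT" "\<T> \<in> TT"
    and "V = mini_velocity \<Omega> \<or> V = taylor_hood_velocity \<Omega>" "v \<in> V \<T>"
  shows "v \<in> H10_vec \<omega> \<Omega>"
  unfolding H10_vec_def
proof (intro CollectI allI)
  fix i
  note w = weight_onD[OF assms(1)]
  have H: "(\<lambda>x. v x $ i) \<in> H10 (\<lambda>_. 1) \<Omega>" using velocity_basic(1)[OF assms(5,6)] by (simp add: H10_vec_def)
  note g = H1_weak_grad(2)[OF weight_on_1[OF w(1,2)] H10_H1[OF H]]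
  note p = piecewise_smooth_weak_grad[OF w(1) mesh_properties(1-3)[OF assms(3,4)]
      velocity_piecewise_smooth[OF assms(3-6), of i] g]
  obtain M where M: "AE x in lebesgue_on \<Omega>. norm (weak_grad \<Omega> (\<lambda>x. v x $ i) x) \<le> M" using p(3) by blast
  have c: "continuous_on (closure \<Omega>) (\<lambda>x. v x $ i)"
    using velocity_basic(2)[OF assms(5,6)] by (intro continuous_intros)
  show "(\<lambda>x. v x $ i) \<in> H10 \<omega> \<Omega>" by (rule H10_change_weight[OF assms(1,2) H c p(1,2) M])
qed

lemma velocity_lincomb:
  assumes "weight_on \<Omega> \<omega>" "V = mini_velocity \<Omega> \<or> V = taylor_hood_velocity \<Omega>" "v \<in> V \<T>" "w \<in> V \<T>"
  shows "lincomb a v b w \<in> V \<T>"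
proof -
  note W = weight_on_1[OF weight_onD(1,2)[OF assms(1)]]
  have 1: "lincomb a v b w \<in> H10_vec (\<lambda>_. 1) \<Omega>"
    by (rule H10_vec_lincomb[OF W velocity_basic(1)[OF assms(2,3)] velocity_basic(1)[OF assms(2,4)]])
  have 2: "continuous_on (closure \<Omega>) (lincomb a v b w)"
    unfolding lincomb_def by (intro continuous_intros velocity_basic(2)[OF assms(2,3)] velocity_basic(2)[OF assms(2,4)])
  from assms(2) show ?thesis
  proof
    assume V: "V = mini_velocity \<Omega>"
    have "\<exists>g \<in> polynomials 1. \<exists>\<beta>. \<forall>x \<in> K. lincomb a v b w x $ i = g x + \<beta> * bubble K x" if K: "K \<in> \<T>" for K i
    proof -
      obtain g \<beta> where g: "g \<in> polynomials 1" "\<forall>x\<in>K. v x $ i = g x + \<beta> * bubble K x"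
        using assms(3) K unfolding V mini_velocity_def by blast
      obtain h \<gamma> where h: "h \<in> polynomials 1" "\<forall>x\<in>K. w x $ i = h x + \<gamma> * bubble K x"
        using assms(4) K unfolding V mini_velocity_def by blast
      show ?thesis
        using polynomials_lincomb[OF g(1) h(1), of a b] g(2) h(2)
        by (intro bexI[of _ "\<lambda>x. a * g x + b * h x"] exI[of _ "a * \<beta> + b * \<gamma>"])
          (auto simp: lincomb_def algebra_simps)
    qed
    then show ?thesis using 1 2 unfolding V mini_velocity_def by blast
  next
    assume V: "V = taylor_hood_velocity \<Omega>"
    have "\<exists>g \<in> polynomials 2. \<forall>x \<in> K. lincomb a v b w x $ i = g x" if K: "K \<in> \<T>" for K i
    proof -
      obtain g where g: "g \<in> polynomials 2" "\<forall>x\<in>K. v x $ i = g x"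
        using assms(3) K unfolding V taylor_hood_velocity_def by blast
      obtain h where h: "h \<in> polynomials 2" "\<forall>x\<in>K. w x $ i = h x"
        using assms(4) K unfolding V taylor_hood_velocity_def by blast
      show ?thesis
        using polynomials_lincomb[OF g(1) h(1), of a b] g(2) h(2)
        by (intro bexI[of _ "\<lambda>x. a * g x + b * h x"]) (auto simp: lincomb_def)
    qed
    then show ?thesis using 1 2 unfolding V taylor_hood_velocity_def by blast
  qed
qed

lemma L2_zero_mean_lincomb:
  assumes "weight_on \<Omega> \<omega>" "p \<in> L2_zero_mean \<omega> \<Omega>" "q \<in> L2_zero_mean \<omega> \<Omega>"
  shows "lincomb a p b q \<in> L2_zero_mean \<omega> \<Omega>"
proof -
  have L: "p \<in> Lp 2 \<omega> \<Omega>" "q \<in> Lp 2 \<omega> \<Omega>" and z: "(LINT x|lebesgue_on \<Omega>. p x) = 0" "(LINT x|lebesgue_on \<Omega>. q x) = 0"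
    using assms(2,3) by (simp_all add: L2_zero_mean_def)
  have "(LINT x|lebesgue_on \<Omega>. a *\<^sub>R p x + b *\<^sub>R q x) = 0"
    using z Lp_integrable(1)[OF assms(1) L(1)] Lp_integrable(1)[OF assms(1) L(2)] by simp
  then show ?thesis
    using Lp_lincomb(1)[OF assms(1) L, of a b] by (simp add: L2_zero_mean_def lincomb_def)
qed

lemma pressure_lincomb:
  assumes "weight_on \<Omega> \<omega>" "p \<in> pressure_space \<Omega> \<T>" "q \<in> pressure_space \<Omega> \<T>"
  shows "lincomb a p b q \<in> pressure_space \<Omega> \<T>"
proof -
  note W = weight_on_1[OF weight_onD(1,2)[OF assms(1)]]
  have 1: "lincomb a p b q \<in> L2_zero_mean (\<lambda>_. 1) \<Omega>"
    using assms(2,3) by (intro L2_zero_mean_lincomb[OF W]) (simp_all add: pressure_space_def)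
  have 2: "continuous_on (closure \<Omega>) (lincomb a p b q)"
    using assms(2,3) unfolding lincomb_def by (intro continuous_intros) (simp_all add: pressure_space_def)
  have "\<exists>g \<in> polynomials 1. \<forall>x \<in> K. lincomb a p b q x = g x" if K: "K \<in> \<T>" for K
  proof -
    obtain g where g: "g \<in> polynomials 1" "\<forall>x\<in>K. p x = g x"
      using assms(2) K unfolding pressure_space_def by blast
    obtain h where h: "h \<in> polynomials 1" "\<forall>x\<in>K. q x = h x"
      using assms(3) K unfolding pressure_space_def by blast
    show ?thesis
      using polynomials_lincomb[OF g(1) h(1), of a b] g(2) h(2)
      by (intro bexI[of _ "\<lambda>x. a * g x + b * h x"]) (auto simp: lincomb_def)
  qed
  then show ?thesis using 1 2 unfolding pressure_space_def by blast
qed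

lemma pressure_L2_zero_mean:
  assumes "weight_on \<Omega> \<omega>" "q \<in> pressure_space \<Omega> \<T>"
  shows "q \<in> L2_zero_mean \<omega> \<Omega>"
proof -
  note w = weight_onD[OF assms(1)]
  have q: "q \<in> L2_zero_mean (\<lambda>_. 1) \<Omega>" "continuous_on (closure \<Omega>) q"
    using assms(2) by (simp_all add: pressure_space_def)
  have "compact (q ` closure \<Omega>)" using w(2) by (intro compact_continuous_image q) (simp add: compact_closure)
  then obtain B where B: "\<And>x. x \<in> closure \<Omega> \<Longrightarrow> norm (q x) \<le> B"
    using compact_imp_bounded[of "q ` closure \<Omega>"] by (auto simp: bounded_iff)
  have "q \<in> Lp 2 \<omega> \<Omega>"
  proof (rule bounded_in_Lp[OF assms(1)])
    show "q \<in> borel_measurable (lebesgue_on \<Omega>)" using q(1) LpD(1) by (auto simp: L2_zero_mean_def)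
    show "norm (q x) \<le> B" if "x \<in> \<Omega>" for x using B that closure_subset[of \<Omega>] by (meson subsetD)
  qed
  then show ?thesis using q(1) by (simp add: L2_zero_mean_def)
qed


section \<open>The forms on the weighted spaces\<close>

lemma lincomb_diff: "lincomb 1 v (- 1) w = (\<lambda>x. v x - w x)"
  by (rule ext) (simp add: lincomb_def)

lemma a_form_integrable:
  assumes "weight_on \<Omega> \<omega>" "w \<in> H10_vec \<omega> \<Omega>" "v \<in> H10_vec (inv_weight \<omega>) \<Omega>"
  shows "integrable (lebesgue_on \<Omega>) (\<lambda>x. grad \<Omega> w x \<bullet> grad \<Omega> v x)"
    and "integrable (lebesgue_on \<Omega>) (\<lambda>x. w x \<bullet> v x)"
    and "\<bar>a_form \<Omega> w v\<bar> \<le> grad_norm \<omega> \<Omega> w * grad_norm (inv_weight \<omega>) \<Omega> v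
      + Lp_norm 2 \<omega> \<Omega> w * Lp_norm 2 (inv_weight \<omega>) \<Omega> v"
proof -
  note w = H10_vec_Lp[OF assms(1,2)] and v = H10_vec_Lp[OF weight_on_inv[OF assms(1)] assms(3)]
  have m: "(\<lambda>x. grad \<Omega> w x \<bullet> grad \<Omega> v x) \<in> borel_measurable (lebesgue_on \<Omega>)"
    "(\<lambda>x. w x \<bullet> v x) \<in> borel_measurable (lebesgue_on \<Omega>)"
    using LpD(1)[OF w(1)] LpD(1)[OF w(2)] LpD(1)[OF v(1)] LpD(1)[OF v(2)] by simp_all
  note p1 = Lp_pairing_bound[OF assms(1) w(2) v(2) m(1) Cauchy_Schwarz_ineq2]
  note p2 = Lp_pairing_bound[OF assms(1) w(1) v(1) m(2) Cauchy_Schwarz_ineq2]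
  show "integrable (lebesgue_on \<Omega>) (\<lambda>x. grad \<Omega> w x \<bullet> grad \<Omega> v x)" "integrable (lebesgue_on \<Omega>) (\<lambda>x. w x \<bullet> v x)"
    by (rule p1(1), rule p2(1))
  have "a_form \<Omega> w v = (LINT x|lebesgue_on \<Omega>. grad \<Omega> w x \<bullet> grad \<Omega> v x) + (LINT x|lebesgue_on \<Omega>. w x \<bullet> v x)"
    unfolding a_form_def by (rule Bochner_Integration.integral_add[OF p1(1) p2(1)])
  then show "\<bar>a_form \<Omega> w v\<bar> \<le> grad_norm \<omega> \<Omega> w * grad_norm (inv_weight \<omega>) \<Omega> v
      + Lp_norm 2 \<omega> \<Omega> w * Lp_norm 2 (inv_weight \<omega>) \<Omega> v"
    using p1(2) p2(2) by (simp add: grad_norm_def)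
qed

lemma a_form_commute: "a_form \<Omega> w v = a_form \<Omega> v w"
  by (simp add: a_form_def inner_commute)

lemma a_form_lincomb_left:
  assumes "weight_on \<Omega> \<omega>" "w \<in> H10_vec \<omega> \<Omega>" "w' \<in> H10_vec \<omega> \<Omega>" "v \<in> H10_vec (inv_weight \<omega>) \<Omega>"
  shows "a_form \<Omega> (lincomb a w b w') v = a * a_form \<Omega> w v + b * a_form \<Omega> w' v"
proof -
  note L = H10_vec_lincomb[OF assms(1-3), of a b]
  note i = a_form_integrable[OF assms(1) L assms(4)] a_form_integrable[OF assms(1,2,4)]
    a_form_integrable[OF assms(1,3,4)]
  have "a_form \<Omega> (lincomb a w b w') v = (LINT x|lebesgue_on \<Omega>.
      a * (grad \<Omega> w x \<bullet> grad \<Omega> v x + w x \<bullet> v x) + b * (grad \<Omega> w' x \<bullet> grad \<Omega> v x + w' x \<bullet> v x))"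
    unfolding a_form_def
  proof (rule integral_cong_AE)
    show "(\<lambda>x. grad \<Omega> (lincomb a w b w') x \<bullet> grad \<Omega> v x + lincomb a w b w' x \<bullet> v x) \<in> borel_measurable (lebesgue_on \<Omega>)"
      using i(1,2) by simp
    show "(\<lambda>x. a * (grad \<Omega> w x \<bullet> grad \<Omega> v x + w x \<bullet> v x) + b * (grad \<Omega> w' x \<bullet> grad \<Omega> v x + w' x \<bullet> v x)) \<in> borel_measurable (lebesgue_on \<Omega>)"
      using i(4,5,7,8) by simp
    show "AE x in lebesgue_on \<Omega>. grad \<Omega> (lincomb a w b w') x \<bullet> grad \<Omega> v x + lincomb a w b w' x \<bullet> v x =
        a * (grad \<Omega> w x \<bullet> grad \<Omega> v x + w x \<bullet> v x) + b * (grad \<Omega> w' x \<bullet> grad \<Omega> v x + w' x \<bullet> v x)"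
      using grad_lincomb_AE[OF assms(1-3), of a b]
    proof eventually_elim
      case (elim x)
      then show ?case by (simp add: lincomb_def inner_add_left algebra_simps)
    qed
  qed
  also have "\<dots> = a * a_form \<Omega> w v + b * a_form \<Omega> w' v"
    unfolding a_form_def using i(4,5,7,8) by simp
  finally show ?thesis .
qed

lemma a_form_lincomb_right:
  assumes "weight_on \<Omega> \<omega>" "w \<in> H10_vec \<omega> \<Omega>" "v \<in> H10_vec (inv_weight \<omega>) \<Omega>" "v' \<in> H10_vec (inv_weight \<omega>) \<Omega>"
  shows "a_form \<Omega> w (lincomb a v b v') = a * a_form \<Omega> w v + b * a_form \<Omega> w v'"
  using a_form_lincomb_left[OF weight_on_inv[OF assms(1)] assms(3,4), of w a b] assms(2)
  by (simp add: a_form_commute[of \<Omega> w])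

lemma abs_trace_le: "\<bar>trace (A :: real^2^2)\<bar> \<le> 2 * norm A"
proof -
  have "\<bar>A $ i $ i\<bar> \<le> norm A" for i
    using component_le_norm_cart[of "A $ i" i] Finite_Cartesian_Product.norm_nth_le[of A i] by simp
  from this[of 1] this[of 2] show ?thesis by (simp add: trace_def sum_2)
qed

lemma b_form_bound:
  assumes "weight_on \<Omega> \<omega>" "v \<in> H10_vec (inv_weight \<omega>) \<Omega>" "q \<in> Lp 2 \<omega> \<Omega>"
  shows "integrable (lebesgue_on \<Omega>) (\<lambda>x. q x * divergence \<Omega> v x)"
    and "\<bar>b_form \<Omega> v q\<bar> \<le> 2 * (Lp_norm 2 \<omega> \<Omega> q * grad_norm (inv_weight \<omega>) \<Omega> v)"
proof -
  note v = H10_vec_Lp(2)[OF weight_on_inv[OF assms(1)] assms(2)]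
  have c: "(\<lambda>x. grad \<Omega> v x $ i $ j) \<in> borel_measurable (lebesgue_on \<Omega>)" for i j
  proof -
    have "(\<lambda>A :: real^2^2. A $ i $ j) \<in> borel_measurable borel"
      by (intro borel_measurable_continuous_onI continuous_intros)
    from measurable_compose[OF LpD(1)[OF v] this] show ?thesis .
  qed
  have m: "divergence \<Omega> v \<in> borel_measurable (lebesgue_on \<Omega>)"
    using borel_measurable_add[OF c[of 1 1] c[of 2 2]] by (simp add: divergence_def[abs_def] trace_def sum_2)
  have d: "divergence \<Omega> v \<in> Lp 2 (inv_weight \<omega>) \<Omega>"
      "Lp_norm 2 (inv_weight \<omega>) \<Omega> (divergence \<Omega> v) \<le> 2 * grad_norm (inv_weight \<omega>) \<Omega> v"
  proof -
    have "AE x in lebesgue_on \<Omega>. norm (divergence \<Omega> v x) \<le> 2 * norm (grad \<Omega> v x)"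
      by (intro AE_I2) (simp add: divergence_def abs_trace_le)
    from Lp_norm_mono[OF weight_on_inv[OF assms(1)] v m this]
    show "divergence \<Omega> v \<in> Lp 2 (inv_weight \<omega>) \<Omega>"
      "Lp_norm 2 (inv_weight \<omega>) \<Omega> (divergence \<Omega> v) \<le> 2 * grad_norm (inv_weight \<omega>) \<Omega> v"
      by (simp_all add: grad_norm_def)
  qed
  have mm: "(\<lambda>x. q x * divergence \<Omega> v x) \<in> borel_measurable (lebesgue_on \<Omega>)"
    by (rule borel_measurable_times[OF LpD(1)[OF assms(3)] m])
  have le: "\<bar>q x * divergence \<Omega> v x\<bar> \<le> norm (q x) * norm (divergence \<Omega> v x)" for x by (simp add: abs_mult)
  note p = Lp_pairing_bound[OF assms(1,3) d(1) mm le]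
  show "integrable (lebesgue_on \<Omega>) (\<lambda>x. q x * divergence \<Omega> v x)" by (rule p(1))
  have "\<bar>b_form \<Omega> v q\<bar> \<le> Lp_norm 2 \<omega> \<Omega> q * Lp_norm 2 (inv_weight \<omega>) \<Omega> (divergence \<Omega> v)"
    using p(2) by (simp add: b_form_def)
  also have "\<dots> \<le> Lp_norm 2 \<omega> \<Omega> q * (2 * grad_norm (inv_weight \<omega>) \<Omega> v)"
    by (rule mult_left_mono[OF d(2) Lp_norm_ge_0[OF assms(1)]])
  finally show "\<bar>b_form \<Omega> v q\<bar> \<le> 2 * (Lp_norm 2 \<omega> \<Omega> q * grad_norm (inv_weight \<omega>) \<Omega> v)" by simp
qed

lemma b_form_lincomb_right:
  assumes "weight_on \<Omega> \<omega>" "v \<in> H10_vec (inv_weight \<omega>) \<Omega>" "q \<in> Lp 2 \<omega> \<Omega>" "q' \<in> Lp 2 \<omega> \<Omega>"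
  shows "b_form \<Omega> v (lincomb a q b q') = a * b_form \<Omega> v q + b * b_form \<Omega> v q'"
proof -
  note i = b_form_bound(1)[OF assms(1,2,3)] b_form_bound(1)[OF assms(1,2,4)]
  have "b_form \<Omega> v (lincomb a q b q') =
      - (LINT x|lebesgue_on \<Omega>. a * (q x * divergence \<Omega> v x) + b * (q' x * divergence \<Omega> v x))"
    by (simp add: b_form_def lincomb_def algebra_simps)
  also have "\<dots> = a * b_form \<Omega> v q + b * b_form \<Omega> v q'"
    unfolding b_form_def using i by simp
  finally show ?thesis .
qed

lemma b_form_lincomb_left:
  assumes "weight_on \<Omega> \<omega>" "v \<in> H10_vec (inv_weight \<omega>) \<Omega>" "v' \<in> H10_vec (inv_weight \<omega>) \<Omega>" "q \<in> Lp 2 \<omega> \<Omega>"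
  shows "b_form \<Omega> (lincomb a v b v') q = a * b_form \<Omega> v q + b * b_form \<Omega> v' q"
proof -
  note L = H10_vec_lincomb[OF weight_on_inv[OF assms(1)] assms(2,3), of a b]
  note i = b_form_bound(1)[OF assms(1,2,4)] b_form_bound(1)[OF assms(1,3,4)] b_form_bound(1)[OF assms(1) L assms(4)]
  have "(LINT x|lebesgue_on \<Omega>. q x * divergence \<Omega> (lincomb a v b v') x) =
      (LINT x|lebesgue_on \<Omega>. a * (q x * divergence \<Omega> v x) + b * (q x * divergence \<Omega> v' x))"
  proof (rule integral_cong_AE)
    show "(\<lambda>x. q x * divergence \<Omega> (lincomb a v b v') x) \<in> borel_measurable (lebesgue_on \<Omega>)" using i(3) by simp
    show "(\<lambda>x. a * (q x * divergence \<Omega> v x) + b * (q x * divergence \<Omega> v' x)) \<in> borel_measurable (lebesgue_on \<Omega>)"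
      using i(1,2) by simp
    show "AE x in lebesgue_on \<Omega>. q x * divergence \<Omega> (lincomb a v b v') x =
        a * (q x * divergence \<Omega> v x) + b * (q x * divergence \<Omega> v' x)"
      using grad_lincomb_AE[OF weight_on_inv[OF assms(1)] assms(2,3), of a b]
    proof eventually_elim
      case (elim x)
      then show ?case by (simp add: divergence_def trace_def sum_2 algebra_simps)
    qed
  qed
  then have "b_form \<Omega> (lincomb a v b v') q = - (LINT x|lebesgue_on \<Omega>. a * (q x * divergence \<Omega> v x) + b * (q x * divergence \<Omega> v' x))"
    by (simp add: b_form_def)
  also have "\<dots> = a * b_form \<Omega> v q + b * b_form \<Omega> v' q" unfolding b_form_def using i(1,2) by simp
  finally show ?thesis .
qed

section \<open>The nonlinear terms\<close>

lemma norm_tensor: "norm (tensor y z) = norm y * norm z"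
proof (rule power2_eq_imp_eq)
  have "(norm (tensor y z))\<^sup>2 = (norm y)\<^sup>2 * (norm z)\<^sup>2"
    by (simp add: norm_vec_squared tensor_def sum_2 power_mult_distrib algebra_simps)
  then show "(norm (tensor y z))\<^sup>2 = (norm y * norm z)\<^sup>2" by (simp add: power_mult_distrib)
qed auto

lemma tensor_diff_bound:
  "norm (tensor y y - tensor z z) \<le> norm y * norm (y - z) + norm z * norm (y - z)"
proof -
  have "tensor y y - tensor z z = tensor (y - z) y + tensor z (y - z)"
    by (simp add: vec_eq_iff tensor_def algebra_simps)
  then have "norm (tensor y y - tensor z z) \<le> norm (tensor (y - z) y) + norm (tensor z (y - z))"
    using norm_triangle_ineq by metis
  then show ?thesis by (simp add: norm_tensor mult.commute)
qed

lemma norm_scaleR_self_diff_bound: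
  fixes y z :: "'a::real_normed_vector"
  shows "norm (norm y *\<^sub>R y - norm z *\<^sub>R z) \<le> norm y * norm (y - z) + norm z * norm (y - z)"
proof -
  have "norm y *\<^sub>R y - norm z *\<^sub>R z = norm y *\<^sub>R (y - z) + (norm y - norm z) *\<^sub>R z"
    by (simp add: algebra_simps)
  then have "norm (norm y *\<^sub>R y - norm z *\<^sub>R z) \<le> norm y * norm (y - z) + \<bar>norm y - norm z\<bar> * norm z"
    using norm_triangle_ineq[of "norm y *\<^sub>R (y - z)" "(norm y - norm z) *\<^sub>R z"] by simp
  also have "\<bar>norm y - norm z\<bar> * norm z \<le> norm (y - z) * norm z"
    by (intro mult_right_mono norm_triangle_ineq3) simp
  finally show ?thesis by (simp add: mult.commute)
qed

lemma measurable_tensor: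
  assumes "u \<in> borel_measurable M"
  shows "(\<lambda>x. tensor (u x) (u x)) \<in> borel_measurable M"
proof -
  have "(\<lambda>y. tensor y y) \<in> borel_measurable borel"
    unfolding tensor_def by (intro borel_measurable_continuous_onI continuous_intros)
  from measurable_compose[OF assms this] show ?thesis .
qed

text \<open>The two quadratic expressions \<open>u \<otimes> u\<close> and \<open>\<bar>u\<bar> u\<close> have the same local Lipschitz bound, so that one
  \<open>L\<^sup>2\<close> function \<open>h\<close> dominates both differences.\<close>

lemma nonlinear_difference_bound:
  assumes "weight_on \<Omega> \<omega>" "v \<in> H10_vec (inv_weight \<omega>) \<Omega>"
    and "u \<in> Lp 4 \<omega> \<Omega>" "w \<in> Lp 4 \<omega> \<Omega>" "(\<lambda>x. u x - w x) \<in> Lp 4 \<omega> \<Omega>"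
  shows "\<bar>(c_form \<Omega> u u v + d_form \<Omega> u u v) - (c_form \<Omega> w w v + d_form \<Omega> w w v)\<bar> \<le>
    (Lp_norm 4 \<omega> \<Omega> u + Lp_norm 4 \<omega> \<Omega> w) * Lp_norm 4 \<omega> \<Omega> (\<lambda>x. u x - w x) *
      (grad_norm (inv_weight \<omega>) \<Omega> v + Lp_norm 2 (inv_weight \<omega>) \<Omega> v)"
proof -
  note v = H10_vec_Lp[OF weight_on_inv[OF assms(1)] assms(2)]
  have mu: "u \<in> borel_measurable (lebesgue_on \<Omega>)" "w \<in> borel_measurable (lebesgue_on \<Omega>)"
    "v \<in> borel_measurable (lebesgue_on \<Omega>)" "grad \<Omega> v \<in> borel_measurable (lebesgue_on \<Omega>)"
    using LpD(1)[OF assms(3)] LpD(1)[OF assms(4)] LpD(1)[OF v(1)] LpD(1)[OF v(2)] .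
  define h where "h x = 1 *\<^sub>R (norm (u x) * norm (u x - w x)) + 1 *\<^sub>R (norm (w x) * norm (u x - w x))" for x
  note t1 = Lp_4_times[OF assms(1,3,5)] and t2 = Lp_4_times[OF assms(1,4,5)]
  have hL: "h \<in> Lp 2 \<omega> \<Omega>" unfolding h_def by (rule Lp_lincomb(1)[OF assms(1) t1(1) t2(1)])
  have h: "Lp_norm 2 \<omega> \<Omega> h \<le> (Lp_norm 4 \<omega> \<Omega> u + Lp_norm 4 \<omega> \<Omega> w) * Lp_norm 4 \<omega> \<Omega> (\<lambda>x. u x - w x)"
    using Lp_lincomb(2)[OF assms(1) t1(1) t2(1), of 1 1] t1(2) t2(2) by (simp add: h_def[abs_def] distrib_right)
  have h0: "0 \<le> h x" for x by (simp add: h_def)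
  have ci: "integrable (lebesgue_on \<Omega>) (\<lambda>x. tensor (z x) (z x) \<bullet> grad \<Omega> v x)"
      "integrable (lebesgue_on \<Omega>) (\<lambda>x. norm (z x) * (z x \<bullet> v x))" if z: "z \<in> Lp 4 \<omega> \<Omega>" for z
  proof -
    have m: "(\<lambda>x. tensor (z x) (z x) \<bullet> grad \<Omega> v x) \<in> borel_measurable (lebesgue_on \<Omega>)"
        "(\<lambda>x. norm (z x) * (z x \<bullet> v x)) \<in> borel_measurable (lebesgue_on \<Omega>)"
      using measurable_tensor[OF LpD(1)[OF z]] LpD(1)[OF z] mu by simp_all
    have l1: "\<bar>tensor (z x) (z x) \<bullet> grad \<Omega> v x\<bar> \<le> norm (norm (z x) * norm (z x)) * norm (grad \<Omega> v x)" for x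
      using Cauchy_Schwarz_ineq2[of "tensor (z x) (z x)" "grad \<Omega> v x"] by (simp add: norm_tensor)
    have l2: "\<bar>norm (z x) * (z x \<bullet> v x)\<bar> \<le> norm (norm (z x) * norm (z x)) * norm (v x)" for x
      using mult_left_mono[OF Cauchy_Schwarz_ineq2[of "z x" "v x"] norm_ge_zero[of "z x"]] by (simp add: abs_mult mult.assoc)
    note t = Lp_4_times(1)[OF assms(1) z z]
    show "integrable (lebesgue_on \<Omega>) (\<lambda>x. tensor (z x) (z x) \<bullet> grad \<Omega> v x)"
      "integrable (lebesgue_on \<Omega>) (\<lambda>x. norm (z x) * (z x \<bullet> v x))"
      by (rule Lp_pairing_bound(1)[OF assms(1) t v(2) m(1) l1], rule Lp_pairing_bound(1)[OF assms(1) t v(1) m(2) l2])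
  qed
  have "c_form \<Omega> u u v - c_form \<Omega> w w v =
      - (LINT x|lebesgue_on \<Omega>. (tensor (u x) (u x) - tensor (w x) (w x)) \<bullet> grad \<Omega> v x)"
    unfolding c_form_def inner_diff_left using ci(1)[OF assms(3)] ci(1)[OF assms(4)] by simp
  moreover have "\<bar>LINT x|lebesgue_on \<Omega>. (tensor (u x) (u x) - tensor (w x) (w x)) \<bullet> grad \<Omega> v x\<bar> \<le>
      Lp_norm 2 \<omega> \<Omega> h * grad_norm (inv_weight \<omega>) \<Omega> v"
    unfolding grad_norm_def
  proof (rule Lp_pairing_bound(2)[OF assms(1) hL v(2)])
    show "(\<lambda>x. (tensor (u x) (u x) - tensor (w x) (w x)) \<bullet> grad \<Omega> v x) \<in> borel_measurable (lebesgue_on \<Omega>)"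
      using measurable_tensor[OF mu(1)] measurable_tensor[OF mu(2)] mu by simp
    fix x
    have "\<bar>(tensor (u x) (u x) - tensor (w x) (w x)) \<bullet> grad \<Omega> v x\<bar> \<le> norm (tensor (u x) (u x) - tensor (w x) (w x)) * norm (grad \<Omega> v x)"
      by (rule Cauchy_Schwarz_ineq2)
    also have "\<dots> \<le> norm (h x) * norm (grad \<Omega> v x)"
      using tensor_diff_bound[of "u x" "w x"] h0[of x] by (intro mult_right_mono) (simp_all add: h_def)
    finally show "\<bar>(tensor (u x) (u x) - tensor (w x) (w x)) \<bullet> grad \<Omega> v x\<bar> \<le> norm (h x) * norm (grad \<Omega> v x)" .
  qed
  moreover have "d_form \<Omega> u u v - d_form \<Omega> w w v =
      (LINT x|lebesgue_on \<Omega>. (norm (u x) *\<^sub>R u x - norm (w x) *\<^sub>R w x) \<bullet> v x)"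
    unfolding d_form_def inner_diff_left using ci(2)[OF assms(3)] ci(2)[OF assms(4)] by simp
  moreover have "\<bar>LINT x|lebesgue_on \<Omega>. (norm (u x) *\<^sub>R u x - norm (w x) *\<^sub>R w x) \<bullet> v x\<bar> \<le>
      Lp_norm 2 \<omega> \<Omega> h * Lp_norm 2 (inv_weight \<omega>) \<Omega> v"
  proof (rule Lp_pairing_bound(2)[OF assms(1) hL v(1)])
    show "(\<lambda>x. (norm (u x) *\<^sub>R u x - norm (w x) *\<^sub>R w x) \<bullet> v x) \<in> borel_measurable (lebesgue_on \<Omega>)"
      using mu by simp
    fix x
    have "\<bar>(norm (u x) *\<^sub>R u x - norm (w x) *\<^sub>R w x) \<bullet> v x\<bar> \<le> norm (norm (u x) *\<^sub>R u x - norm (w x) *\<^sub>R w x) * norm (v x)"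
      by (rule Cauchy_Schwarz_ineq2)
    also have "\<dots> \<le> norm (h x) * norm (v x)"
      using norm_scaleR_self_diff_bound[of "u x" "w x"] h0[of x] by (intro mult_right_mono) (simp_all add: h_def)
    finally show "\<bar>(norm (u x) *\<^sub>R u x - norm (w x) *\<^sub>R w x) \<bullet> v x\<bar> \<le> norm (h x) * norm (v x)" .
  qed
  ultimately have "\<bar>(c_form \<Omega> u u v + d_form \<Omega> u u v) - (c_form \<Omega> w w v + d_form \<Omega> w w v)\<bar> \<le>
      Lp_norm 2 \<omega> \<Omega> h * (grad_norm (inv_weight \<omega>) \<Omega> v + Lp_norm 2 (inv_weight \<omega>) \<Omega> v)"
    by (simp add: distrib_left)
  also have "\<dots> \<le> (Lp_norm 4 \<omega> \<Omega> u + Lp_norm 4 \<omega> \<Omega> w) * Lp_norm 4 \<omega> \<Omega> (\<lambda>x. u x - w x) *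
      (grad_norm (inv_weight \<omega>) \<Omega> v + Lp_norm 2 (inv_weight \<omega>) \<Omega> v)"
    by (intro mult_right_mono[OF h] add_nonneg_nonneg grad_norm_nonneg Lp_norm_ge_0 weight_on_inv[OF assms(1)])
  finally show ?thesis .
qed

text \<open>The infimum in the definition of the constant is attained, because the inequality persists in
  the limit.\<close>

lemma embedding_constD:
  assumes "weight_on \<Omega> \<omega>" "embedding_const n \<omega> \<Omega> < \<infinity>" "v \<in> H10_vec \<omega> \<Omega>"
  shows "v \<in> Lp n \<omega> \<Omega>" "Lp_norm n \<omega> \<Omega> v \<le> enn2real (embedding_const n \<omega> \<Omega>) * grad_norm \<omega> \<Omega> v"
proof -
  let ?S = "{ennreal C |C. 0 \<le> C \<and>
     (\<forall>v \<in> H10_vec \<omega> \<Omega>. v \<in> Lp n \<omega> \<Omega> \<and> Lp_norm n \<omega> \<Omega> v \<le> C * grad_norm \<omega> \<Omega> v)}"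
  have E: "embedding_const n \<omega> \<Omega> = Inf ?S" by (simp only: embedding_const_def)
  have "?S \<noteq> {}"
  proof
    assume e: "?S = {}"
    have "embedding_const n \<omega> \<Omega> = top" unfolding E e by simp
    then show False using assms(2) by simp
  qed
  then obtain C0 where C0: "0 \<le> C0" "v \<in> Lp n \<omega> \<Omega>" "Lp_norm n \<omega> \<Omega> v \<le> C0 * grad_norm \<omega> \<Omega> v"
    using assms(3) by blast
  show "v \<in> Lp n \<omega> \<Omega>" by (rule C0(2))
  show "Lp_norm n \<omega> \<Omega> v \<le> enn2real (embedding_const n \<omega> \<Omega>) * grad_norm \<omega> \<Omega> v"
  proof (cases "grad_norm \<omega> \<Omega> v = 0")
    case True
    then show ?thesis using C0(3) by simp
  next
    case False
    then have g: "0 < grad_norm \<omega> \<Omega> v" using grad_norm_nonneg[OF assms(1), of v] by simp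
    have "ennreal (Lp_norm n \<omega> \<Omega> v / grad_norm \<omega> \<Omega> v) \<le> Inf ?S"
    proof (rule Inf_greatest)
      fix y assume "y \<in> ?S"
      then obtain C where C: "y = ennreal C" "Lp_norm n \<omega> \<Omega> v \<le> C * grad_norm \<omega> \<Omega> v" using assms(3) by blast
      then show "ennreal (Lp_norm n \<omega> \<Omega> v / grad_norm \<omega> \<Omega> v) \<le> y"
        using g by (auto intro!: ennreal_leI simp: divide_le_eq)
    qed
    then have "ennreal (Lp_norm n \<omega> \<Omega> v / grad_norm \<omega> \<Omega> v) \<le> embedding_const n \<omega> \<Omega>" by (simp only: E)
    then have "enn2real (ennreal (Lp_norm n \<omega> \<Omega> v / grad_norm \<omega> \<Omega> v)) \<le> enn2real (embedding_const n \<omega> \<Omega>)"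
      by (rule enn2real_mono) (use assms(2) in simp)
    moreover have "0 \<le> Lp_norm n \<omega> \<Omega> v / grad_norm \<omega> \<Omega> v" using g Lp_norm_ge_0[OF assms(1), of n v] by simp
    ultimately show ?thesis using g by (simp add: divide_le_eq)
  qed
qed

section \<open>The discrete Brinkman operator\<close>

text \<open>What the error analysis uses of the finite element spaces: they are subspaces of the spaces for
  both weights, since they serve as trial and as test spaces.\<close>

definition discrete_pair :: "scalar \<Rightarrow> (real^2) set \<Rightarrow> vfield set \<Rightarrow> scalar set \<Rightarrow> bool" where
  "discrete_pair \<omega> \<Omega> V P \<longleftrightarrow> V \<subseteq> H10_vec \<omega> \<Omega> \<inter> H10_vec (inv_weight \<omega>) \<Omega> \<and>
     P \<subseteq> L2_zero_mean \<omega> \<Omega> \<inter> L2_zero_mean (inv_weight \<omega>) \<Omega> \<and>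
     (\<forall>a b. \<forall>v\<in>V. \<forall>w\<in>V. lincomb a v b w \<in> V) \<and> (\<forall>a b. \<forall>p\<in>P. \<forall>q\<in>P. lincomb a p b q \<in> P)"

lemma discrete_pairD:
  assumes "discrete_pair \<omega> \<Omega> V P"
  shows "v \<in> V \<Longrightarrow> v \<in> H10_vec \<omega> \<Omega>" "v \<in> V \<Longrightarrow> v \<in> H10_vec (inv_weight \<omega>) \<Omega>"
    "q \<in> P \<Longrightarrow> q \<in> Lp 2 \<omega> \<Omega>" "q \<in> P \<Longrightarrow> q \<in> Lp 2 (inv_weight \<omega>) \<Omega>"
    "v \<in> V \<Longrightarrow> w \<in> V \<Longrightarrow> lincomb a v b w \<in> V" "p \<in> P \<Longrightarrow> q \<in> P \<Longrightarrow> lincomb a p b q \<in> P"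
  using assms unfolding discrete_pair_def L2_zero_mean_def by blast+

lemma lincomb_pair_in:
  assumes "discrete_pair \<omega> \<Omega> V P" "y \<in> V \<times> P" "z \<in> V \<times> P"
  shows "lincomb_pair a y b z \<in> V \<times> P"
  using assms(2,3) discrete_pairD(5,6)[OF assms(1)] by (auto simp: lincomb_pair_def)

lemma brinkman_lincomb_right:
  assumes "weight_on \<Omega> \<omega>" "discrete_pair \<omega> \<Omega> V P" "x \<in> V \<times> P" "y \<in> V \<times> P" "z \<in> V \<times> P"
  shows "brinkman_form \<Omega> x (lincomb_pair a y b z) = a * brinkman_form \<Omega> x y + b * brinkman_form \<Omega> x z"
proof -
  obtain u p v q v' q' where e: "x = (u, p)" "y = (v, q)" "z = (v', q')" by (metis surj_pair)
  note D = discrete_pairD[OF assms(2)]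
  have m: "u \<in> V" "p \<in> P" "v \<in> V" "q \<in> P" "v' \<in> V" "q' \<in> P" using assms(3-5) e by auto
  have b: "b_form \<Omega> u (lincomb a q b q') = a * b_form \<Omega> u q + b * b_form \<Omega> u q'"
    using b_form_lincomb_right[OF weight_on_inv[OF assms(1)], of u q q' a b] D(1)[OF m(1)] D(4)[OF m(4)] D(4)[OF m(6)] by simp
  show ?thesis
    unfolding e brinkman_form_def lincomb_pair_def
    using a_form_lincomb_right[OF assms(1) D(1)[OF m(1)] D(2)[OF m(3)] D(2)[OF m(5)], of a b]
      b_form_lincomb_left[OF assms(1) D(2)[OF m(3)] D(2)[OF m(5)] D(3)[OF m(2)], of a b] b
    by (simp add: algebra_simps)
qed

lemma brinkman_lincomb_left:
  assumes "weight_on \<Omega> \<omega>" "discrete_pair \<omega> \<Omega> V P" "x \<in> V \<times> P" "y \<in> V \<times> P" "z \<in> V \<times> P"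
  shows "brinkman_form \<Omega> (lincomb_pair a y b z) x = a * brinkman_form \<Omega> y x + b * brinkman_form \<Omega> z x"
proof -
  obtain u p v q v' q' where e: "x = (u, p)" "y = (v, q)" "z = (v', q')" by (metis surj_pair)
  note D = discrete_pairD[OF assms(2)]
  have m: "u \<in> V" "p \<in> P" "v \<in> V" "q \<in> P" "v' \<in> V" "q' \<in> P" using assms(3-5) e by auto
  have b: "b_form \<Omega> (lincomb a v b v') p = a * b_form \<Omega> v p + b * b_form \<Omega> v' p"
    using b_form_lincomb_left[OF weight_on_inv[OF assms(1)], of v v' p a b] D(1)[OF m(3)] D(1)[OF m(5)] D(4)[OF m(2)] by simp
  show ?thesis
    unfolding e brinkman_form_def lincomb_pair_def
    using a_form_lincomb_left[OF assms(1) D(1)[OF m(3)] D(1)[OF m(5)] D(2)[OF m(1)], of a b]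
      b_form_lincomb_right[OF assms(1) D(2)[OF m(1)] D(3)[OF m(4)] D(3)[OF m(6)], of a b] b
    by (simp add: algebra_simps)
qed

lemma pair_norm_lincomb:
  assumes "weight_on \<Omega> \<omega>" "discrete_pair \<omega> \<Omega> V P" "y \<in> V \<times> P" "z \<in> V \<times> P"
  shows "pair_norm \<omega> \<Omega> (lincomb_pair a y b z) \<le> \<bar>a\<bar> * pair_norm \<omega> \<Omega> y + \<bar>b\<bar> * pair_norm \<omega> \<Omega> z"
proof -
  note D = discrete_pairD[OF assms(2)]
  have m: "fst y \<in> V" "snd y \<in> P" "fst z \<in> V" "snd z \<in> P" using assms(3,4) by auto
  show ?thesis
    unfolding pair_norm_def lincomb_pair_def fst_conv snd_conv
    using grad_norm_lincomb(2)[OF assms(1) D(1)[OF m(1)] D(1)[OF m(3)], of a b]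
      Lp_lincomb(2)[OF assms(1) D(3)[OF m(2)] D(3)[OF m(4)], of a b]
    by (simp add: lincomb_def distrib_left)
qed

lemma discrete_pair_inv:
  "discrete_pair \<omega> \<Omega> V P \<Longrightarrow> discrete_pair (inv_weight \<omega>) \<Omega> V P"
  unfolding discrete_pair_def inv_inv_weight by blast

text \<open>After scaling, the functional has dual norm at most 1; the chosen preimage differs from the
  given one by an element of the kernel.\<close>

lemma discrete_inverse_bound:
  assumes "weight_on \<Omega> \<omega>" "discrete_pair \<omega> \<Omega> V P" "discrete_invertible \<omega> \<Omega> V P"
    and "y \<in> V \<times> P" "0 \<le> \<kappa>"
    and "\<And>z. z \<in> V \<times> P \<Longrightarrow> \<bar>brinkman_form \<Omega> y z\<bar> \<le> \<kappa> * pair_norm (inv_weight \<omega>) \<Omega> z"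
  shows "ennreal (pair_norm \<omega> \<Omega> y) \<le> discrete_inv_norm \<omega> \<Omega> V P * ennreal \<kappa>"
proof -
  let ?NS = "pair_norm \<omega> \<Omega>" and ?NT = "pair_norm (inv_weight \<omega>) \<Omega>" and ?B = "brinkman_form \<Omega>"
  have kernel: "?NS k = 0" if "k \<in> V \<times> P" "\<And>z. z \<in> V \<times> P \<Longrightarrow> ?B k z = 0" for k
    using assms(3) that unfolding discrete_invertible_def op_invertible_def by blast
  show ?thesis
  proof (cases "\<kappa> = 0")
    case True
    then have "?NS y = 0" using assms(6) by (intro kernel[OF assms(4)]) force
    then show ?thesis by simp
  next
    case False
    then have \<kappa>: "0 < \<kappa>" using assms(5) by simp
    define F where "F z = ?B y z / \<kappa>" for z
    have Fb: "\<bar>F z\<bar> \<le> ?NT z" if "z \<in> V \<times> P" for z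
      using assms(6)[OF that] \<kappa> by (simp add: F_def divide_le_eq mult.commute)
    have Fd: "F \<in> dual_space lincomb_pair (V \<times> P) ?NT"
      unfolding dual_space_def
    proof (intro CollectI conjI allI ballI exI[of _ 1])
      show "F (lincomb_pair a x b z) = a * F x + b * F z" if "x \<in> V \<times> P" "z \<in> V \<times> P" for a b x z
        using brinkman_lincomb_right[OF assms(1,2,4) that, of a b] \<kappa> by (simp add: F_def field_simps)
      show "\<bar>F z\<bar> \<le> 1 * ?NT z" if "z \<in> V \<times> P" for z using Fb[OF that] by simp
    qed
    have Fn: "dual_norm (V \<times> P) ?NT F \<le> 1"
      unfolding dual_norm_def
    proof (rule cSUP_least)
      have "?NT (lincomb_pair 0 y 0 y) \<le> 1"
        using pair_norm_lincomb[OF weight_on_inv[OF assms(1)] discrete_pair_inv[OF assms(2)] assms(4,4), of 0 0] by simp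
      then show "{z \<in> V \<times> P. ?NT z \<le> 1} \<noteq> {}" using lincomb_pair_in[OF assms(2,4,4)] by blast
      show "\<bar>F z\<bar> \<le> 1" if "z \<in> {z \<in> V \<times> P. ?NT z \<le> 1}" for z using Fb[of z] that by auto
    qed
    define y' where "y' = op_inverse (V \<times> P) (V \<times> P) ?B F"
    have "y' \<in> V \<times> P \<and> (\<forall>z \<in> V \<times> P. ?B y' z = F z)"
      unfolding y'_def op_inverse_def
    proof (rule someI)
      show "lincomb_pair (1 / \<kappa>) y 0 y \<in> V \<times> P \<and> (\<forall>z\<in>V \<times> P. ?B (lincomb_pair (1 / \<kappa>) y 0 y) z = F z)"
        using lincomb_pair_in[OF assms(2,4,4)] brinkman_lincomb_left[OF assms(1,2) _ assms(4,4)] by (simp add: F_def)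
    qed
    then have y': "y' \<in> V \<times> P" "\<And>z. z \<in> V \<times> P \<Longrightarrow> ?B y' z = F z" by blast+
    define k where "k = lincomb_pair \<kappa> y' (- 1) y"
    have k: "k \<in> V \<times> P" unfolding k_def by (rule lincomb_pair_in[OF assms(2) y'(1) assms(4)])
    have "?NS k = 0"
    proof (rule kernel[OF k])
      fix z assume z: "z \<in> V \<times> P"
      show "?B k z = 0"
        unfolding k_def brinkman_lincomb_left[OF assms(1,2) z y'(1) assms(4)] y'(2)[OF z] using \<kappa> by (simp add: F_def)
    qed
    moreover have "y = lincomb_pair \<kappa> y' (- 1) k"
      by (simp add: k_def lincomb_pair_def lincomb_def prod_eq_iff)
    ultimately have "?NS y \<le> \<kappa> * ?NS y'"
      using pair_norm_lincomb[OF assms(1,2) y'(1) k, of \<kappa> "- 1"] \<kappa> by simp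
    then have "ennreal (?NS y) \<le> ennreal (\<kappa> * ?NS y')" by (rule ennreal_leI)
    also have "\<dots> = ennreal (?NS y') * ennreal \<kappa>" using \<kappa> by (simp add: ennreal_mult' mult.commute)
    also have "\<dots> \<le> discrete_inv_norm \<omega> \<Omega> V P * ennreal \<kappa>"
    proof (rule mult_right_mono)
      show "ennreal (?NS y') \<le> discrete_inv_norm \<omega> \<Omega> V P"
        unfolding discrete_inv_norm_def op_inverse_norm_def y'_def using Fd Fn by (intro SUP_upper) simp
    qed simp
    finally show ?thesis .
  qed
qed


section \<open>Quasi-best approximation\<close>

text \<open>The difference \<open>y\<close> of the discrete solution and the discrete pair \<open>(w, q)\<close> solves a discrete Brinkman
  problem whose right-hand side consists of the approximation errors \<open>X1\<close>, \<open>X2\<close> and of the difference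
  of the nonlinear terms.  The latter is a multiple of the velocity error \<open>e\<close> and, by the condition
  \<open>small\<close>, can be absorbed.\<close>

lemma error_estimate:
  assumes W: "weight_on \<Omega> \<omega>" and D: "discrete_pair \<omega> \<Omega> V P" and inv: "discrete_invertible \<omega> \<Omega> V P"
    and N: "discrete_inv_norm \<omega> \<Omega> V P \<le> ennreal M" and M: "0 \<le> M"
    and u: "u \<in> H10_vec \<omega> \<Omega>" and p: "p \<in> Lp 2 \<omega> \<Omega>"
    and uT: "uT \<in> V" and pT: "pT \<in> P" and w: "w \<in> V" and q: "q \<in> P"
    and eq: "\<And>v. v \<in> V \<Longrightarrow> a_form \<Omega> u v + b_form \<Omega> v p + c_form \<Omega> u u v + d_form \<Omega> u u v =
      a_form \<Omega> uT v + b_form \<Omega> v pT + c_form \<Omega> uT uT v + d_form \<Omega> uT uT v"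
    and div: "\<And>r. r \<in> P \<Longrightarrow> b_form \<Omega> u r = 0 \<and> b_form \<Omega> uT r = 0"
    and a: "\<And>v. v \<in> V \<Longrightarrow> \<bar>a_form \<Omega> (\<lambda>x. u x - w x) v\<bar> \<le>
      A * grad_norm \<omega> \<Omega> (\<lambda>x. u x - w x) * grad_norm (inv_weight \<omega>) \<Omega> v" and A: "0 \<le> A"
    and nl: "\<And>v. v \<in> V \<Longrightarrow> \<bar>(c_form \<Omega> u u v + d_form \<Omega> u u v) - (c_form \<Omega> uT uT v + d_form \<Omega> uT uT v)\<bar> \<le>
      \<gamma> * grad_norm \<omega> \<Omega> (\<lambda>x. u x - uT x) * grad_norm (inv_weight \<omega>) \<Omega> v" and \<gamma>: "0 \<le> \<gamma>"
    and small: "discrete_inv_norm \<omega> \<Omega> V P * ennreal \<gamma> \<le> ennreal (1 / 2)"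
  shows "grad_norm \<omega> \<Omega> (\<lambda>x. u x - uT x) + Lp_norm 2 \<omega> \<Omega> (\<lambda>x. p x - pT x) \<le>
    2 * (1 + M * (A + 2)) * (grad_norm \<omega> \<Omega> (\<lambda>x. u x - w x) + Lp_norm 2 \<omega> \<Omega> (\<lambda>x. p x - q x))"
proof -
  note Wi = weight_on_inv[OF W] and DD = discrete_pairD[OF D]
  define X1 X2 e where "X1 = grad_norm \<omega> \<Omega> (\<lambda>x. u x - w x)" and "X2 = Lp_norm 2 \<omega> \<Omega> (\<lambda>x. p x - q x)"
    and "e = grad_norm \<omega> \<Omega> (\<lambda>x. u x - uT x)"
  have X: "0 \<le> X1" "0 \<le> X2" "0 \<le> e"
    unfolding X1_def X2_def e_def by (intro grad_norm_nonneg Lp_norm_ge_0 W)+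
  define \<kappa> where "\<kappa> = (A + 2) * (X1 + X2) + \<gamma> * e"
  have \<kappa>: "0 \<le> \<kappa>" unfolding \<kappa>_def using X A \<gamma> by simp
  define y where "y = (lincomb 1 uT (- 1) w, lincomb 1 pT (- 1) q)"
  have y: "y \<in> V \<times> P" unfolding y_def using DD(5)[OF uT w] DD(6)[OF pT q] by simp
  note uL = DD(1)[OF uT] and wL = DD(1)[OF w]
  have bound: "\<bar>brinkman_form \<Omega> y z\<bar> \<le> \<kappa> * pair_norm (inv_weight \<omega>) \<Omega> z" if z: "z \<in> V \<times> P" for z
  proof -
    obtain v r where zv: "z = (v, r)" by (rule prod.exhaust)
    with z have v: "v \<in> V" and r: "r \<in> P" by auto
    note vL = DD(2)[OF v] and rL = DD(4)[OF r]
    have b_left: "b_form \<Omega> (lincomb 1 s (- 1) t) r = b_form \<Omega> s r - b_form \<Omega> t r"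
      if "s \<in> H10_vec \<omega> \<Omega>" "t \<in> H10_vec \<omega> \<Omega>" for s t
      using b_form_lincomb_left[OF Wi, of s t r 1 "- 1"] that rL by simp
    have a_left: "a_form \<Omega> (lincomb 1 s (- 1) t) v = a_form \<Omega> s v - a_form \<Omega> t v"
      if "s \<in> H10_vec \<omega> \<Omega>" "t \<in> H10_vec \<omega> \<Omega>" for s t
      using a_form_lincomb_left[OF W that vL, of 1 "- 1"] by simp
    have b_right: "b_form \<Omega> v (lincomb 1 s (- 1) t) = b_form \<Omega> v s - b_form \<Omega> v t"
      if "s \<in> Lp 2 \<omega> \<Omega>" "t \<in> Lp 2 \<omega> \<Omega>" for s t
      using b_form_lincomb_right[OF W vL that, of 1 "- 1"] by simp
    let ?N = "(c_form \<Omega> u u v + d_form \<Omega> u u v) - (c_form \<Omega> uT uT v + d_form \<Omega> uT uT v)"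
    have split: "brinkman_form \<Omega> y z = a_form \<Omega> (lincomb 1 u (- 1) w) v + b_form \<Omega> v (lincomb 1 p (- 1) q) +
        b_form \<Omega> (lincomb 1 u (- 1) w) r + ?N"
      unfolding zv y_def brinkman_form_def
      using eq[OF v] div[OF r] a_left[OF uL wL] a_left[OF u wL] b_right[OF DD(3)[OF pT] DD(3)[OF q]]
        b_right[OF p DD(3)[OF q]] b_left[OF uL wL] b_left[OF u wL] by simp
    define gv nr where "gv = grad_norm (inv_weight \<omega>) \<Omega> v" and "nr = Lp_norm 2 (inv_weight \<omega>) \<Omega> r"
    have nn: "0 \<le> gv" "0 \<le> nr" unfolding gv_def nr_def by (intro grad_norm_nonneg Lp_norm_ge_0 Wi)+
    have 1: "\<bar>a_form \<Omega> (lincomb 1 u (- 1) w) v\<bar> \<le> A * X1 * gv"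
      using a[OF v] by (simp add: lincomb_diff X1_def gv_def)
    have pq: "lincomb 1 p (- 1) q \<in> Lp 2 \<omega> \<Omega>"
      unfolding lincomb_def by (rule Lp_lincomb(1)[OF W p DD(3)[OF q]])
    have 2: "\<bar>b_form \<Omega> v (lincomb 1 p (- 1) q)\<bar> \<le> 2 * (X2 * gv)"
      using b_form_bound(2)[OF W vL pq] by (simp add: lincomb_diff X2_def gv_def)
    have 3: "\<bar>b_form \<Omega> (lincomb 1 u (- 1) w) r\<bar> \<le> 2 * (nr * X1)"
      using b_form_bound(2)[OF Wi _ rL, of "lincomb 1 u (- 1) w"] H10_vec_lincomb[OF W u wL, of 1 "- 1"]
      by (simp add: lincomb_diff X1_def nr_def)
    have 4: "\<bar>?N\<bar> \<le> \<gamma> * e * gv" using nl[OF v] by (simp add: e_def gv_def)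
    have "\<bar>brinkman_form \<Omega> y z\<bar> \<le> A * X1 * gv + 2 * (X2 * gv) + 2 * (nr * X1) + \<gamma> * e * gv"
      unfolding split using 1 2 3 4 by linarith
    also have "\<dots> \<le> \<kappa> * (gv + nr)"
    proof -
      have "\<kappa> * (gv + nr) - (A * X1 * gv + 2 * (X2 * gv) + 2 * (nr * X1) + \<gamma> * e * gv) =
          A * X2 * gv + 2 * X1 * gv + A * (X1 + X2) * nr + 2 * X2 * nr + \<gamma> * e * nr"
        by (simp add: \<kappa>_def algebra_simps)
      moreover have "0 \<le> A * X2 * gv + 2 * X1 * gv + A * (X1 + X2) * nr + 2 * X2 * nr + \<gamma> * e * nr"
        using X A \<gamma> nn by simp
      ultimately show ?thesis by linarith
    qed
    finally show ?thesis by (simp add: zv pair_norm_def gv_def nr_def)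
  qed
  define d where "d = enn2real (discrete_inv_norm \<omega> \<Omega> V P)"
  have "discrete_inv_norm \<omega> \<Omega> V P < top" using N by (rule le_less_trans) simp
  then have d: "discrete_inv_norm \<omega> \<Omega> V P = ennreal d" "0 \<le> d" by (simp_all add: d_def)
  have dM: "d \<le> M" using N M d by simp
  have d\<gamma>: "d * \<gamma> \<le> 1 / 2"
  proof -
    have "ennreal (d * \<gamma>) \<le> ennreal (1 / 2)" using small d \<gamma> by (simp add: ennreal_mult')
    then show ?thesis by (subst (asm) ennreal_le_iff) auto
  qed
  have "ennreal (pair_norm \<omega> \<Omega> y) \<le> ennreal (d * \<kappa>)"
    using discrete_inverse_bound[OF W D inv y \<kappa> bound] d \<kappa> by (simp add: ennreal_mult')
  then have "pair_norm \<omega> \<Omega> y \<le> d * \<kappa>" using d \<kappa> by (subst (asm) ennreal_le_iff) auto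
  also have "d * \<kappa> = d * ((A + 2) * (X1 + X2)) + d * \<gamma> * e" by (simp add: \<kappa>_def algebra_simps)
  also have "\<dots> \<le> M * ((A + 2) * (X1 + X2)) + 1 / 2 * e"
    using dM d\<gamma> X A by (intro add_mono mult_right_mono) auto
  finally have ny: "pair_norm \<omega> \<Omega> y \<le> M * (A + 2) * (X1 + X2) + e / 2" by simp
  have "e \<le> X1 + grad_norm \<omega> \<Omega> (fst y)"
  proof -
    note l1 = H10_vec_lincomb[OF W u wL, of 1 "- 1"] and l2 = H10_vec_lincomb[OF W uL wL, of 1 "- 1"]
    have "lincomb 1 (lincomb 1 u (- 1) w) (- 1) (lincomb 1 uT (- 1) w) = (\<lambda>x. u x - uT x)"
      by (rule ext) (simp add: lincomb_def)
    then show ?thesis using grad_norm_lincomb(2)[OF W l1 l2, of 1 "- 1"]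
      by (simp add: e_def X1_def y_def lincomb_diff)
  qed
  moreover have "Lp_norm 2 \<omega> \<Omega> (\<lambda>x. p x - pT x) \<le> X2 + Lp_norm 2 \<omega> \<Omega> (snd y)"
  proof -
    have l: "(\<lambda>x. 1 *\<^sub>R p x + (- 1) *\<^sub>R q x) \<in> Lp 2 \<omega> \<Omega>" "(\<lambda>x. 1 *\<^sub>R pT x + (- 1) *\<^sub>R q x) \<in> Lp 2 \<omega> \<Omega>"
      by (rule Lp_lincomb(1)[OF W p DD(3)[OF q]], rule Lp_lincomb(1)[OF W DD(3)[OF pT] DD(3)[OF q]])
    show ?thesis using Lp_lincomb(2)[OF W l, of 1 "- 1"] by (simp add: X2_def y_def lincomb_def)
  qed
  ultimately have "e + Lp_norm 2 \<omega> \<Omega> (\<lambda>x. p x - pT x) \<le> ((X1 + X2) + M * (A + 2) * (X1 + X2)) + e / 2"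
    using ny by (simp add: pair_norm_def)
  moreover have "0 \<le> Lp_norm 2 \<omega> \<Omega> (\<lambda>x. p x - pT x)" by (rule Lp_norm_ge_0[OF W])
  moreover have "s + t \<le> 2 * S" if "s + t \<le> S + s / 2" "0 \<le> t" for s t S :: real using that by simp
  ultimately have "e + Lp_norm 2 \<omega> \<Omega> (\<lambda>x. p x - pT x) \<le> 2 * ((X1 + X2) + M * (A + 2) * (X1 + X2))"
    by blast
  then show ?thesis by (simp add: X1_def X2_def e_def algebra_simps)
qed

text \<open>\<open>c\<close> is the product of the embedding constants, \<open>B\<close> and \<open>D\<close> are the two inverse norms and \<open>F\<close> is
  the size of the data.  The mixed product \<open>B D\<close> is at most the larger of the two squares.\<close>

lemma smallness:
  fixes c B D F g h :: ennreal
  assumes "c * B\<^sup>2 * F < 1 / 6" "c * D\<^sup>2 * F < 1 / 6" "g \<le> 3 / 2 * B * F" "h \<le> 3 / 2 * D * F"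
  shows "D * (c * (g + h)) \<le> ennreal (1 / 2)"
proof -
  have sixth: "(1 / 6 :: ennreal) = ennreal (1 / 6)"
    by (metis divide_ennreal ennreal_1 ennreal_numeral zero_le_one zero_less_numeral)
  have th: "(3 / 2 :: ennreal) = ennreal (3 / 2)"
    by (metis divide_ennreal ennreal_numeral zero_le_numeral zero_less_numeral)
  have DB: "c * (D * B) * F \<le> ennreal (1 / 6)"
  proof (cases "D \<le> B")
    case True
    then have "c * (D * B) * F \<le> c * (B * B) * F" by (intro mult_right_mono mult_left_mono) auto
    also have "\<dots> \<le> ennreal (1 / 6)" using assms(1) sixth by (simp add: power2_eq_square)
    finally show ?thesis .
  next
    case False
    then have "c * (D * B) * F \<le> c * (D * D) * F" by (intro mult_right_mono mult_left_mono) auto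
    also have "\<dots> \<le> ennreal (1 / 6)" using assms(2) sixth by (simp add: power2_eq_square)
    finally show ?thesis .
  qed
  have DD: "c * (D * D) * F \<le> ennreal (1 / 6)" using assms(2) sixth by (simp add: power2_eq_square)
  have "D * (c * (g + h)) \<le> D * (c * (3 / 2 * B * F + 3 / 2 * D * F))"
    by (intro mult_left_mono add_mono assms) auto
  also have "\<dots> = 3 / 2 * (c * (D * B) * F + c * (D * D) * F)"
    by (simp add: distrib_left mult_ac)
  also have "\<dots> \<le> 3 / 2 * (ennreal (1 / 6) + ennreal (1 / 6))"
    by (intro mult_left_mono add_mono DB DD) auto
  also have "\<dots> = ennreal (1 / 2)" unfolding th by (simp flip: ennreal_plus ennreal_mult')
  finally show ?thesis .
qed

lemma le_INF_add:
  fixes g :: "'a \<Rightarrow> real" and h :: "'b \<Rightarrow> real"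
  assumes "V \<noteq> {}" "P \<noteq> {}" "0 < C" "\<And>w q. w \<in> V \<Longrightarrow> q \<in> P \<Longrightarrow> E \<le> C * (g w + h q)"
  shows "E \<le> C * ((INF w\<in>V. g w) + (INF q\<in>P. h q))"
proof -
  have le: "E / C \<le> g w + h q" if "w \<in> V" "q \<in> P" for w q
    using assms(4)[OF that] assms(3) by (simp add: divide_le_eq mult.commute)
  have "E / C - h q \<le> (INF w\<in>V. g w)" if "q \<in> P" for q
    using le[OF _ that] by (intro cINF_greatest[OF assms(1)]) (simp add: diff_le_eq)
  then have "E / C - (INF w\<in>V. g w) \<le> (INF q\<in>P. h q)"
    by (intro cINF_greatest[OF assms(2)]) (simp add: algebra_simps)
  then have "E / C \<le> (INF w\<in>V. g w) + (INF q\<in>P. h q)" by simp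
  then show ?thesis using assms(3) by (simp add: divide_le_eq mult.commute)
qed

text \<open>An infinite embedding constant is compatible with smallness only if the other factors of the
  product vanish, and then the a priori bound forces the velocity to vanish.\<close>

lemma ennreal_product_finite_imp_0:
  fixes b f g :: ennreal
  assumes "top * b\<^sup>2 * f < 1 / 6" "g \<le> 3 / 2 * b * f"
  shows "g = 0"
proof -
  have "top * (b\<^sup>2 * f) \<noteq> top" using assms(1) by (auto simp: mult.assoc)
  then have "b\<^sup>2 * f = 0" by (simp add: ennreal_top_mult split: if_splits)
  then have "b * f = 0" by (auto simp: power2_eq_square)
  then show ?thesis using assms(2) by (auto simp: mult.assoc)
qed

lemma forms_0_AE:
  assumes "AE x in lebesgue_on \<Omega>. u x = 0"
  shows "c_form \<Omega> u u v = 0" "d_form \<Omega> u u v = 0"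
proof -
  have "(LINT x|lebesgue_on \<Omega>. tensor (u x) (u x) \<bullet> grad \<Omega> v x) = 0"
    by (rule integral_eq_zero_AE) (use assms in \<open>eventually_elim, simp add: tensor_def inner_vec_def\<close>)
  then show "c_form \<Omega> u u v = 0" by (simp add: c_form_def)
  show "d_form \<Omega> u u v = 0" unfolding d_form_def
    by (rule integral_eq_zero_AE) (use assms in \<open>eventually_elim, simp\<close>)
qed

text \<open>For vanishing velocities the nonlinear terms disappear, and the general estimate with \<open>w = uT\<close>
  and \<open>A = \<gamma> = 0\<close> leaves only the pressures.\<close>

lemma error_estimate_0:
  assumes W: "weight_on \<Omega> \<omega>" and D: "discrete_pair \<omega> \<Omega> V P" and inv: "discrete_invertible \<omega> \<Omega> V P"
    and N: "discrete_inv_norm \<omega> \<Omega> V P \<le> ennreal M" and M: "0 \<le> M"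
    and u: "u \<in> H10_vec \<omega> \<Omega>" and p: "p \<in> Lp 2 \<omega> \<Omega>"
    and uT: "uT \<in> V" and pT: "pT \<in> P" and q: "q \<in> P"
    and eq: "\<And>v. v \<in> V \<Longrightarrow> a_form \<Omega> u v + b_form \<Omega> v p + c_form \<Omega> u u v + d_form \<Omega> u u v =
      a_form \<Omega> uT v + b_form \<Omega> v pT + c_form \<Omega> uT uT v + d_form \<Omega> uT uT v"
    and div: "\<And>r. r \<in> P \<Longrightarrow> b_form \<Omega> u r = 0 \<and> b_form \<Omega> uT r = 0"
    and zero: "AE x in lebesgue_on \<Omega>. u x = 0" "AE x in lebesgue_on \<Omega>. uT x = 0"
  shows "grad_norm \<omega> \<Omega> (\<lambda>x. u x - uT x) + Lp_norm 2 \<omega> \<Omega> (\<lambda>x. p x - pT x) \<le>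
    2 * (1 + M * 2) * Lp_norm 2 \<omega> \<Omega> (\<lambda>x. p x - q x)"
proof -
  note DD = discrete_pairD[OF D]
  have L: "lincomb 1 u (- 1) uT \<in> H10_vec \<omega> \<Omega>" by (rule H10_vec_lincomb[OF W u DD(1)[OF uT]])
  have z: "AE x in lebesgue_on \<Omega>. lincomb 1 u (- 1) uT x = 0"
    using zero by eventually_elim (simp add: lincomb_def)
  have zg: "AE x in lebesgue_on \<Omega>. grad \<Omega> (lincomb 1 u (- 1) uT) x = 0"
    by (rule H10_vec_0_imp_gradient_0[OF W L z])
  have g0: "grad_norm \<omega> \<Omega> (\<lambda>x. u x - uT x) = 0"
  proof -
    have z: "(\<lambda>x. 0 :: real^2^2) \<in> Lp 2 \<omega> \<Omega>" by (simp add: Lp_def)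
    from Lp_norm_cong(2)[OF W z LpD(1)[OF H10_vec_Lp(2)[OF W L]] zg]
    show ?thesis by (simp add: grad_norm_def lincomb_diff Lp_norm_2)
  qed
  have a0: "a_form \<Omega> (\<lambda>x. u x - uT x) v = 0" for v
  proof -
    have "a_form \<Omega> (lincomb 1 u (- 1) uT) v = 0"
      unfolding a_form_def by (rule integral_eq_zero_AE) (use z zg in \<open>eventually_elim, simp\<close>)
    then show ?thesis by (simp add: lincomb_diff)
  qed
  have "grad_norm \<omega> \<Omega> (\<lambda>x. u x - uT x) + Lp_norm 2 \<omega> \<Omega> (\<lambda>x. p x - pT x) \<le>
    2 * (1 + M * (0 + 2)) * (grad_norm \<omega> \<Omega> (\<lambda>x. u x - uT x) + Lp_norm 2 \<omega> \<Omega> (\<lambda>x. p x - q x))"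
    by (rule error_estimate[OF W D inv N M u p uT pT uT q eq div, where \<gamma> = 0])
      (simp_all add: a0 forms_0_AE[OF zero(1)] forms_0_AE[OF zero(2)])
  then show ?thesis using g0 by simp
qed

theorem theorem5p4:
  fixes \<Omega> :: "(real^2) set" and \<omega> :: "real^2 \<Rightarrow> real"
    and TT :: "mesh set" and V :: "mesh \<Rightarrow> vfield set" and P :: "mesh \<Rightarrow> scalar set"
    and C_B :: real and f :: "vfield \<Rightarrow> real" and u :: vfield and p :: scalar
  assumes "convex_polytope_domain \<Omega>"
    and "A2_on \<Omega> \<omega>"
    and "mesh_family \<Omega> TT"
    and "V = mini_velocity \<Omega> \<or> V = taylor_hood_velocity \<Omega>"
    and "P = pressure_space \<Omega>"
    and "\<forall>\<T> \<in> TT. discrete_invertible \<omega> \<Omega> (V \<T>) (P \<T>)"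
    and "\<exists>M::real. \<forall>\<T> \<in> TT. discrete_inv_norm \<omega> \<Omega> (V \<T>) (P \<T>) \<le> ennreal M"
    and "0 < C_B"
    and "\<forall>\<T> \<in> TT. brinkman_projection_stable \<omega> \<Omega> (V \<T>) (P \<T>) C_B"
    and "f \<in> H_minus1 \<omega> \<Omega>"
    and "C_e \<omega> \<Omega> * (brinkman_inv_norm \<omega> \<Omega>)\<^sup>2 * ennreal (H_minus1_norm \<omega> \<Omega> f) < 1 / 6"
    and "continuous_solution \<omega> \<Omega> f u p"
    and "ennreal (grad_norm \<omega> \<Omega> u) \<le>
           3 / 2 * brinkman_inv_norm \<omega> \<Omega> * ennreal (H_minus1_norm \<omega> \<Omega> f)"
  shows "\<exists>C'>0. \<forall>\<T> \<in> TT. \<forall>uT pT.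
    C_e \<omega> \<Omega> * (discrete_inv_norm \<omega> \<Omega> (V \<T>) (P \<T>))\<^sup>2 * ennreal (H_minus1_norm \<omega> \<Omega> f) < 1 / 6 \<longrightarrow>
    3 * (ennreal C_B * (embedding_const 4 \<omega> \<Omega>)\<^sup>2 * (1 + embedding_const 2 (inv_weight \<omega>) \<Omega>)) / 2
      * ennreal (H_minus1_norm \<omega> \<Omega> f)
      * (brinkman_inv_norm \<omega> \<Omega> + discrete_inv_norm \<omega> \<Omega> (V \<T>) (P \<T>)) < 1 / 2 \<longrightarrow>
    discrete_solution \<Omega> (V \<T>) (P \<T>) f uT pT \<longrightarrow>
    ennreal (grad_norm \<omega> \<Omega> uT) \<le>
      3 / 2 * discrete_inv_norm \<omega> \<Omega> (V \<T>) (P \<T>) * ennreal (H_minus1_norm \<omega> \<Omega> f) \<longrightarrow>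
    grad_norm \<omega> \<Omega> (\<lambda>x. u x - uT x) + Lp_norm 2 \<omega> \<Omega> (\<lambda>x. p x - pT x) \<le>
      C' * ((INF wT \<in> V \<T>. grad_norm \<omega> \<Omega> (\<lambda>x. u x - wT x)) +
            (INF qT \<in> P \<T>. Lp_norm 2 \<omega> \<Omega> (\<lambda>x. p x - qT x)))"
proof -
  have W: "weight_on \<Omega> \<omega>" and near: "bounded_near_frontier \<Omega> \<omega>" "bounded_near_frontier \<Omega> (inv_weight \<omega>)"
    using A2_on_weight_on[OF assms(1,2)] by auto
  note Wi = weight_on_inv[OF W]
  have D: "discrete_pair \<omega> \<Omega> (V \<T>) (P \<T>)" if T: "\<T> \<in> TT" for \<T>
    unfolding discrete_pair_def assms(5)
    using velocity_H10_vec[OF W near(1) assms(3) T assms(4)] velocity_H10_vec[OF Wi near(2) assms(3) T assms(4)]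
      pressure_L2_zero_mean[OF W] pressure_L2_zero_mean[OF Wi]
      velocity_lincomb[OF W assms(4)] pressure_lincomb[OF W]
    by (intro conjI ballI allI subsetI IntI) auto
  obtain M0 where M0: "\<And>\<T>. \<T> \<in> TT \<Longrightarrow> discrete_inv_norm \<omega> \<Omega> (V \<T>) (P \<T>) \<le> ennreal M0"
    using assms(7) by blast
  define M where "M = max M0 0"
  have M: "0 \<le> M" "\<And>\<T>. \<T> \<in> TT \<Longrightarrow> discrete_inv_norm \<omega> \<Omega> (V \<T>) (P \<T>) \<le> ennreal M"
    using M0 order_trans[OF _ ennreal_leI[of M0 M]] by (auto simp: M_def)
  have u: "u \<in> H10_vec \<omega> \<Omega>" and pz: "p \<in> L2_zero_mean \<omega> \<Omega>"
    using assms(12) by (auto simp: continuous_solution_def pair_space_def)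
  have p: "p \<in> Lp 2 \<omega> \<Omega>" using pz by (simp add: L2_zero_mean_def)
  let ?F = "ennreal (H_minus1_norm \<omega> \<Omega> f)" and ?B = "brinkman_inv_norm \<omega> \<Omega>"
    and ?C4 = "embedding_const 4 \<omega> \<Omega>" and ?C2 = "embedding_const 2 (inv_weight \<omega>) \<Omega>"
  have eqs: "a_form \<Omega> u v + b_form \<Omega> v p + c_form \<Omega> u u v + d_form \<Omega> u u v =
        a_form \<Omega> uT v + b_form \<Omega> v pT + c_form \<Omega> uT uT v + d_form \<Omega> uT uT v"
      "b_form \<Omega> u r = 0 \<and> b_form \<Omega> uT r = 0"
    if T: "\<T> \<in> TT" and sol: "discrete_solution \<Omega> (V \<T>) (P \<T>) f uT pT" and v: "v \<in> V \<T>" and r: "r \<in> P \<T>"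
    for \<T> uT pT v r
  proof -
    have "(v, r) \<in> pair_space (inv_weight \<omega>) \<Omega>"
      using D[OF T] v r by (auto simp: discrete_pair_def pair_space_def)
    then have "a_form \<Omega> u v + b_form \<Omega> v p + c_form \<Omega> u u v + d_form \<Omega> u u v = f v \<and> b_form \<Omega> u r = 0"
      using assms(12) unfolding continuous_solution_def by blast
    moreover have "a_form \<Omega> uT v + b_form \<Omega> v pT + c_form \<Omega> uT uT v + d_form \<Omega> uT uT v = f v \<and> b_form \<Omega> uT r = 0"
      using sol v r unfolding discrete_solution_def by blast
    ultimately show "a_form \<Omega> u v + b_form \<Omega> v p + c_form \<Omega> u u v + d_form \<Omega> u u v =
        a_form \<Omega> uT v + b_form \<Omega> v pT + c_form \<Omega> uT uT v + d_form \<Omega> uT uT v"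
      "b_form \<Omega> u r = 0 \<and> b_form \<Omega> uT r = 0" by auto
  qed
  have est: "\<exists>C'>0. \<forall>\<T> \<in> TT. \<forall>uT pT w q.
      C_e \<omega> \<Omega> * (discrete_inv_norm \<omega> \<Omega> (V \<T>) (P \<T>))\<^sup>2 * ?F < 1 / 6 \<longrightarrow>
      discrete_solution \<Omega> (V \<T>) (P \<T>) f uT pT \<longrightarrow>
      ennreal (grad_norm \<omega> \<Omega> uT) \<le> 3 / 2 * discrete_inv_norm \<omega> \<Omega> (V \<T>) (P \<T>) * ?F \<longrightarrow>
      w \<in> V \<T> \<longrightarrow> q \<in> P \<T> \<longrightarrow>
      grad_norm \<omega> \<Omega> (\<lambda>x. u x - uT x) + Lp_norm 2 \<omega> \<Omega> (\<lambda>x. p x - pT x) \<le>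
        C' * (grad_norm \<omega> \<Omega> (\<lambda>x. u x - w x) + Lp_norm 2 \<omega> \<Omega> (\<lambda>x. p x - q x))"
  proof (cases "?C4 < \<infinity> \<and> ?C2 < \<infinity>")
    case True
    define c4 c2 where "c4 = enn2real ?C4" and "c2 = enn2real ?C2"
    have C: "?C4 = ennreal c4" "?C2 = ennreal c2" "0 \<le> c4" "0 \<le> c2" using True by (simp_all add: c4_def c2_def)
    have E4: "v \<in> Lp 4 \<omega> \<Omega>" "Lp_norm 4 \<omega> \<Omega> v \<le> c4 * grad_norm \<omega> \<Omega> v" if "v \<in> H10_vec \<omega> \<Omega>" for v
      using embedding_constD[OF W _ that, of 4] True by (simp_all add: c4_def)
    have E2: "Lp_norm 2 (inv_weight \<omega>) \<Omega> v \<le> c2 * grad_norm (inv_weight \<omega>) \<Omega> v"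
      if "v \<in> H10_vec (inv_weight \<omega>) \<Omega>" for v
      using embedding_constD(2)[OF Wi _ that, of 2] True by (simp add: c2_def)
    \<comment> \<open>The \<open>L\<^sup>4\<close> embedding implies a Poincare inequality for the weight \<open>\<omega>\<close> with constant \<open>k * c4\<close>.\<close>
    define k where "k = Lp_norm 4 \<omega> \<Omega> (\<lambda>_. axis 1 1 :: real^2)"
    have k: "0 \<le> k" unfolding k_def by (rule Lp_norm_ge_0[OF W])
    define A where "A = 1 + k * c4 * c2"
    have A: "0 \<le> A" using k C by (simp add: A_def)
    have a: "\<bar>a_form \<Omega> y v\<bar> \<le> A * grad_norm \<omega> \<Omega> y * grad_norm (inv_weight \<omega>) \<Omega> v"
      if y: "y \<in> H10_vec \<omega> \<Omega>" and v: "v \<in> H10_vec (inv_weight \<omega>) \<Omega>" for y v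
    proof -
      note g = grad_norm_nonneg[OF W, of y] grad_norm_nonneg[OF Wi, of v]
      have "Lp_norm 2 \<omega> \<Omega> y \<le> k * Lp_norm 4 \<omega> \<Omega> y" unfolding k_def by (rule Lp_norm_2_le_Lp_norm_4[OF W E4(1)[OF y]])
      also have "\<dots> \<le> k * (c4 * grad_norm \<omega> \<Omega> y)" by (rule mult_left_mono[OF E4(2)[OF y] k])
      finally have "Lp_norm 2 \<omega> \<Omega> y * Lp_norm 2 (inv_weight \<omega>) \<Omega> v \<le>
          (k * (c4 * grad_norm \<omega> \<Omega> y)) * (c2 * grad_norm (inv_weight \<omega>) \<Omega> v)"
        using E2[OF v] k C g by (intro mult_mono Lp_norm_ge_0[OF Wi]) auto
      then show ?thesis using a_form_integrable(3)[OF W y v] by (simp add: A_def algebra_simps)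
    qed
    show ?thesis
    proof (intro exI[of _ "2 * (1 + M * (A + 2))"] conjI ballI allI impI)
      show "0 < 2 * (1 + M * (A + 2))" using M(1) A by (simp add: add_pos_nonneg)
      fix \<T> uT pT w q
      assume T: "\<T> \<in> TT" and s1: "C_e \<omega> \<Omega> * (discrete_inv_norm \<omega> \<Omega> (V \<T>) (P \<T>))\<^sup>2 * ?F < 1 / 6"
        and sol: "discrete_solution \<Omega> (V \<T>) (P \<T>) f uT pT"
        and s2: "ennreal (grad_norm \<omega> \<Omega> uT) \<le> 3 / 2 * discrete_inv_norm \<omega> \<Omega> (V \<T>) (P \<T>) * ?F"
        and w: "w \<in> V \<T>" and q: "q \<in> P \<T>"
      note Dp = D[OF T] and DD = discrete_pairD[OF D[OF T]]
      have uT: "uT \<in> V \<T>" and pT: "pT \<in> P \<T>" using sol by (auto simp: discrete_solution_def)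
      note uTH = DD(1)[OF uT]
      define gu guT where "gu = grad_norm \<omega> \<Omega> u" and "guT = grad_norm \<omega> \<Omega> uT"
      have g: "0 \<le> gu" "0 \<le> guT" unfolding gu_def guT_def by (intro grad_norm_nonneg W)+
      define \<gamma> where "\<gamma> = c4\<^sup>2 * (1 + c2) * (gu + guT)"
      have \<gamma>: "0 \<le> \<gamma>" using C g by (simp add: \<gamma>_def)
      have Ce: "C_e \<omega> \<Omega> = ennreal (c4\<^sup>2 * (1 + c2))"
        using C(3,4) by (simp add: C_e_def C(1,2) ennreal_mult' ennreal_power flip: ennreal_1 ennreal_plus)
      have small: "discrete_inv_norm \<omega> \<Omega> (V \<T>) (P \<T>) * ennreal \<gamma> \<le> ennreal (1 / 2)"
      proof -
        have "ennreal \<gamma> = C_e \<omega> \<Omega> * (ennreal gu + ennreal guT)"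
          unfolding \<gamma>_def Ce using g C(3,4) by (simp add: ennreal_mult' flip: ennreal_plus)
        then show ?thesis using smallness[OF assms(11) s1 assms(13) s2] by (simp add: gu_def guT_def)
      qed
      have dL: "(\<lambda>x. u x - uT x) \<in> H10_vec \<omega> \<Omega>"
        using H10_vec_lincomb[OF W u uTH, of 1 "- 1"] by (simp add: lincomb_diff)
      have nl: "\<bar>(c_form \<Omega> u u v + d_form \<Omega> u u v) - (c_form \<Omega> uT uT v + d_form \<Omega> uT uT v)\<bar> \<le>
          \<gamma> * grad_norm \<omega> \<Omega> (\<lambda>x. u x - uT x) * grad_norm (inv_weight \<omega>) \<Omega> v" if v: "v \<in> V \<T>" for v
      proof -
        note vH = DD(2)[OF v]
        let ?e = "grad_norm \<omega> \<Omega> (\<lambda>x. u x - uT x)" and ?v = "grad_norm (inv_weight \<omega>) \<Omega> v"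
        have nn: "0 \<le> ?e" "0 \<le> ?v" by (intro grad_norm_nonneg W Wi)+
        have "(Lp_norm 4 \<omega> \<Omega> u + Lp_norm 4 \<omega> \<Omega> uT) * Lp_norm 4 \<omega> \<Omega> (\<lambda>x. u x - uT x) *
            (?v + Lp_norm 2 (inv_weight \<omega>) \<Omega> v) \<le> (c4 * gu + c4 * guT) * (c4 * ?e) * (?v + c2 * ?v)"
          using E4(2)[OF u] E4(2)[OF uTH] E4(2)[OF dL] E2[OF vH] C g nn
          by (intro mult_mono add_mono mult_nonneg_nonneg add_nonneg_nonneg Lp_norm_ge_0 W Wi) (auto simp: gu_def guT_def)
        also have "\<dots> = \<gamma> * ?e * ?v" by (simp add: \<gamma>_def power2_eq_square algebra_simps)
        finally show ?thesis
          using nonlinear_difference_bound[OF W vH E4(1)[OF u] E4(1)[OF uTH] E4(1)[OF dL]] by linarith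
      qed
      have a': "\<bar>a_form \<Omega> (\<lambda>x. u x - w x) v\<bar> \<le>
          A * grad_norm \<omega> \<Omega> (\<lambda>x. u x - w x) * grad_norm (inv_weight \<omega>) \<Omega> v" if v: "v \<in> V \<T>" for v
        using a[OF _ DD(2)[OF v], of "\<lambda>x. u x - w x"] H10_vec_lincomb[OF W u DD(1)[OF w], of 1 "- 1"]
        by (simp add: lincomb_diff)
      show "grad_norm \<omega> \<Omega> (\<lambda>x. u x - uT x) + Lp_norm 2 \<omega> \<Omega> (\<lambda>x. p x - pT x) \<le>
          2 * (1 + M * (A + 2)) * (grad_norm \<omega> \<Omega> (\<lambda>x. u x - w x) + Lp_norm 2 \<omega> \<Omega> (\<lambda>x. p x - q x))"
        by (rule error_estimate[OF W Dp bspec[OF assms(6) T] M(2)[OF T] M(1) u p uT pT w q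
              eqs(1)[OF T sol _ pT] eqs(2)[OF T sol uT] a' A nl \<gamma> small])
    qed
  next
    case False
    \<comment> \<open>An infinite constant makes \<open>C_e\<close> infinite, except that \<open>0 * \<infinity> = 0\<close>; but a constant zero for the
      \<open>L\<^sup>4\<close> embedding also forces the velocities to vanish.\<close>
    have zero: "AE x in lebesgue_on \<Omega>. z x = 0"
      if z: "z \<in> H10_vec \<omega> \<Omega>" and b: "C_e \<omega> \<Omega> * b\<^sup>2 * ?F < 1 / 6" "ennreal (grad_norm \<omega> \<Omega> z) \<le> 3 / 2 * b * ?F"
      for z b
    proof (cases "?C4 = 0")
      case True
      have "Lp_norm 2 \<omega> \<Omega> z \<le> 0"
        using Lp_norm_2_le_Lp_norm_4[OF W embedding_constD(1)[OF W _ z, of 4]]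
          embedding_constD(2)[OF W _ z, of 4] True Lp_norm_ge_0[OF W, of 4 z] by simp
      then have "Lp_norm 2 \<omega> \<Omega> z = 0" using Lp_norm_ge_0[OF W, of 2 z] by simp
      then show ?thesis by (rule Lp_norm_0_AE[OF W H10_vec_Lp(1)[OF W z]])
    next
      case C4: False
      have "C_e \<omega> \<Omega> = top"
      proof -
        have "?C4 = top \<or> ?C2 = top" using False by (metis infinity_ennreal_def top.not_eq_extremum)
        then show ?thesis using C4 by (auto simp: C_e_def ennreal_mult_eq_top_iff power2_eq_square)
      qed
      then have "ennreal (grad_norm \<omega> \<Omega> z) = 0"
        using ennreal_product_finite_imp_0[OF _ b(2)] b(1) by simp
      then have "grad_norm \<omega> \<Omega> z = 0" using grad_norm_nonneg[OF W, of z] by (simp add: ennreal_eq_0_iff)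
      then show ?thesis by (rule H10_vec_gradient_0_imp_0(1)[OF W z])
    qed
    show ?thesis
    proof (intro exI[of _ "2 * (1 + M * 2)"] conjI ballI allI impI)
      show "0 < 2 * (1 + M * 2)" using M(1) by simp
      fix \<T> uT pT w q
      assume T: "\<T> \<in> TT" and s1: "C_e \<omega> \<Omega> * (discrete_inv_norm \<omega> \<Omega> (V \<T>) (P \<T>))\<^sup>2 * ?F < 1 / 6"
        and sol: "discrete_solution \<Omega> (V \<T>) (P \<T>) f uT pT"
        and s2: "ennreal (grad_norm \<omega> \<Omega> uT) \<le> 3 / 2 * discrete_inv_norm \<omega> \<Omega> (V \<T>) (P \<T>) * ?F"
        and w: "w \<in> V \<T>" and q: "q \<in> P \<T>"
      note DD = discrete_pairD[OF D[OF T]]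
      have uT: "uT \<in> V \<T>" and pT: "pT \<in> P \<T>" using sol by (auto simp: discrete_solution_def)
      have "grad_norm \<omega> \<Omega> (\<lambda>x. u x - uT x) + Lp_norm 2 \<omega> \<Omega> (\<lambda>x. p x - pT x) \<le>
          2 * (1 + M * 2) * Lp_norm 2 \<omega> \<Omega> (\<lambda>x. p x - q x)"
        by (rule error_estimate_0[OF W D[OF T] bspec[OF assms(6) T] M(2)[OF T] M(1) u p uT pT q
              eqs(1)[OF T sol _ pT] eqs(2)[OF T sol uT] zero[OF u assms(11,13)] zero[OF DD(1)[OF uT] s1 s2]])
      also have "\<dots> \<le> 2 * (1 + M * 2) * (grad_norm \<omega> \<Omega> (\<lambda>x. u x - w x) + Lp_norm 2 \<omega> \<Omega> (\<lambda>x. p x - q x))"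
        using M(1) grad_norm_nonneg[OF W] by (intro mult_left_mono) auto
      finally show "grad_norm \<omega> \<Omega> (\<lambda>x. u x - uT x) + Lp_norm 2 \<omega> \<Omega> (\<lambda>x. p x - pT x) \<le>
          2 * (1 + M * 2) * (grad_norm \<omega> \<Omega> (\<lambda>x. u x - w x) + Lp_norm 2 \<omega> \<Omega> (\<lambda>x. p x - q x))" .
    qed
  qed
  then obtain C' where C': "0 < C'" "\<And>\<T> uT pT w q. \<T> \<in> TT \<Longrightarrow>
      C_e \<omega> \<Omega> * (discrete_inv_norm \<omega> \<Omega> (V \<T>) (P \<T>))\<^sup>2 * ?F < 1 / 6 \<Longrightarrow>
      discrete_solution \<Omega> (V \<T>) (P \<T>) f uT pT \<Longrightarrow>
      ennreal (grad_norm \<omega> \<Omega> uT) \<le> 3 / 2 * discrete_inv_norm \<omega> \<Omega> (V \<T>) (P \<T>) * ?F \<Longrightarrow>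
      w \<in> V \<T> \<Longrightarrow> q \<in> P \<T> \<Longrightarrow>
      grad_norm \<omega> \<Omega> (\<lambda>x. u x - uT x) + Lp_norm 2 \<omega> \<Omega> (\<lambda>x. p x - pT x) \<le>
        C' * (grad_norm \<omega> \<Omega> (\<lambda>x. u x - w x) + Lp_norm 2 \<omega> \<Omega> (\<lambda>x. p x - q x))" by blast
  show ?thesis
  proof (intro exI[of _ C'] conjI ballI allI impI C'(1))
    fix \<T> uT pT
    assume T: "\<T> \<in> TT" and s1: "C_e \<omega> \<Omega> * (discrete_inv_norm \<omega> \<Omega> (V \<T>) (P \<T>))\<^sup>2 * ?F < 1 / 6"
      and sol: "discrete_solution \<Omega> (V \<T>) (P \<T>) f uT pT"
      and s2: "ennreal (grad_norm \<omega> \<Omega> uT) \<le> 3 / 2 * discrete_inv_norm \<omega> \<Omega> (V \<T>) (P \<T>) * ?F"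
    show "grad_norm \<omega> \<Omega> (\<lambda>x. u x - uT x) + Lp_norm 2 \<omega> \<Omega> (\<lambda>x. p x - pT x) \<le>
        C' * ((INF wT \<in> V \<T>. grad_norm \<omega> \<Omega> (\<lambda>x. u x - wT x)) +
              (INF qT \<in> P \<T>. Lp_norm 2 \<omega> \<Omega> (\<lambda>x. p x - qT x)))"
    proof (rule le_INF_add[OF _ _ C'(1)])
      show "V \<T> \<noteq> {}" "P \<T> \<noteq> {}" using sol by (auto simp: discrete_solution_def)
    qed (rule C'(2)[OF T s1 sol s2])
  qed
qed

end
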